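(* Let $d,m\ge 1$ be integers, $n=d+m$, let $A\in\mathbb{R}^{(d+1)\times m}$ and let $\mathcal{L}=\{(\bm{x},\widetilde{\bm{x}}A)\mid \bm{x}\in\mathbb{R}^d\}\subset\mathbb{R}^n$, where $\widetilde{\bm{x}}=(1,\bm{x})$. Suppose that $\omega(A)=\omega<n$, and let $s$ be a real number with $$\frac{d+1-m\tau_0}{\tau_0+1}<s\le d,\qquad\text{where}\qquad \tau_0:=\frac{1}{\max\{m,\omega\}}.$$ Then for any decreasing function $\psi:\mathbb{N}\to\mathbb{R}_{>0}$ we have $$\mathcal{H}^s(\mathcal{S}_n(\psi)\cap\mathcal{L})=\begin{cases}0&\text{when }\sum_{q}\psi(q)^{m+s}q^{d-s}<\infty;\\ \infty&\text{when }\sum_{q}\psi(q)^{m+s}q^{d-s}=\infty.\end{cases}$$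
   Context: Vectors are row vectors; $|\cdot|$ is the supremum norm; $\|\bm{y}\|$ is the sup-norm distance of $\bm{y}$ to the nearest integer vector (also for column vectors). "Decreasing" means non-increasing. $\mathcal{H}^s$ is $s$-dimensional Hausdorff measure. The diophantine exponent $\omega(A)$ of a real matrix $A$ with $m$ columns is the supremum of all $\omega\in\mathbb{R}$ such that $\|A\bm{q}^{\mathrm T}\|<|\bm{q}|^{-\omega}$ holds for infinitely many $\bm{q}\in\mathbb{Z}^m$. $\mathcal{S}_n(\psi)=\{\bm{y}\in\mathbb{R}^n:\|q\bm{y}\|<\psi(q)\text{ for infinitely many }q\in\mathbb{N}\}$. *)

theory Defs
  imports "HOL-Analysis.Analysis"
begin

definition int_vectors :: "(real ^ 'n::finite) set" where
  "int_vectors = {p. \<forall>i. p $ i \<in> \<int>}"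

definition nearest_int_dist :: "real ^ 'n::finite \<Rightarrow> real" where
  "nearest_int_dist y = (INF p\<in>int_vectors. infnorm (y - p))"

text \<open>The supremum is taken in the extended reals, since the exponent may be infinite.\<close>

definition diophantine_exponent :: "real ^ 'm::finite ^ 'r::finite \<Rightarrow> ereal" where
  "diophantine_exponent A =
     (SUP w\<in>{w::real. infinite {q \<in> int_vectors. q \<noteq> 0 \<and>
        nearest_int_dist (A *v q) < infnorm q powr (- w)}}. ereal w)"

definition approximable :: "(nat \<Rightarrow> real) \<Rightarrow> (real ^ 'n::finite) set" where
  "approximable \<psi> =
     {y. infinite {q::nat. q \<ge> 1 \<and> nearest_int_dist (real q *\<^sub>R y) < \<psi> q}}"

text \<open>
  The index type of a concatenation is the sum of the index types, and the \<open>d + 1\<close>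
  coordinates of \<open>(1, x)\<close> are indexed by \<open>'d option\<close>, with \<open>None\<close> for the leading \<open>1\<close>.
\<close>

definition vec_append :: "real ^ 'd::finite \<Rightarrow> real ^ 'm::finite \<Rightarrow> real ^ ('d + 'm)" where
  "vec_append x z = (\<chi> k. case k of Inl i \<Rightarrow> x $ i | Inr j \<Rightarrow> z $ j)"

definition cons_one :: "real ^ 'd::finite \<Rightarrow> real ^ 'd option" where
  "cons_one x = (\<chi> k. case k of None \<Rightarrow> 1 | Some i \<Rightarrow> x $ i)"

definition affine_graph :: "real ^ 'm::finite ^ ('d::finite) option \<Rightarrow> (real ^ ('d + 'm)) set" where
  "affine_graph A = {vec_append x (cons_one x v* A) | x. True}"

text \<open>
  Hausdorff measure for the metric of the type (Euclidean on \<open>real ^ 'n\<close>), without a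
  normalising constant. Since \<open>0 powr 0 = 0\<close>, the exponent \<open>0\<close> is treated separately so
  that the \<open>0\<close>-dimensional measure is counting measure. Covering sets are required to be
  bounded because \<open>diameter\<close> is meaningful only for bounded sets.
\<close>

definition diam_power :: "real \<Rightarrow> 'a::metric_space set \<Rightarrow> ennreal" where
  "diam_power s U =
     (if U = {} then 0 else if s = 0 then 1 else ennreal (diameter U powr s))"

definition hausdorff_content :: "real \<Rightarrow> real \<Rightarrow> 'a::metric_space set \<Rightarrow> ennreal" where
  "hausdorff_content s \<delta> E =
     (INF U\<in>{U :: nat \<Rightarrow> 'a set. E \<subseteq> (\<Union>i. U i) \<and> (\<forall>i. bounded (U i) \<and> diameter (U i) \<le> \<delta>)}.
        \<Sum>i. diam_power s (U i))"

definition hausdorff_measure :: "real \<Rightarrow> 'a::metric_space set \<Rightarrow> ennreal" where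
  "hausdorff_measure s E = (SUP \<delta>\<in>{0<..}. hausdorff_content s \<delta> E)"

end

theory Submission
  imports Defs
begin

text \<open>
  If \<open>A j\<close> is never too close to an integer vector, then the points \<open>(q, a) A\<close> are well
  distributed modulo one down to the scale \<open>Q\<^sup>-\<^sup>\<tau>\<close>: the trigonometric polynomial over those
  \<open>(q, a)\<close> with \<open>(q, a) A\<close> nearly integral is large near every \<open>A j\<close>, so Parseval bounds the
  number of its terms. This gives the expected upper bound for the number of rational points near the
  subspace. Since \<open>s\<close> exceeds the stated bound, \<open>\<psi>\<close> may be compared with
  \<open>q\<^sup>-\<^sup>\<tau>\<close>, and the convergence case follows from the obvious cover.

  For divergence, Dirichlet's pigeonhole argument places a rational point close to every point
  of the subspace, and the counting bound shows that its denominator is usually large; hence the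
  rational points with denominator about \<open>2\<^sup>k\<close> contain well-separated sets of the expected size in
  every ball. A cover of finite \<open>s\<close>-cost would leave some ball lightly covered, and inside a lightly
  covered ball there is always a smaller lightly covered ball around one of the rational points.
  Iterating, one finds an uncovered point of the limsup set. The argument treats \<open>s < d\<close> and
  \<open>s = d\<close> alike.
\<close>

section \<open>Covering and packing by balls\<close>

text \<open>The hypothesis on \<open>s\<close> says that the critical exponent (d + 1 - s)/(m + s)
  is below \<open>\<tau>\<^sub>0\<close>, and \<omega> < n says that some \<open>s\<close> up to d
  satisfies it. For an exponent \<open>\<tau>1\<close> strictly between, the series belonging to
  q^(-\<open>\<tau>1\<close>) converges, so the scales at which \<psi> is smaller are negligible in
  both cases. The counting bound reaches down to thickness q^(-\<tau>) for \<tau> <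
  \<open>\<tau>\<^sub>0\<close>: while \<omega> \<tau> < 1, an integer vector j of size up to
  N^\<tau> keeps \<open>A *v j\<close> at distance more than a multiple of 1/N from the integers,
  and m \<tau> < 1 makes the expected number of points grow. In the divergence case the covering
  sets have all sizes, and points of different levels may cluster. Lightness is therefore measured
  by d-th powers: the selected points are spread like volume, so a set of size t can spoil only a
  share t^d of a window, plus about one point per level, which is a geometric sum of order t^s. The
  finite s-cost pays for the latter.\<close>

definition separated :: "real \<Rightarrow> 'a::metric_space set \<Rightarrow> bool" where
  "separated \<rho> P \<longleftrightarrow> pairwise (\<lambda>x y. disjnt (cball x (\<rho>/2)) (cball y (\<rho>/2))) P"

text \<open>Finite Vitali selection: a ball of largest radius is kept, the balls meeting it are
  discarded, and induction handles the rest. The proviso \<open>t x \<ge> 0\<close> excludes empty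
  balls, which do not even meet themselves. For constant \<open>t\<close> the result is a maximal
  separated set.\<close>

lemma greedy_disjoint_cballs:
  fixes c :: "'i \<Rightarrow> 'a::metric_space" and t :: "'i \<Rightarrow> real"
  assumes "finite X"
  obtains C where "C \<subseteq> X" "pairwise (\<lambda>x y. disjnt (cball (c x) (t x)) (cball (c y) (t y))) C"
    "\<And>x. x \<in> X \<Longrightarrow> t x \<ge> 0 \<Longrightarrow> \<exists>y\<in>C. t x \<le> t y \<and> \<not> disjnt (cball (c x) (t x)) (cball (c y) (t y))"
proof -
  let ?d = "\<lambda>x y. disjnt (cball (c x) (t x)) (cball (c y) (t y))"
  have "\<exists>C\<subseteq>X. pairwise ?d C \<and> (\<forall>x\<in>X. t x \<ge> 0 \<longrightarrow> (\<exists>y\<in>C. t x \<le> t y \<and> \<not> ?d x y))"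
    using assms
  proof (induction X rule: finite_psubset_induct)
    case (psubset X)
    show ?case
    proof (cases "X = {}")
      case True
      then show ?thesis by auto
    next
      case False
      then obtain m where m: "m \<in> X" "\<And>x. x \<in> X \<Longrightarrow> t x \<le> t m"
      proof -
        have "Max (t ` X) \<in> t ` X" using psubset.hyps False by simp
        then obtain m where "m \<in> X" "t m = Max (t ` X)" by auto
        then show ?thesis using psubset.hyps by (intro that[of m]) auto
      qed
      let ?X' = "{x \<in> X. x \<noteq> m \<and> ?d x m}"
      have "?X' \<subset> X" using m by auto
      then obtain C where C: "C \<subseteq> ?X'" "pairwise ?d C"
        "\<And>x. x \<in> ?X' \<Longrightarrow> t x \<ge> 0 \<Longrightarrow> \<exists>y\<in>C. t x \<le> t y \<and> \<not> ?d x y"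
        using psubset.IH[of ?X'] by meson
      have "pairwise ?d (insert m C)"
        unfolding pairwise_insert using C by (auto simp: disjnt_sym)
      moreover have "\<exists>y\<in>insert m C. t x \<le> t y \<and> \<not> ?d x y" if x: "x \<in> X" "t x \<ge> 0" for x
      proof (cases "x \<in> ?X'")
        case True
        then show ?thesis using C(3) x by blast
      next
        case False
        then have "\<not> ?d x m" using x m by (cases "x = m") (auto simp: disjnt_iff intro!: exI[of _ "c m"])
        then show ?thesis using m x by blast
      qed
      ultimately show ?thesis using C m
        by (intro exI[of _ "insert m C"]) auto
    qed
  qed
  then show ?thesis using that by meson
qed

lemma cball_cover_power_le:
  fixes x :: "'a::euclidean_space"
  assumes "finite F" "R \<ge> 0" "\<And>i. i \<in> F \<Longrightarrow> t i \<ge> 0"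
    and cov: "cball x R \<subseteq> (\<Union>i\<in>F. cball (a i) (t i))"
  shows "R ^ DIM('a) \<le> (\<Sum>i\<in>F. t i ^ DIM('a))"
proof -
  let ?u = "unit_ball_vol (real DIM('a))"
  have "?u * R ^ DIM('a) = measure lebesgue (cball x R)"
    using assms by (simp add: content_cball)
  also have "\<dots> \<le> measure lebesgue (\<Union>i\<in>F. cball (a i) (t i))"
    using cov assms by (intro measure_mono_fmeasurable) (auto intro!: fmeasurable.finite_UN)
  also have "\<dots> \<le> (\<Sum>i\<in>F. measure lebesgue (cball (a i) (t i)))"
    using assms by (intro measure_UNION_le) auto
  also have "\<dots> = ?u * (\<Sum>i\<in>F. t i ^ DIM('a))"
    using assms by (simp add: content_cball sum_distrib_left)
  finally show ?thesis using unit_ball_vol_pos[of "real DIM('a)"] by simp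
qed

lemma card_packing_le:
  fixes z :: "'a::euclidean_space"
  assumes "finite P" "P \<subseteq> cball z T" "\<rho> > 0" "T \<ge> 0"
    and sep: "separated \<rho> P"
  shows "real (card P) \<le> (1 + 2 * T / \<rho>) ^ DIM('a)"
proof -
  let ?u = "unit_ball_vol (real DIM('a))"
  have "real (card P) * (?u * (\<rho>/2) ^ DIM('a)) = (\<Sum>p\<in>P. measure lebesgue (cball p (\<rho>/2)))"
    using assms by (simp add: content_cball)
  also have "\<dots> = measure lebesgue (\<Union>p\<in>P. cball p (\<rho>/2))"
    using sep[unfolded separated_def] assms by (intro measure_UNION'[symmetric]) auto
  also have "\<dots> \<le> measure lebesgue (cball z (T + \<rho>/2))"
  proof (rule measure_mono_fmeasurable)
    show "(\<Union>p\<in>P. cball p (\<rho>/2)) \<subseteq> cball z (T + \<rho>/2)"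
    proof
      fix y assume "y \<in> (\<Union>p\<in>P. cball p (\<rho>/2))"
      then obtain p where "p \<in> P" "dist p y \<le> \<rho>/2" by auto
      then show "y \<in> cball z (T + \<rho>/2)" using assms(2) dist_triangle[of z y p] by auto
    qed
    show "(\<Union>p\<in>P. cball p (\<rho>/2)) \<in> sets lebesgue"
      using assms by (intro sets.finite_UN) auto
  qed auto
  also have "\<dots> = ?u * (T + \<rho>/2) ^ DIM('a)" using assms by (simp add: content_cball)
  finally have "real (card P) * (\<rho>/2) ^ DIM('a) \<le> (T + \<rho>/2) ^ DIM('a)"
    using unit_ball_vol_pos[of "real DIM('a)"] by (simp add: mult.left_commute)
  then have "real (card P) \<le> ((T + \<rho>/2) / (\<rho>/2)) ^ DIM('a)"
    unfolding power_divide[of "T + \<rho>/2"] using assms by (subst pos_le_divide_eq) auto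
  also have "(T + \<rho>/2) / (\<rho>/2) = 1 + 2 * T / \<rho>" using assms by (simp add: field_simps)
  finally show ?thesis .
qed

section \<open>Limsup sets of balls cannot be covered cheaply\<close>

text \<open>
  The weight \<open>u j\<close> stands for the diameter of \<open>U j\<close>, enlarged so as to be positive also for
  singletons.
\<close>

definition light :: "(nat \<Rightarrow> 'a::euclidean_space set) \<Rightarrow> (nat \<Rightarrow> real) \<Rightarrow> real \<Rightarrow> 'a \<Rightarrow> real \<Rightarrow> bool" where
  "light U u \<epsilon> x R \<longleftrightarrow>
     (\<forall>F. finite F \<longrightarrow> (\<forall>j\<in>F. U j \<inter> cball x R \<noteq> {}) \<longrightarrow> (\<Sum>j\<in>F. u j ^ DIM('a)) \<le> \<epsilon> * R ^ DIM('a))"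

text \<open>Up to a constant, \<open>R ^ DIM('a) / \<rho> ^ DIM('a)\<close> is the largest size of a
  \<rho>-separated set in the ball when \<rho> is at most \<open>R\<close>, so \<open>c\<close> is
  the share of the possible points that is reached.\<close>

definition rich_in :: "'a::euclidean_space set \<Rightarrow> real \<Rightarrow> real \<Rightarrow> 'a \<Rightarrow> real \<Rightarrow> bool" where
  "rich_in P \<rho> c x R \<longleftrightarrow> (\<exists>Q\<subseteq>P \<inter> cball x R. finite Q \<and> separated \<rho> Q \<and>
     c * R ^ DIM('a) / \<rho> ^ DIM('a) \<le> real (card Q))"

lemma sum_le_sum_cover:
  fixes w :: "'b \<Rightarrow> real"
  assumes "finite T" "finite F" "T \<subseteq> (\<Union>i\<in>F. Q i)" "\<And>x. w x \<ge> 0"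
  shows "sum w T \<le> (\<Sum>i\<in>F. sum w (T \<inter> Q i))"
  using assms(2,1,3)
proof (induction F arbitrary: T rule: finite_induct)
  case empty
  then show ?case by simp
next
  case (insert i F)
  have "sum w T = sum w (T \<inter> Q i) + sum w (T - Q i)"
    using insert.prems by (intro sum.Int_Diff) auto
  also have "sum w (T - Q i) \<le> (\<Sum>i'\<in>F. sum w ((T - Q i) \<inter> Q i'))"
    using insert.prems by (intro insert.IH) auto
  also have "\<dots> \<le> (\<Sum>i'\<in>F. sum w (T \<inter> Q i'))"
    using insert.prems assms(4) by (intro sum_mono sum_mono2) auto
  finally show ?case using insert.hyps by simp
qed

lemma sum_fst_Sigma:
  fixes f :: "'b \<Rightarrow> real"
  assumes "finite W" "\<And>k. k \<in> W \<Longrightarrow> finite (Q k)"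
  shows "(\<Sum>y\<in>Sigma W Q. f (fst y)) = (\<Sum>k\<in>W. f k * real (card (Q k)))"
  using sum.Sigma[of W Q "\<lambda>k _. f k"] assms by (simp add: case_prod_beta mult.commute)

text \<open>A location hit once by each level of radius at most \<open>t\<close> collects this sum.
  Halving from level to level makes it comparable to its first term, hence to
  \<open>t powr s\<close>.\<close>

lemma sum_geometric_decay_le:
  fixes r :: "nat \<Rightarrow> real"
  assumes W: "finite W" and s: "s > 0"
    and pos: "\<And>k. k \<in> W \<Longrightarrow> r k > 0"
    and decay: "\<And>k k'. k \<in> W \<Longrightarrow> k' \<in> W \<Longrightarrow> k \<le> k' \<Longrightarrow> r k' \<le> r k / 2 ^ (k' - k)"
    and le: "\<And>k. k \<in> W \<Longrightarrow> r k \<le> t"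
  shows "(\<Sum>k\<in>W. r k powr s) \<le> t powr s / (1 - 2 powr (- s))"
proof (cases "W = {}")
  case True
  then show ?thesis using s by (auto simp: powr_minus_divide ge_one_powr_ge_zero intro!: divide_nonneg_nonneg)
next
  case False
  define k0 where "k0 = Min W"
  have k0: "k0 \<in> W" "\<And>k. k \<in> W \<Longrightarrow> k0 \<le> k" using W False by (auto simp: k0_def)
  have t: "t > 0" using pos[OF k0(1)] le[OF k0(1)] by simp
  have q: "2 powr (- s) < (1::real)" "(0::real) < 2 powr (-s)" using s by (auto simp: powr_less_one)
  have "(\<Sum>k\<in>W. r k powr s) \<le> (\<Sum>k\<in>W. t powr s * (2 powr (-s)) ^ (k - k0))"
  proof (rule sum_mono)
    fix k assume k: "k \<in> W"
    have "r k \<le> r k0 / 2 ^ (k - k0)" using decay k0 k by blast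
    also have "\<dots> \<le> t / 2 ^ (k - k0)" using le[OF k0(1)] by (intro divide_right_mono) auto
    finally have "r k powr s \<le> (t / 2 ^ (k - k0)) powr s"
      using pos[OF k] s by (intro powr_mono2) auto
    also have "\<dots> = t powr s * (2 powr (-s)) ^ (k - k0)"
      using t by (simp add: powr_divide powr_minus_divide power_divide powr_power powr_powr flip: powr_realpow)
        (simp add: mult.commute powr_powr flip: powr_realpow)
    finally show "r k powr s \<le> t powr s * (2 powr (-s)) ^ (k - k0)" .
  qed
  also have "\<dots> = t powr s * (\<Sum>i\<in>(\<lambda>k. k - k0) ` W. (2 powr (-s)) ^ i)"
    using k0 by (subst sum.reindex) (auto simp: sum_distrib_left intro!: inj_on_diff_nat)
  also have "(\<Sum>i\<in>(\<lambda>k. k - k0) ` W. (2 powr (-s)) ^ i) \<le> (\<Sum>i. (2 powr (-s)) ^ i)"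
    using W q by (intro sum_le_suminf summable_geometric) auto
  also have "\<dots> = 1 / (1 - 2 powr (-s))" using q by (intro suminf_geometric) auto
  finally show ?thesis using t by (simp add: mult_left_mono)
qed

lemma summable_tail_finite_sums:
  fixes f :: "nat \<Rightarrow> real"
  assumes "summable f" "\<And>j. f j \<ge> 0" "\<eta> > 0"
  obtains J where "\<And>F. finite F \<Longrightarrow> (\<And>j. j \<in> F \<Longrightarrow> j \<ge> J) \<Longrightarrow> sum f F \<le> \<eta>"
proof -
  obtain J where J: "\<And>n. n \<ge> J \<Longrightarrow> norm (\<Sum>i. f (i + n)) < \<eta>"
    using suminf_exist_split[OF assms(3,1)] by blast
  show ?thesis
  proof (rule that[of J])
    fix F :: "nat set" assume F: "finite F" "\<And>j. j \<in> F \<Longrightarrow> j \<ge> J"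
    have "sum f F = (\<Sum>i\<in>(\<lambda>j. j - J) ` F. f (i + J))"
      using F by (subst sum.reindex) (auto simp: inj_on_def eq_diff_iff)
    also have "\<dots> \<le> (\<Sum>i. f (i + J))"
      using F assms by (intro sum_le_suminf) (auto simp: summable_iff_shift)
    also have "\<dots> \<le> \<eta>" using J[of J] by (auto simp: abs_less_iff)
    finally show "sum f F \<le> \<eta>" .
  qed
qed

text \<open>The summand 1 accounts for the point that even a tiny ball may contain. The radius is
  \<open>4 * t\<close> because this is the enlargement that Vitali selection produces below; 9 comes
  from 1 + 8 t/\<rho> \<le> 9 max(1, t/\<rho>).\<close>

lemma card_separated_le:
  fixes z :: "'a::euclidean_space"
  assumes "finite P" "\<rho> > 0" "t \<ge> 0"
    and sep: "separated \<rho> P"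
  shows "real (card (P \<inter> cball z (4 * t))) \<le> 9 ^ DIM('a) * (1 + t ^ DIM('a) / \<rho> ^ DIM('a))"
proof -
  have "real (card (P \<inter> cball z (4 * t))) \<le> (1 + 2 * (4 * t) / \<rho>) ^ DIM('a)"
    using assms by (intro card_packing_le[of _ z]) (auto simp: separated_def intro: pairwise_subset)
  also have "\<dots> \<le> (9 * max 1 (t / \<rho>)) ^ DIM('a)"
    using assms by (intro power_mono) (auto simp: max_def field_simps)
  also have "\<dots> \<le> 9 ^ DIM('a) * (1 + t ^ DIM('a) / \<rho> ^ DIM('a))"
    using assms by (auto simp: max_def power_mult_distrib power_divide)
  finally show ?thesis .
qed

text \<open>
  If every ball of a window were heavily covered, then each would lie close to a set that is at
  least as large: either a big covering set, or (Vitali) one of disjoint balls, each of which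
  carries a large share of the tail of the cover. These large sets are too few to be close to all
  balls of the window.
\<close>

lemma light_step:
  fixes U :: "nat \<Rightarrow> 'a::euclidean_space set" and P :: "nat \<Rightarrow> 'a set" and r \<rho> :: "nat \<Rightarrow> real"
  assumes s: "0 < s" "s \<le> real DIM('a)"
    and u: "\<And>j. 0 < u j" "\<And>j. u j \<le> 1" "summable (\<lambda>j. u j powr s)"
    and diam: "\<And>j a b. a \<in> U j \<Longrightarrow> b \<in> U j \<Longrightarrow> dist a b \<le> u j"
    and r: "\<And>k. k \<in> I \<Longrightarrow> 0 < r k" "\<And>k. k \<in> I \<Longrightarrow> r k \<le> 1 / 2 ^ k"
    and decay: "\<And>k k'. k \<in> I \<Longrightarrow> k' \<in> I \<Longrightarrow> k \<le> k' \<Longrightarrow> r k' \<le> r k / 2 ^ (k' - k)"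
    and \<rho>: "\<And>k. k \<in> I \<Longrightarrow> 0 < \<rho> k"
    and diverge: "\<And>K. \<exists>W\<subseteq>I. finite W \<and> (\<forall>k\<in>W. K \<le> k) \<and> 1 \<le> (\<Sum>k\<in>W. r k powr s / \<rho> k ^ DIM('a))"
    and c: "c > 0" and \<epsilon>: "\<epsilon> = c / (4 * 18 ^ DIM('a))"
    and rich: "\<And>k. k \<in> I \<Longrightarrow> k \<ge> K \<Longrightarrow> rich_in (P k) (\<rho> k) c x (R/2)"
    and R: "0 < R" and light: "light U u \<epsilon> x R"
  shows "\<exists>k\<in>I. k \<ge> K \<and> (\<exists>p\<in>P k. cball p (r k) \<subseteq> cball x R \<and> light U u \<epsilon> p (r k))"
proof (rule ccontr)
  assume neg: "\<not> ?thesis"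
  let ?D = "DIM('a)"
  define C :: real where "C = 9 ^ ?D"
  have C: "C > 0" by (simp add: C_def)
  define G where "G = 1 / (1 - 2 powr (- s))"
  have "2 powr (-s) < (1::real)" using s by (auto simp: powr_less_one)
  then have G: "G > 0" by (simp add: G_def)
  \<comment> \<open>\<open>B * S\<close> will bound the total weight of the window from below,
    because each level has its share of points in the half ball. The constants are chosen so that
    three upper contributions are at most \<open>B / 4\<close> each, relative to \<open>S\<close>;
    the factor \<open>18 ^ ?D\<close> in \<epsilon> absorbs \<open>C\<close> and the halving of
    \<open>R\<close>.\<close>
  define B where "B = c * (R/2) ^ ?D"
  have B: "B > 0" using c R by (simp add: B_def)
  have eps: "\<epsilon> > 0" using c by (simp add: \<epsilon>)
  have "(18::real) ^ ?D = 2 ^ ?D * 9 ^ ?D" by (simp flip: power_mult_distrib)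
  then have C\<epsilon>: "C * (\<epsilon> * R ^ ?D) = B / 4"
    by (simp add: \<epsilon> B_def C_def power_divide field_simps)
  define \<eta> where "\<eta> = B / (4 * C * (1 + G) * (1 + 1 / \<epsilon>))"
  have \<eta>: "\<eta> > 0" using B C G eps unfolding \<eta>_def by (intro divide_pos_pos mult_pos_pos add_pos_pos) auto
  have C\<eta>: "C * (1 + G) * (\<eta> * (1 + 1 / \<epsilon>)) = B / 4"
  proof -
    have "C * Y * (B / (4 * C * Y * X) * X) = B / 4" if "X > 0" "Y > 0" for X Y
      using that C by (simp add: field_simps)
    from this[of "1 + 1 / \<epsilon>" "1 + G"] show ?thesis
      using G eps unfolding \<eta>_def by (simp add: add_pos_pos)
  qed
  obtain J where J: "\<And>F. finite F \<Longrightarrow> (\<And>j. j \<in> F \<Longrightarrow> j \<ge> J) \<Longrightarrow> (\<Sum>j\<in>F. u j powr s) \<le> \<eta>"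
    using summable_tail_finite_sums[OF u(3) _ \<eta>] by auto
  define \<gamma> where "\<gamma> = (B / (4 * C * G * (real J + 1))) powr (1/s)"
  have \<gamma>: "\<gamma> > 0" using B C G by (auto simp: \<gamma>_def)
  \<comment> \<open>Window radii will be below \<beta>. Being below \<open>R / 2\<close> keeps the
    balls inside \<open>cball x R\<close>, being below \<gamma> makes the first \<open>J\<close>
    covering sets cheap, and being below \<open>u j\<close> for \<open>j < J\<close> ensures that
    only tail sets can be smaller than such a ball.\<close>
  define \<beta> where "\<beta> = Min (insert (R/2) (insert \<gamma> (u ` {..<J})))"
  have \<beta>: "\<beta> > 0" "\<beta> \<le> R/2" "\<beta> \<le> \<gamma>" "\<And>j. j < J \<Longrightarrow> \<beta> \<le> u j"
  proof -
    show "\<beta> > 0" using R \<gamma> u(1) unfolding \<beta>_def by (subst Min_gr_iff) auto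
    show "\<beta> \<le> R/2" "\<beta> \<le> \<gamma>" unfolding \<beta>_def by (rule Min_le; simp)+
    show "\<beta> \<le> u j" if "j < J" for j unfolding \<beta>_def using that by (intro Min_le) auto
  qed
  have CJ: "C * (G * (real J * \<beta> powr s)) \<le> B / 4"
  proof -
    have "\<beta> powr s \<le> \<gamma> powr s" using \<beta> s by (intro powr_mono2) auto
    also have "\<gamma> powr s = B / (4 * C * G * (real J + 1))"
      using s B C G by (simp add: \<gamma>_def powr_powr)
    finally have "C * (G * (real J * \<beta> powr s)) \<le> C * (G * ((real J + 1) * (B / (4 * C * G * (real J + 1)))))"
      using C G B by (intro mult_left_mono mult_mono) auto
    also have "\<dots> = B / 4"
    proof -
      have eq: "C * (G * (X * (B / (4 * C * G * X)))) = B / 4" if "X > 0" for X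
      proof -
        have "C * (G * (X * (B / (4 * C * G * X)))) = (C * G * X) * B / (4 * (C * G * X))" by (simp add: mult_ac)
        also have "\<dots> = B / 4" using that C G by simp
        finally show ?thesis .
      qed
      show ?thesis by (rule eq) (simp add: add_nonneg_pos)
    qed
    finally show ?thesis .
  qed
  obtain K1 where K1: "K1 \<ge> K" "1 / 2 ^ K1 < \<beta>"
  proof -
    obtain n where n: "(1/2::real) ^ n < \<beta>" using real_arch_pow_inv[of \<beta> "1/2"] \<beta> by auto
    have "(1/2::real) ^ max n K \<le> (1/2) ^ n" by (intro power_decreasing) auto
    then show ?thesis using that[of "max n K"] n by (auto simp: power_one_over)
  qed
  obtain W where W: "W \<subseteq> I" "finite W" "\<And>k. k \<in> W \<Longrightarrow> K1 \<le> k" "1 \<le> (\<Sum>k\<in>W. r k powr s / \<rho> k ^ ?D)"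
    using diverge[of K1] by auto
  define S where "S = (\<Sum>k\<in>W. r k powr s / \<rho> k ^ ?D)"
  have S: "S \<ge> 1" using W by (simp add: S_def)
  have r\<beta>: "r k \<le> \<beta>" if "k \<in> W" for k
  proof -
    have "r k \<le> 1 / 2 ^ k" using that W r by auto
    also have "\<dots> \<le> 1 / 2 ^ K1" using W(3)[OF that] by (intro divide_left_mono power_increasing) auto
    finally show ?thesis using K1 by simp
  qed
  have WI: "k \<in> I" "0 < r k" "0 < \<rho> k" if "k \<in> W" for k using that W r \<rho> by auto
  have "\<forall>k\<in>W. \<exists>Q\<subseteq>P k \<inter> cball x (R/2). finite Q \<and> separated (\<rho> k) Q \<and>
      c * (R/2) ^ ?D / \<rho> k ^ ?D \<le> real (card Q)"
    using W K1 WI by (intro ballI rich[unfolded rich_in_def]) (auto intro: order.trans)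
  from bchoice[OF this] obtain Q where "\<forall>k\<in>W. Q k \<subseteq> P k \<inter> cball x (R/2) \<and> finite (Q k) \<and>
      separated (\<rho> k) (Q k) \<and> c * (R/2) ^ ?D / \<rho> k ^ ?D \<le> real (card (Q k))" by blast
  then have Q: "Q k \<subseteq> P k \<inter> cball x (R/2)" "finite (Q k)" "separated (\<rho> k) (Q k)"
    "c * (R/2) ^ ?D / \<rho> k ^ ?D \<le> real (card (Q k))" if "k \<in> W" for k
    using that by blast+
  define T where "T = Sigma W Q"
  define wt where "wt y = r (fst y) powr s" for y :: "nat \<times> 'a"
  have wt0: "wt y \<ge> 0" for y by (simp add: wt_def)
  have finT: "finite T" unfolding T_def using W Q by auto
  have sub: "cball p (r k) \<subseteq> cball x R" if "(k, p) \<in> T" for k p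
  proof -
    have "dist x p \<le> R/2" "r k \<le> R/2" using that Q(1)[of k] r\<beta>[of k] \<beta>(2) by (auto simp: T_def)
    show ?thesis
    proof
      fix y assume "y \<in> cball p (r k)"
      then have "dist p y \<le> r k" by simp
      then have "dist x y \<le> R"
        using dist_triangle[of x y p] \<open>dist x p \<le> R/2\<close> \<open>r k \<le> R/2\<close> by linarith
      then show "y \<in> cball x R" by simp
    qed
  qed
  have bad: "\<exists>F. finite F \<and> (\<forall>j\<in>F. U j \<inter> cball p (r k) \<noteq> {}) \<and> \<epsilon> * r k ^ ?D < (\<Sum>j\<in>F. u j ^ ?D)"
    if kp: "(k, p) \<in> T" for k p
  proof -
    have "\<not> light U u \<epsilon> p (r k)"
      using neg sub[OF kp] kp Q(1)[of k] WI[of k] W(3)[of k] K1 by (auto simp: T_def)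
    then show ?thesis unfolding light_def by (auto simp: not_le)
  qed
  \<comment> \<open>\<open>T1\<close> collects the points whose ball meets a covering set at least
    as large as the ball. For points of \<open>T2\<close>, every covering set meeting the ball is
    smaller than it.\<close>
  define T1 where "T1 = {y \<in> T. \<exists>j. U j \<inter> cball (snd y) (r (fst y)) \<noteq> {} \<and> r (fst y) \<le> u j}"
  define T2 where "T2 = T - T1"
  have "\<forall>y\<in>T1. \<exists>j. U j \<inter> cball (snd y) (r (fst y)) \<noteq> {} \<and> r (fst y) \<le> u j"
    unfolding T1_def by blast
  from bchoice[OF this] obtain jj where
    jj: "\<And>y. y \<in> T1 \<Longrightarrow> U (jj y) \<inter> cball (snd y) (r (fst y)) \<noteq> {} \<and> r (fst y) \<le> u (jj y)" by blast
  define F1 where "F1 = jj ` T1"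
  have finF1: "finite F1" using finT by (auto simp: F1_def T1_def)
  define z where "z j = (SOME a. a \<in> U j)" for j
  have zU: "z j \<in> U j" if j: "j \<in> F1" for j
  proof -
    obtain y where "y \<in> T1" "j = jj y" using j unfolding F1_def by blast
    then have "U j \<noteq> {}" using jj by blast
    then show ?thesis by (simp add: z_def some_in_eq)
  qed
  have finT2: "finite T2" using finT by (simp add: T2_def)
  \<comment> \<open>A covering set smaller than a ball it meets lies in the ball of doubled radius.
    Disjointness of the doubled balls thus prevents two chosen balls from sharing a covering
    set.\<close>
  obtain D where D: "D \<subseteq> T2"
      "pairwise (\<lambda>y y'. disjnt (cball (snd y) (2 * r (fst y))) (cball (snd y') (2 * r (fst y')))) D"
      "\<And>y. y \<in> T2 \<Longrightarrow> 2 * r (fst y) \<ge> 0 \<Longrightarrow> \<exists>y'\<in>D. 2 * r (fst y) \<le> 2 * r (fst y') \<and>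
          \<not> disjnt (cball (snd y) (2 * r (fst y))) (cball (snd y') (2 * r (fst y')))"
    using greedy_disjoint_cballs[OF finT2, where c = snd and t = "\<lambda>y. 2 * r (fst y)"] by blast
  have finD: "finite D" using D(1) finT2 by (rule finite_subset)
  define E where "E a t = {y. r (fst y) \<le> t \<and> snd y \<in> cball a (4 * t)}" for a :: 'a and t
  have cover: "T1 \<subseteq> (\<Union>j\<in>F1. E (z j) (u j))" "T2 \<subseteq> (\<Union>y\<in>D. E (snd y) (r (fst y)))"
  proof -
    show "T1 \<subseteq> (\<Union>j\<in>F1. E (z j) (u j))"
    proof
      fix y assume y: "y \<in> T1"
      let ?j = "jj y"
      have j: "?j \<in> F1" using y by (auto simp: F1_def)
      obtain b where b: "b \<in> U ?j" "dist (snd y) b \<le> r (fst y)" using jj[OF y] by auto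
      have "dist (z ?j) (snd y) \<le> dist (z ?j) b + dist b (snd y)" by (rule dist_triangle)
      also have "\<dots> \<le> u ?j + r (fst y)" using diam[OF zU[OF j] b(1)] b(2) by (simp add: dist_commute)
      also have "\<dots> \<le> 4 * u ?j" using jj[OF y] u(1)[of ?j] by simp
      finally show "y \<in> (\<Union>j\<in>F1. E (z j) (u j))" using j jj[OF y] by (auto simp: E_def)
    qed
    show "T2 \<subseteq> (\<Union>y\<in>D. E (snd y) (r (fst y)))"
    proof
      fix y assume y: "y \<in> T2"
      then have "r (fst y) > 0" using WI by (auto simp: T2_def T_def)
      then obtain y' where y': "y' \<in> D" "r (fst y) \<le> r (fst y')"
          "\<not> disjnt (cball (snd y) (2 * r (fst y))) (cball (snd y') (2 * r (fst y')))"
        using D(3)[OF y] by auto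
      then obtain b where "dist (snd y) b \<le> 2 * r (fst y)" "dist (snd y') b \<le> 2 * r (fst y')"
        by (auto simp: disjnt_iff)
      then have "dist (snd y') (snd y) \<le> 4 * r (fst y')"
        using dist_triangle[of "snd y'" "snd y" b] y'(2) by (simp add: dist_commute)
      then show "y \<in> (\<Union>y\<in>D. E (snd y) (r (fst y)))" using y' by (auto simp: E_def)
    qed
  qed
  let ?\<Gamma> = "\<lambda>t. \<Sum>k\<in>{k\<in>W. r k \<le> t}. r k powr s"
  \<comment> \<open>Each level has at most \<open>C * (1 + t ^ ?D / \<rho> k ^ ?D)\<close> points
    near a set of size \<open>t\<close>. Weighted by \<open>r k powr s\<close>, the 1 gives the
    geometric part and the quotient gives a share \<open>t ^ ?D\<close> of \<open>S\<close>.\<close>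
  have count: "sum wt (T' \<inter> E a t) \<le> C * (?\<Gamma> t + t ^ ?D * S)"
    if t: "t \<ge> 0" and T': "T' \<subseteq> T" for a t T'
  proof -
    have "T \<inter> E a t = Sigma {k\<in>W. r k \<le> t} (\<lambda>k. Q k \<inter> cball a (4 * t))"
      unfolding T_def E_def by auto
    then have "sum wt (T \<inter> E a t) = (\<Sum>k\<in>{k\<in>W. r k \<le> t}. r k powr s * real (card (Q k \<inter> cball a (4 * t))))"
      unfolding wt_def using W(2) Q(2) by (simp only:) (intro sum_fst_Sigma, auto)
    also have "\<dots> \<le> (\<Sum>k\<in>{k\<in>W. r k \<le> t}. r k powr s * (C * (1 + t ^ ?D / \<rho> k ^ ?D)))"
      unfolding C_def using Q WI t by (intro sum_mono mult_left_mono card_separated_le) auto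
    also have "\<dots> = C * (?\<Gamma> t + t ^ ?D * (\<Sum>k\<in>{k\<in>W. r k \<le> t}. r k powr s / \<rho> k ^ ?D))"
      by (simp add: sum_distrib_left algebra_simps sum.distrib)
    also have "\<dots> \<le> C * (?\<Gamma> t + t ^ ?D * S)"
      unfolding S_def using C t W WI
      by (intro mult_left_mono add_left_mono sum_mono2) (auto intro: less_imp_le)
    finally have "sum wt (T \<inter> E a t) \<le> C * (?\<Gamma> t + t ^ ?D * S)" .
    moreover have "sum wt (T' \<inter> E a t) \<le> sum wt (T \<inter> E a t)"
      using finT T' wt0 by (intro sum_mono2) auto
    ultimately show ?thesis by simp
  qed
  have geo_le: "(\<Sum>k\<in>X. r k powr s) \<le> G * t powr s" if X: "X \<subseteq> W" "\<And>k. k \<in> X \<Longrightarrow> r k \<le> t" for X t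
  proof -
    have "(\<Sum>k\<in>X. r k powr s) \<le> t powr s / (1 - 2 powr (- s))"
    proof (rule sum_geometric_decay_le)
      show "finite X" using X(1) W(2) by (rule finite_subset)
      show "r k > 0" if "k \<in> X" for k using WI(2) X(1) that by blast
      show "r k' \<le> r k / 2 ^ (k' - k)" if "k \<in> X" "k' \<in> X" "k \<le> k'" for k k'
        using that X(1) WI(1) by (intro decay) blast+
    qed (use s X(2) in blast)+
    then show ?thesis by (simp add: G_def)
  qed
  have geo: "?\<Gamma> t \<le> G * t powr s" for t by (rule geo_le) auto
  have geo\<beta>: "?\<Gamma> t \<le> G * \<beta> powr s" for t
    by (rule geo_le) (use r\<beta> in blast)+
  have "B * S = (\<Sum>k\<in>W. r k powr s * (c * (R/2) ^ ?D / \<rho> k ^ ?D))"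
    by (simp add: B_def S_def sum_distrib_left mult_ac)
  also have "\<dots> \<le> (\<Sum>k\<in>W. r k powr s * real (card (Q k)))"
    using Q(4) by (intro sum_mono mult_left_mono) auto
  also have "\<dots> = sum wt T" 
    unfolding T_def wt_def using W(2) Q(2) by (intro sum_fst_Sigma[symmetric]) auto
  also have "\<dots> = sum wt T1 + sum wt T2"
    using sum.subset_diff[of T1 T wt] finT by (auto simp: T2_def T1_def)
  finally have main: "B * S \<le> sum wt T1 + sum wt T2" .
  have T1le: "sum wt T1 \<le> C * S * (G * (real J * \<beta> powr s) + \<epsilon> * R ^ ?D + (1 + G) * \<eta>)"
  proof -
    have "sum wt T1 \<le> (\<Sum>j\<in>F1. sum wt (T1 \<inter> E (z j) (u j)))"
      using cover finF1 finT wt0 by (intro sum_le_sum_cover) (auto simp: T1_def)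
    also have "\<dots> \<le> (\<Sum>j\<in>F1. C * (?\<Gamma> (u j) + u j ^ ?D * S))"
      using u(1) by (intro sum_mono count) (auto simp: T1_def less_imp_le)
    also have "\<dots> = C * ((\<Sum>j\<in>F1. ?\<Gamma> (u j)) + (\<Sum>j\<in>F1. u j ^ ?D) * S)"
      by (simp only: sum_distrib_left[symmetric] sum_distrib_right sum.distrib)
    also have "(\<Sum>j\<in>F1. u j ^ ?D) \<le> \<epsilon> * R ^ ?D"
    proof -
      have "U j \<inter> cball x R \<noteq> {}" if j: "j \<in> F1" for j
      proof -
        obtain y where y: "y \<in> T1" "j = jj y" using j unfolding F1_def by blast
        have "cball (snd y) (r (fst y)) \<subseteq> cball x R" using y sub[of "fst y" "snd y"] by (auto simp: T1_def)
        then show ?thesis using jj[OF y(1)] y(2) by blast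
      qed
      then show ?thesis using light finF1 unfolding light_def by blast
    qed
    \<comment> \<open>Lightness has paid for the volume part. In the geometric part, the first
      \<open>J\<close> sets are cheap because all radii are below \<beta>, and the others have total
      s-cost at most \<eta>.\<close>
    also have "(\<Sum>j\<in>F1. ?\<Gamma> (u j))
        = (\<Sum>j\<in>F1 \<inter> {..<J}. ?\<Gamma> (u j)) + (\<Sum>j\<in>F1 - {..<J}. ?\<Gamma> (u j))"
      using finF1 by (rule sum.Int_Diff)
    also have "(\<Sum>j\<in>F1 \<inter> {..<J}. ?\<Gamma> (u j)) \<le> (\<Sum>j\<in>F1 \<inter> {..<J}. G * \<beta> powr s)"
      by (intro sum_mono geo\<beta>)
    also have "\<dots> = real (card (F1 \<inter> {..<J})) * (G * \<beta> powr s)" by simp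
    also have "\<dots> \<le> real J * (G * \<beta> powr s)"
      using G card_mono[of "{..<J}" "F1 \<inter> {..<J}"] by (intro mult_right_mono) auto
    also have "(\<Sum>j\<in>F1 - {..<J}. ?\<Gamma> (u j)) \<le> (\<Sum>j\<in>F1 - {..<J}. G * u j powr s)"
      by (intro sum_mono geo)
    also have "\<dots> = G * (\<Sum>j\<in>F1 - {..<J}. u j powr s)" by (simp add: sum_distrib_left)
    also have "\<dots> \<le> G * \<eta>" using G finF1 by (intro mult_left_mono J) auto
    finally have "sum wt T1 \<le> C * (real J * (G * \<beta> powr s) + G * \<eta> + \<epsilon> * R ^ ?D * S)"
      using C S by simp
    also have "\<dots> \<le> C * (S * (real J * (G * \<beta> powr s)) + S * ((1 + G) * \<eta>) + \<epsilon> * R ^ ?D * S)"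
    proof -
      have "1 * (real J * (G * \<beta> powr s)) \<le> S * (real J * (G * \<beta> powr s))"
        using S G by (intro mult_right_mono) auto
      moreover have "1 * (G * \<eta>) \<le> S * ((1 + G) * \<eta>)"
        using S G \<eta> by (intro mult_mono) auto
      ultimately show ?thesis using C by (intro mult_left_mono[OF _ less_imp_le[OF C]]) linarith
    qed
    finally show ?thesis by (simp add: algebra_simps)
  qed
  \<comment> \<open>Failure of lightness is a statement about d-th powers. All sets involved are
    smaller than the ball, so the ratio \<open>u j / r\<close> is below 1 and passing to the smaller
    exponent \<open>s\<close> only increases its power; the tail is then charged in s-cost.\<close>
  have heavy: "\<exists>F. finite F \<and> (\<forall>j\<in>F. j \<ge> J \<and> U j \<inter> cball (snd y) (r (fst y)) \<noteq> {} \<and> u j < r (fst y)) \<and>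
      \<epsilon> * r (fst y) powr s \<le> (\<Sum>j\<in>F. u j powr s)" if y: "y \<in> D" for y
  proof -
    let ?r = "r (fst y)"
    have yT: "(fst y, snd y) \<in> T" and yT1: "y \<notin> T1" "y \<in> T" using y D by (auto simp: T2_def)
    have r0: "?r > 0" "?r \<le> \<beta>" using yT WI r\<beta> by (auto simp: T_def)
    obtain F where F: "finite F" "\<And>j. j \<in> F \<Longrightarrow> U j \<inter> cball (snd y) ?r \<noteq> {}" "\<epsilon> * ?r ^ ?D < (\<Sum>j\<in>F. u j ^ ?D)"
      using bad[OF yT] by blast
    have ur: "u j < ?r" if "j \<in> F" for j
      using yT1 F(2)[OF that] unfolding T1_def by (auto simp: not_le)
    have jJ: "j \<ge> J" if "j \<in> F" for j
      using ur[OF that] r0 \<beta>(4)[of j] by (cases "j < J") auto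
    have "\<epsilon> * ?r powr s = \<epsilon> * ?r ^ ?D * (?r powr s / ?r ^ ?D)" using r0 by simp
    also have "\<dots> \<le> (\<Sum>j\<in>F. u j ^ ?D) * (?r powr s / ?r ^ ?D)"
      using F(3) r0 by (intro mult_right_mono) auto
    also have "\<dots> = (\<Sum>j\<in>F. (u j / ?r) ^ ?D * ?r powr s)"
      unfolding sum_distrib_right by (intro sum.cong) (auto simp: power_divide)
    also have "\<dots> \<le> (\<Sum>j\<in>F. u j powr s)"
    proof (rule sum_mono)
      fix j assume j: "j \<in> F"
      have "(u j / ?r) ^ ?D = (u j / ?r) powr real ?D" using u(1)[of j] r0 by (simp add: powr_realpow)
      also have "\<dots> \<le> (u j / ?r) powr s"
        using s u(1)[of j] r0 ur[OF j] by (intro powr_mono') auto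
      also have "\<dots> = u j powr s / ?r powr s" using u(1)[of j] r0 by (simp add: powr_divide)
      finally show "(u j / ?r) ^ ?D * ?r powr s \<le> u j powr s" using r0 by (simp add: field_simps)
    qed
    finally show ?thesis using F ur jJ by blast
  qed
  then have "\<forall>y\<in>D. \<exists>F. finite F \<and> (\<forall>j\<in>F. j \<ge> J \<and> U j \<inter> cball (snd y) (r (fst y)) \<noteq> {} \<and> u j < r (fst y)) \<and>
      \<epsilon> * r (fst y) powr s \<le> (\<Sum>j\<in>F. u j powr s)" by blast
  from bchoice[OF this] obtain FF where FF: "\<And>y. y \<in> D \<Longrightarrow> finite (FF y)"
      "\<And>y j. y \<in> D \<Longrightarrow> j \<in> FF y \<Longrightarrow> j \<ge> J \<and> U j \<inter> cball (snd y) (r (fst y)) \<noteq> {} \<and> u j < r (fst y)"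
      "\<And>y. y \<in> D \<Longrightarrow> \<epsilon> * r (fst y) powr s \<le> (\<Sum>j\<in>FF y. u j powr s)"
    by blast
  have FFdis: "FF y \<inter> FF y' = {}" if yy: "y \<in> D" "y' \<in> D" "y \<noteq> y'" for y y'
  proof (rule ccontr)
    assume "FF y \<inter> FF y' \<noteq> {}"
    then obtain j where j: "j \<in> FF y" "j \<in> FF y'" by auto
    obtain a b where a: "a \<in> U j" "dist (snd y) a \<le> r (fst y)" and b: "b \<in> U j" "dist (snd y') b \<le> r (fst y')"
      using FF(2)[OF yy(1) j(1)] FF(2)[OF yy(2) j(2)] by auto
    have uu: "0 < u j" "u j < r (fst y')" "u j < r (fst y)"
      using u(1)[of j] FF(2)[OF yy(1) j(1)] FF(2)[OF yy(2) j(2)] by auto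
    have "dist (snd y') a \<le> 2 * r (fst y')"
      using dist_triangle[of "snd y'" a b] b diam[OF b(1) a(1)] uu by simp
    moreover have "dist (snd y) a \<le> 2 * r (fst y)" using a uu by simp
    moreover note pairwiseD[OF D(2) yy]
    ultimately show False by (simp add: disjnt_iff)
  qed
  have Dsum: "(\<Sum>y\<in>D. r (fst y) powr s) \<le> \<eta> / \<epsilon>"
  proof -
    have "\<epsilon> * (\<Sum>y\<in>D. r (fst y) powr s) \<le> (\<Sum>y\<in>D. \<Sum>j\<in>FF y. u j powr s)"
      unfolding sum_distrib_left using FF(3) by (intro sum_mono)
    also have "\<dots> = (\<Sum>j\<in>(\<Union>y\<in>D. FF y). u j powr s)"
      using finD FF(1) FFdis by (intro sum.UNION_disjoint[symmetric]) auto
    also have "\<dots> \<le> \<eta>" using finD FF by (intro J) auto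
    finally show ?thesis using eps by (simp add: field_simps)
  qed
  have T2le: "sum wt T2 \<le> C * S * ((1 + G) * (\<eta> / \<epsilon>))"
  proof -
    have r01: "0 < r (fst y)" "r (fst y) \<le> 1" if "y \<in> D" for y
    proof -
      have "fst y \<in> W" using that D by (auto simp: T2_def T_def)
      then show "0 < r (fst y)" using WI by auto
      have "r (fst y) \<le> 1 / 2 ^ fst y" using \<open>fst y \<in> W\<close> WI r(2) by blast
      also have "\<dots> \<le> 1" by simp
      finally show "r (fst y) \<le> 1" .
    qed
    have "sum wt T2 \<le> (\<Sum>y\<in>D. sum wt (T2 \<inter> E (snd y) (r (fst y))))"
      using cover finD finT wt0 by (intro sum_le_sum_cover) (auto simp: T2_def)
    also have "\<dots> \<le> (\<Sum>y\<in>D. C * S * ((1 + G) * r (fst y) powr s))"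
    proof (rule sum_mono)
      fix y assume y: "y \<in> D"
      let ?r = "r (fst y)"
      have "sum wt (T2 \<inter> E (snd y) ?r) \<le> C * (?\<Gamma> ?r + ?r ^ ?D * S)"
        using r01[OF y] by (intro count) (auto simp: T2_def)
      also have "\<dots> \<le> C * (S * (G * ?r powr s) + ?r powr s * S)"
      proof -
        have "?\<Gamma> ?r \<le> 1 * (G * ?r powr s)" using geo by simp
        also have "\<dots> \<le> S * (G * ?r powr s)" using S G by (intro mult_right_mono) auto
        finally have 1: "?\<Gamma> ?r \<le> S * (G * ?r powr s)" .
        have "?r ^ ?D = ?r powr real ?D" using r01[OF y] by (simp add: powr_realpow)
        also have "\<dots> \<le> ?r powr s" using r01[OF y] s by (intro powr_mono') auto
        finally show ?thesis using 1 C S by (intro mult_left_mono add_mono mult_right_mono) auto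
      qed
      finally show "sum wt (T2 \<inter> E (snd y) ?r) \<le> C * S * ((1 + G) * ?r powr s)"
        by (simp add: algebra_simps)
    qed
    also have "\<dots> = C * S * ((1 + G) * (\<Sum>y\<in>D. r (fst y) powr s))"
      by (simp add: sum_distrib_left)
    also have "\<dots> \<le> C * S * ((1 + G) * (\<eta> / \<epsilon>))"
      using C S G Dsum by (intro mult_left_mono) auto
    finally show ?thesis .
  qed
  have "B * S \<le> S * (C * (G * (real J * \<beta> powr s)) + C * (\<epsilon> * R ^ ?D) + C * (1 + G) * (\<eta> * (1 + 1 / \<epsilon>)))"
    using main T1le T2le by (simp add: algebra_simps add_divide_distrib)
  also have "\<dots> \<le> S * (B / 4 + B / 4 + B / 4)"
    using CJ S unfolding C\<epsilon> C\<eta> by (intro mult_left_mono) auto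
  finally show False using B S by (simp add: field_simps)
qed

text \<open>Repeated use of \<open>light_step\<close> yields nested light balls around points of
  \<open>P k\<close> at ever higher levels; compactness gives a common point \<open>y\<close>. If
  \<open>y\<close> were in \<open>U j\<close>, this single set would meet every ball, and lightness
  would bound \<open>u j ^ DIM('a)\<close> by quantities tending to 0, although \<open>u j\<close>
  is positive.\<close>

theorem limsup_balls_not_covered:
  fixes U :: "nat \<Rightarrow> 'a::euclidean_space set" and P :: "nat \<Rightarrow> 'a set" and r \<rho> :: "nat \<Rightarrow> real"
  assumes s: "0 < s" "s \<le> real DIM('a)"
    and u: "\<And>j. 0 < u j" "\<And>j. u j \<le> 1" "summable (\<lambda>j. u j powr s)"
    and diam: "\<And>j a b. a \<in> U j \<Longrightarrow> b \<in> U j \<Longrightarrow> dist a b \<le> u j"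
    and r: "\<And>k. k \<in> I \<Longrightarrow> 0 < r k" "\<And>k. k \<in> I \<Longrightarrow> r k \<le> 1 / 2 ^ k"
    and decay: "\<And>k k'. k \<in> I \<Longrightarrow> k' \<in> I \<Longrightarrow> k \<le> k' \<Longrightarrow> r k' \<le> r k / 2 ^ (k' - k)"
    and \<rho>: "\<And>k. k \<in> I \<Longrightarrow> 0 < \<rho> k"
    and diverge: "\<And>K. \<exists>W\<subseteq>I. finite W \<and> (\<forall>k\<in>W. K \<le> k) \<and> 1 \<le> (\<Sum>k\<in>W. r k powr s / \<rho> k ^ DIM('a))"
    and c: "c > 0"
    and rich: "\<And>x R. 0 < R \<Longrightarrow> R \<le> 1 \<Longrightarrow> \<exists>K. \<forall>k\<in>I. k \<ge> K \<longrightarrow> rich_in (P k) (\<rho> k) c x R"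
    and light: "light U u (c / (4 * 18 ^ DIM('a))) x0 1"
  shows "\<exists>y. y \<notin> (\<Union>j. U j) \<and> (\<forall>K. \<exists>k\<ge>K. \<exists>p\<in>P k. dist p y \<le> r k)"
proof -
  define \<epsilon> where "\<epsilon> = c / (4 * 18 ^ DIM('a))"
  \<comment> \<open>The starting ball belongs to no level, hence the guard \<open>n > 0\<close>; the
    condition \<open>n \<le> k\<close> drives the levels to infinity.\<close>
  define good where "good n q \<longleftrightarrow> (case q of (k, x, R) \<Rightarrow>
     0 < R \<and> R \<le> 1 \<and> light U u \<epsilon> x R \<and> (n > 0 \<longrightarrow> n \<le> k \<and> k \<in> I \<and> x \<in> P k \<and> R = r k))"
    for n :: nat and q :: "nat \<times> 'a \<times> real"
  define step where "step q q' \<longleftrightarrow> (case q of (k, x, R) \<Rightarrow> case q' of (k', x', R') \<Rightarrow> cball x' R' \<subseteq> cball x R)"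
    for q q' :: "nat \<times> 'a \<times> real"
  have "\<exists>f. \<forall>n. good n (f n) \<and> step (f n) (f (Suc n))"
  proof (rule dependent_nat_choice)
    show "\<exists>q. good 0 q" using light by (intro exI[of _ "(0, x0, 1)"]) (auto simp: good_def \<epsilon>_def)
  next
    fix q n assume q: "good n q"
    obtain k x R where qe: "q = (k, x, R)" by (cases q)
    have R: "0 < R" "R \<le> 1" "light U u \<epsilon> x R" using q by (auto simp: qe good_def)
    obtain K where K: "\<forall>k\<in>I. k \<ge> K \<longrightarrow> rich_in (P k) (\<rho> k) c x (R/2)"
      using rich[of "R/2" x] R by auto
    have "\<exists>k\<in>I. k \<ge> max K (Suc n) \<and> (\<exists>p\<in>P k. cball p (r k) \<subseteq> cball x R \<and> light U u \<epsilon> p (r k))"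
      by (rule light_step[OF s u diam r decay \<rho> diverge c \<epsilon>_def _ R(1,3)]) (use K in auto)
    then obtain k' p where k': "k' \<in> I" "k' \<ge> max K (Suc n)" "p \<in> P k'"
       "cball p (r k') \<subseteq> cball x R" "light U u \<epsilon> p (r k')" by auto
    have "r k' \<le> 1" using r(2)[OF k'(1)] by (rule order.trans) simp
    then show "\<exists>q'. good (Suc n) q' \<and> step q q'"
      using k' r by (intro exI[of _ "(k', p, r k')"]) (auto simp: good_def step_def qe)
  qed
  then obtain f where f: "\<And>n. good n (f n)" "\<And>n. step (f n) (f (Suc n))" by auto
  define kk xx RR where "kk n = fst (f n)" and "xx n = fst (snd (f n))" and "RR n = snd (snd (f n))" for n
  have fe: "f n = (kk n, xx n, RR n)" for n by (simp add: kk_def xx_def RR_def)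
  have g: "0 < RR n" "light U u \<epsilon> (xx n) (RR n)" for n
    using f(1)[of n] by (auto simp: good_def fe)
  have gS: "n \<le> kk n" "kk n \<in> I" "xx n \<in> P (kk n)" "RR n = r (kk n)" if "n > 0" for n
    using f(1)[of n] that by (auto simp: good_def fe)
  have "cball (xx (Suc n)) (RR (Suc n)) \<subseteq> cball (xx n) (RR n)" for n
    using f(2)[of n] by (auto simp: step_def fe)
  then have dec: "cball (xx n) (RR n) \<subseteq> cball (xx m) (RR m)" if "m \<le> n" for m n
    using lift_Suc_antimono_le[of "\<lambda>n. cball (xx n) (RR n)"] that by blast
  have "\<Inter> (range (\<lambda>n. cball (xx n) (RR n))) \<noteq> {}"
    using dec g(1)[THEN less_imp_le] by (intro compact_nest) (auto simp: not_less)
  then obtain y where "y \<in> \<Inter> (range (\<lambda>n. cball (xx n) (RR n)))" by blast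
  then have y: "y \<in> cball (xx n) (RR n)" for n by blast
  have "y \<notin> U j" for j
  proof
    assume yj: "y \<in> U j"
    have le: "u j ^ DIM('a) \<le> \<epsilon> * (1 / 2 ^ n) ^ DIM('a)" if n: "n > 0" for n
    proof -
      have "(\<Sum>j\<in>{j}. u j ^ DIM('a)) \<le> \<epsilon> * RR n ^ DIM('a)"
        using g(2)[of n] y[of n] yj unfolding light_def by blast
      moreover have "RR n \<le> 1 / 2 ^ n"
      proof -
        have "RR n \<le> 1 / 2 ^ kk n" using gS[OF n] r(2)[of "kk n"] by simp
        also have "\<dots> \<le> 1 / 2 ^ n" using gS(1)[OF n] by (intro divide_left_mono power_increasing) auto
        finally show ?thesis .
      qed
      then have "\<epsilon> * RR n ^ DIM('a) \<le> \<epsilon> * (1 / 2 ^ n) ^ DIM('a)"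
        using g(1)[of n] c by (intro mult_left_mono power_mono) (auto simp: \<epsilon>_def)
      ultimately show ?thesis by simp
    qed
    have "(\<lambda>n. \<epsilon> * ((1/2::real) ^ n) ^ DIM('a)) \<longlonglongrightarrow> \<epsilon> * 0 ^ DIM('a)"
      by (intro tendsto_intros LIMSEQ_power_zero) auto
    moreover have "\<exists>N. \<forall>n\<ge>N. u j ^ DIM('a) \<le> \<epsilon> * ((1/2) ^ n) ^ DIM('a)"
      using le by (intro exI[of _ 1]) (auto simp: power_one_over)
    ultimately have "u j ^ DIM('a) \<le> \<epsilon> * 0 ^ DIM('a)" by (rule LIMSEQ_le_const)
    moreover have "u j ^ DIM('a) > 0" using u(1) by simp
    ultimately show False by (simp add: zero_power)
  qed
  moreover have "\<exists>k\<ge>K. \<exists>p\<in>P k. dist p y \<le> r k" for K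
  proof (intro exI[of _ "kk (Suc K)"] conjI bexI[of _ "xx (Suc K)"])
    show "K \<le> kk (Suc K)" using gS(1)[of "Suc K"] by simp
    show "xx (Suc K) \<in> P (kk (Suc K))" using gS(3)[of "Suc K"] by simp
    show "dist (xx (Suc K)) y \<le> r (kk (Suc K))" using y[of "Suc K"] gS(4)[of "Suc K"] by simp
  qed
  ultimately show ?thesis by (intro exI[of _ y]) auto
qed

section \<open>Equidistribution by finite Fourier analysis\<close>

definition near_int :: "real \<Rightarrow> real ^ 'n::finite \<Rightarrow> bool" where
  "near_int \<delta> y \<longleftrightarrow> (\<exists>p\<in>int_vectors. \<forall>i. \<bar>y $ i - p $ i\<bar> \<le> \<delta>)"

lemma sum_cis_root_of_unity:
  fixes t :: int and M :: nat
  assumes "t \<noteq> 0" "\<bar>t\<bar> < int M"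
  shows "(\<Sum>h<M. cis (2 * pi * (of_int t * of_nat h / of_nat M))) = 0"
proof -
  define z where "z = cis (2 * pi * (of_int t / of_nat M))"
  have M: "M > 0" using assms by auto
  have 1: "cis (2 * pi * (of_int t * of_nat h / of_nat M)) = z ^ h" for h
    unfolding z_def Complex.DeMoivre by (rule arg_cong[of _ _ cis]) simp
  have "z ^ M = cis (2 * pi * of_int t)"
    unfolding z_def using M by (simp add: Complex.DeMoivre mult_ac)
  then have zM: "z ^ M = 1" by (simp add: cis_multiple_2pi)
  have "z \<noteq> 1"
  proof
    assume "z = 1"
    then have "cos (2 * pi * (of_int t / of_nat M)) = 1"
      unfolding z_def by (metis cis.simps(1) one_complex.simps(1))
    then obtain n :: int where "2 * pi * (of_int t / of_nat M) = of_int n * 2 * pi"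
      by (metis cos_one_2pi_int)
    then have "(2 * pi) * (of_int t / of_nat M) = (2 * pi) * of_int n" by (simp only: mult_ac)
    then have "real_of_int t / real M = of_int n"
      unfolding mult_cancel_left using pi_gt_zero by auto
    then have "real_of_int t = of_int (n * int M)"
      using M by (simp add: field_simps)
    then have "t = n * int M" by linarith
    then have "\<bar>t\<bar> = \<bar>n\<bar> * int M" by (simp add: abs_mult)
    moreover have "\<bar>n\<bar> \<ge> 1" using assms \<open>t = n * int M\<close> by auto
    ultimately have "\<bar>t\<bar> \<ge> int M" using mult_right_mono[of 1 "\<bar>n\<bar>" "int M"] by simp
    then show False using assms by simp
  qed
  then show ?thesis unfolding 1 using zM by (simp add: geometric_sum)
qed

lemma finite_bounded_funs: "finite {z :: 'k::finite \<Rightarrow> nat. \<forall>i. z i < M}"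
  and card_bounded_funs: "card {z :: 'k::finite \<Rightarrow> nat. \<forall>i. z i < M} = M ^ CARD('k)"
proof -
  have eq: "{z :: 'k \<Rightarrow> nat. \<forall>i. z i < M} = PiE UNIV (\<lambda>_. {..<M})"
    by (auto simp: PiE_def Pi_def extensional_def)
  show "finite {z :: 'k \<Rightarrow> nat. \<forall>i. z i < M}" unfolding eq by (intro finite_PiE) auto
  show "card {z :: 'k \<Rightarrow> nat. \<forall>i. z i < M} = M ^ CARD('k)"
    unfolding eq by (subst card_PiE) auto
qed

lemma sum_bounded_funs_prod:
  fixes f :: "'k::finite \<Rightarrow> nat \<Rightarrow> complex"
  shows "(\<Sum>z\<in>{z. \<forall>i. z i < M}. \<Prod>i\<in>UNIV. f i (z i)) = (\<Prod>i\<in>UNIV. \<Sum>h<M. f i h)"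
proof -
  have eq: "{z :: 'k \<Rightarrow> nat. \<forall>i. z i < M} = PiE UNIV (\<lambda>_. {..<M})"
    by (auto simp: PiE_def Pi_def extensional_def)
  show ?thesis unfolding eq by (subst prod_sum_PiE) auto
qed

lemma cis_sum: "finite S \<Longrightarrow> cis (sum f S) = (\<Prod>i\<in>S. cis (f i))"
  by (induction S rule: finite_induct) (auto simp: cis_mult [symmetric])

lemma int_vectors_component_diff:
  "u \<in> int_vectors \<Longrightarrow> v \<in> int_vectors \<Longrightarrow> u $ i - v $ i \<in> \<int>"
  by (auto simp: int_vectors_def)

text \<open>Differences below \<open>M\<close> keep distinct frequencies distinct modulo
  \<open>M\<close>, so their characters are orthogonal on the grid. Subtracting \<open>v1\<close>
  multiplies the polynomial by a unimodular factor only; it is done to have small frequencies when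
  grid points are perturbed.\<close>

lemma torus_parseval:
  fixes V :: "(real ^ 'k::finite) set" and M :: nat
  assumes V: "finite V" "V \<subseteq> int_vectors"
    and sep: "\<And>v v' i. v \<in> V \<Longrightarrow> v' \<in> V \<Longrightarrow> \<bar>v $ i - v' $ i\<bar> < real M"
  shows "(\<Sum>z\<in>{z. \<forall>i. z i < M}. (cmod (\<Sum>v\<in>V. cis (2 * pi * (\<Sum>i\<in>UNIV. (v $ i - v1 $ i) * real (z i) / real M))))\<^sup>2)
     = real (card V) * real M ^ CARD('k)"
proof -
  let ?Z = "{z :: 'k \<Rightarrow> nat. \<forall>i. z i < M}"
  define \<phi> where "\<phi> v z = 2 * pi * (\<Sum>i\<in>UNIV. (v $ i - v1 $ i) * real (z i) / real M)"
    for v :: "real ^ 'k" and z :: "'k \<Rightarrow> nat"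
  have sq: "complex_of_real ((cmod (\<Sum>v\<in>V. cis (\<phi> v z)))\<^sup>2)
     = (\<Sum>v\<in>V. \<Sum>v'\<in>V. cis (2 * pi * (\<Sum>i\<in>UNIV. (v $ i - v' $ i) * real (z i) / real M)))" for z
  proof -
    have d: "\<phi> v z - \<phi> v' z = 2 * pi * (\<Sum>i\<in>UNIV. (v $ i - v' $ i) * real (z i) / real M)" for v v'
      unfolding \<phi>_def by (simp add: right_diff_distrib[symmetric] sum_subtractf[symmetric]
          diff_divide_distrib[symmetric] left_diff_distrib[symmetric])
    have "complex_of_real ((cmod (\<Sum>v\<in>V. cis (\<phi> v z)))\<^sup>2)
       = (\<Sum>v\<in>V. cis (\<phi> v z)) * cnj (\<Sum>v\<in>V. cis (\<phi> v z))"
      by (rule complex_norm_square)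
    also have "\<dots> = (\<Sum>v\<in>V. \<Sum>v'\<in>V. cis (\<phi> v z - \<phi> v' z))"
      by (simp add: sum_product cis_cnj cis_mult)
    also have "\<dots> = (\<Sum>v\<in>V. \<Sum>v'\<in>V. cis (2 * pi * (\<Sum>i\<in>UNIV. (v $ i - v' $ i) * real (z i) / real M)))"
      unfolding d ..
    finally show ?thesis .
  qed
  \<comment> \<open>The sum over the grid factors over the coordinates, so one coordinate in which
    the frequencies differ makes it vanish.\<close>
  have orth: "(\<Sum>z\<in>?Z. cis (2 * pi * (\<Sum>i\<in>UNIV. (v $ i - v' $ i) * real (z i) / real M)))
      = (if v = v' then of_nat (M ^ CARD('k)) else 0)" if vv: "v \<in> V" "v' \<in> V" for v v'
  proof (cases "v = v'")
    case True
    then show ?thesis by (simp add: card_bounded_funs)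
  next
    case False
    then obtain i0 where i0: "v $ i0 \<noteq> v' $ i0" by (auto simp: vec_eq_iff)
    have "v $ i0 - v' $ i0 \<in> \<int>" using vv V by (auto intro!: int_vectors_component_diff)
    then obtain t where t: "v $ i0 - v' $ i0 = of_int t" by (auto elim: Ints_cases)
    have t0: "t \<noteq> 0" using t i0 by auto
    have tM: "\<bar>t\<bar> < int M" using sep[OF vv, of i0] t by linarith
    have "cis (2 * pi * (\<Sum>i\<in>UNIV. (v $ i - v' $ i) * real (z i) / real M))
       = (\<Prod>i\<in>UNIV. cis (2 * pi * ((v $ i - v' $ i) * real (z i) / real M)))" for z
      by (simp add: sum_distrib_left cis_sum)
    then have "(\<Sum>z\<in>?Z. cis (2 * pi * (\<Sum>i\<in>UNIV. (v $ i - v' $ i) * real (z i) / real M)))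
       = (\<Prod>i\<in>UNIV. \<Sum>h<M. cis (2 * pi * ((v $ i - v' $ i) * real h / real M)))"
      using sum_bounded_funs_prod[of "\<lambda>i h. cis (2 * pi * ((v $ i - v' $ i) * real h / real M))"] by simp
    also have "\<dots> = 0"
    proof (rule prod_zero)
      show "\<exists>i\<in>UNIV. (\<Sum>h<M. cis (2 * pi * ((v $ i - v' $ i) * real h / real M))) = 0"
        using sum_cis_root_of_unity[OF t0 tM] by (intro bexI[of _ i0]) (auto simp: t)
    qed simp
    finally show ?thesis using False by simp
  qed
  have "complex_of_real (\<Sum>z\<in>?Z. (cmod (\<Sum>v\<in>V. cis (\<phi> v z)))\<^sup>2)
     = (\<Sum>z\<in>?Z. \<Sum>v\<in>V. \<Sum>v'\<in>V. cis (2 * pi * (\<Sum>i\<in>UNIV. (v $ i - v' $ i) * real (z i) / real M)))"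
    unfolding of_real_sum sq ..
  also have "\<dots> = (\<Sum>v\<in>V. \<Sum>v'\<in>V. \<Sum>z\<in>?Z. cis (2 * pi * (\<Sum>i\<in>UNIV. (v $ i - v' $ i) * real (z i) / real M)))"
    by (subst sum.swap, intro sum.cong refl sum.swap)
  also have "\<dots> = (\<Sum>v\<in>V. \<Sum>v'\<in>V. if v = v' then of_nat (M ^ CARD('k)) else 0)"
    by (intro sum.cong refl orth)
  also have "\<dots> = complex_of_real (real (card V) * real M ^ CARD('k))"
    using V by simp
  finally show ?thesis unfolding \<phi>_def using of_real_eq_iff by blast
qed

lemma cos_ge_half_near_int:
  assumes "\<bar>\<alpha> - of_int n\<bar> \<le> 1/8"
  shows "cos (2 * pi * \<alpha>) \<ge> 1/2"
proof -
  define e where "e = \<alpha> - of_int n"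
  have "cos (2 * pi * \<alpha>) = cos (2 * pi * e + 2 * pi * of_int n)"
    unfolding e_def by (simp add: algebra_simps)
  also have "\<dots> = cos (2 * pi * e)" by (simp add: cos_add)
  also have "\<dots> = cos \<bar>2 * pi * e\<bar>" by simp
  also have "\<dots> \<ge> cos (pi / 3)"
  proof (rule cos_monotone_0_pi_le)
    have "\<bar>2 * pi * e\<bar> = 2 * pi * \<bar>e\<bar>" by (simp add: abs_mult)
    also have "\<dots> \<le> 2 * pi * (1/8)" using assms by (intro mult_left_mono) (auto simp: e_def)
    also have "\<dots> \<le> pi / 3" using pi_gt_zero by simp
    finally show "\<bar>2 * pi * e\<bar> \<le> pi / 3" .
  qed auto
  finally show ?thesis by (simp add: cos_60)
qed

text \<open>
  The trigonometric polynomial \<open>\<Sum>v\<in>V. e(v \<cdot> z / M)\<close> on the finite torus has mean square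
  \<open>card V\<close>, but it is at least \<open>card V / 2\<close> at the roughly \<open>J\<^sup>m\<close> grid points closest to the
  points \<open>A j\<close>.
\<close>

lemma card_near_int_le:
  fixes A :: "real ^ 'm::finite ^ 'k::finite" and V :: "(real ^ 'k) set" and N J :: nat
  assumes V: "finite V" "V \<subseteq> int_vectors" and N: "N \<ge> 1" and J: "J \<ge> 1"
    and diam: "\<And>v v' i. v \<in> V \<Longrightarrow> v' \<in> V \<Longrightarrow> \<bar>v $ i - v' $ i\<bar> \<le> real N"
    and near: "\<And>v. v \<in> V \<Longrightarrow> near_int \<delta> (v v* A)"
    and \<delta>: "\<delta> \<le> 1 / (32 * real CARD('m) * real J)"
    and sep: "\<And>j p. j \<in> int_vectors \<Longrightarrow> j \<noteq> 0 \<Longrightarrow> (\<And>l. \<bar>j $ l\<bar> < real J) \<Longrightarrow> p \<in> int_vectors \<Longrightarrow>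
               \<exists>i. \<bar>(A *v j - p) $ i\<bar> > 1 / (8 * real CARD('k) * real N)"
  shows "real (card V) * real J ^ CARD('m) \<le> 4 * (8 * real CARD('k) * real N) ^ CARD('k)"
proof (cases "V = {}")
  case True
  then show ?thesis by simp
next
  case False
  then obtain v1 where v1: "v1 \<in> V" by auto
  \<comment> \<open>Rounding to the grid moves each coordinate by at most 1/(2M), hence a phase with
    frequencies up to \<open>N\<close> by at most CARD('k) N/(2M) = 1/16. Moreover 1/M is exactly
    the distance in \<open>sep\<close>.\<close>
  define M where "M = 8 * CARD('k) * N"
  have M0: "M > 0" using N by (simp add: M_def)
  have kpos: "CARD('k) \<ge> 1" by (simp add: Suc_leI)
  have "1 * N < 8 * CARD('k) * N" using N kpos by (intro mult_strict_right_mono) linarith+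
  then have NM: "N < M" by (simp add: M_def)
  let ?Z = "{z :: 'k \<Rightarrow> nat. \<forall>i. z i < M}"
  let ?Jset = "{j :: 'm \<Rightarrow> nat. \<forall>i. j i < J}"
  define F where "F z = (\<Sum>v\<in>V. cis (2 * pi * (\<Sum>i\<in>UNIV. (v $ i - v1 $ i) * real (z i) / real M)))" for z :: "'k \<Rightarrow> nat"
  define vec where "vec j = (\<chi> l. real (j l))" for j :: "'m \<Rightarrow> nat"
  define \<theta> where "\<theta> j = A *v vec j" for j
  \<comment> \<open>The grid point nearest to \<open>A *v vec j\<close> modulo one; \<open>g\<close>
    is the integer part removed in the reduction.\<close>
  define zz where "zz j = (\<lambda>i. nat (round (real M * \<theta> j $ i) mod int M))" for j
  have zzM: "zz j \<in> ?Z" for j using M0 by (auto simp: zz_def nat_less_iff)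
  define g where "g j i = round (real M * \<theta> j $ i) div int M" for j i
  have err: "\<bar>\<theta> j $ i - of_int (g j i) - real (zz j i) / real M\<bar> \<le> 1 / (2 * real M)" for j i
  proof -
    let ?r = "round (real M * \<theta> j $ i)"
    have "?r = int M * g j i + int (zz j i)" unfolding g_def zz_def using M0 by simp
    then have "real_of_int ?r = real M * of_int (g j i) + real (zz j i)"
      by (metis of_int_add of_int_mult of_int_of_nat_eq)
    then have "real M * (\<theta> j $ i - of_int (g j i) - real (zz j i) / real M) = real M * \<theta> j $ i - of_int ?r"
      using M0 by (simp add: field_simps)
    then have "real M * \<bar>\<theta> j $ i - of_int (g j i) - real (zz j i) / real M\<bar> = \<bar>real M * \<theta> j $ i - of_int ?r\<bar>"
      by (metis abs_mult abs_of_nat)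
    also have "\<dots> \<le> 1/2" using of_int_round_abs_le[of "real M * \<theta> j $ i"] by (simp add: abs_minus_commute)
    finally show ?thesis using M0 by (simp add: field_simps)
  qed
  \<comment> \<open>Two indices rounded to the same grid point would put
    \<open>A *v (vec j - vec j')\<close> within 1/M of an integer vector in every coordinate, which
    \<open>sep\<close> forbids.\<close>
  have inj: "inj_on zz ?Jset"
  proof (rule inj_onI, rule ccontr)
    fix j j' assume jj: "j \<in> ?Jset" "j' \<in> ?Jset" "zz j = zz j'" "j \<noteq> j'"
    let ?p = "(\<chi> i. of_int (g j i - g j' i)) :: real ^ 'k"
    have p1: "vec j - vec j' \<in> int_vectors" "?p \<in> int_vectors" by (auto simp: int_vectors_def vec_def)
    have p2: "vec j - vec j' \<noteq> 0"
    proof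
      assume "vec j - vec j' = 0"
      then have "vec j = vec j'" by simp
      then have "\<And>l. j l = j' l" unfolding vec_def by (metis vec_lambda_beta of_nat_eq_iff)
      then show False using jj by auto
    qed
    have p3: "\<bar>(vec j - vec j') $ l\<bar> < real J" for l
      using jj by (auto simp: vec_def abs_less_iff dest!: spec[of _ l])
    obtain i where i: "\<bar>(A *v (vec j - vec j') - ?p) $ i\<bar> > 1 / (8 * real CARD('k) * real N)"
      using sep[OF p1(1) p2 p3 p1(2)] by blast
    have "(A *v (vec j - vec j') - ?p) $ i = (\<theta> j $ i - of_int (g j i) - real (zz j i) / real M)
       - (\<theta> j' $ i - of_int (g j' i) - real (zz j' i) / real M)"
      using jj(3) by (simp add: \<theta>_def matrix_vector_mult_diff_distrib)
    then have "\<bar>(A *v (vec j - vec j') - ?p) $ i\<bar> \<le> 1 / (2 * real M) + 1 / (2 * real M)"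
      using err[of j i] err[of j' i] by linarith
    also have "\<dots> = 1 / (8 * real CARD('k) * real N)" by (simp add: M_def)
    finally show False using i by simp
  qed
  have large: "cmod (F (zz j)) \<ge> real (card V) / 2" if j: "j \<in> ?Jset" for j
  proof -
    have "Re (cis (2 * pi * (\<Sum>i\<in>UNIV. (v $ i - v1 $ i) * real (zz j i) / real M))) \<ge> 1/2" if v: "v \<in> V" for v
    proof -
      define u where "u = v - v1"
      have uN: "\<bar>u $ i\<bar> \<le> real N" for i using diam[OF v v1] by (simp add: u_def)
      have uI: "u $ i \<in> \<int>" for i using v v1 V by (auto simp: u_def intro!: int_vectors_component_diff)
      obtain p p1 where p: "p \<in> int_vectors" "\<And>l. \<bar>(v v* A) $ l - p $ l\<bar> \<le> \<delta>"
        and p1: "p1 \<in> int_vectors" "\<And>l. \<bar>(v1 v* A) $ l - p1 $ l\<bar> \<le> \<delta>"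
        using near[OF v] near[OF v1] unfolding near_int_def by metis
      define P where "P = p - p1"
      have uP: "\<bar>(u v* A) $ l - P $ l\<bar> \<le> 2 * \<delta>" for l
      proof -
        have "(u v* A) $ l - P $ l = ((v v* A) $ l - p $ l) - ((v1 v* A) $ l - p1 $ l)"
          by (simp add: u_def P_def vector_matrix_mult_def sum_subtractf left_diff_distrib)
        then show ?thesis using p(2)[of l] p1(2)[of l] by linarith
      qed
      have PI: "P $ l \<in> \<int>" for l using p p1 by (auto simp: P_def int_vectors_def)
      define \<alpha> where "\<alpha> = (\<Sum>i\<in>UNIV. u $ i * real (zz j i) / real M)"
      define I1 where "I1 = (\<Sum>l\<in>UNIV. P $ l * real (j l)) - (\<Sum>i\<in>UNIV. u $ i * of_int (g j i))"
      have "I1 \<in> \<int>" unfolding I1_def by (intro Ints_diff Ints_sum Ints_mult PI uI) auto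
      then obtain n where n: "I1 = of_int n" by (auto elim: Ints_cases)
      \<comment> \<open>Transposition: pairing \<open>u\<close> with \<open>A *v vec j\<close>
        equals pairing \<open>u v* A\<close> with \<open>vec j\<close>. As \<open>u v* A\<close> is
        within \<open>2 * \<delta>\<close> of an integer vector, the phase is within 1/16 of an
        integer; rounding adds another 1/16.\<close>
      have dual: "(\<Sum>i\<in>UNIV. u $ i * \<theta> j $ i) = (\<Sum>l\<in>UNIV. (u v* A) $ l * real (j l))"
        unfolding \<theta>_def vec_def matrix_vector_mult_def vector_matrix_mult_def
        by (simp add: sum_distrib_left sum_distrib_right mult_ac, rule sum.swap)
      have "\<alpha> - I1 = (\<Sum>l\<in>UNIV. ((u v* A) $ l - P $ l) * real (j l))
          - (\<Sum>i\<in>UNIV. u $ i * (\<theta> j $ i - of_int (g j i) - real (zz j i) / real M))"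
        unfolding \<alpha>_def I1_def by (simp add: algebra_simps sum.distrib sum_subtractf dual)
      then have "\<bar>\<alpha> - I1\<bar> \<le> \<bar>\<Sum>l\<in>UNIV. ((u v* A) $ l - P $ l) * real (j l)\<bar>
          + \<bar>\<Sum>i\<in>UNIV. u $ i * (\<theta> j $ i - of_int (g j i) - real (zz j i) / real M)\<bar>" by linarith
      also have "\<bar>\<Sum>l\<in>UNIV. ((u v* A) $ l - P $ l) * real (j l)\<bar> \<le> (\<Sum>l\<in>(UNIV::'m set). 2 * \<delta> * real J)"
      proof (rule order.trans[OF sum_abs], rule sum_mono)
        fix l show "\<bar>((u v* A) $ l - P $ l) * real (j l)\<bar> \<le> 2 * \<delta> * real J"
          unfolding abs_mult using j uP[of l] order.trans[OF abs_ge_zero uP[of l]]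
          by (intro mult_mono) (auto intro: less_imp_le)
      qed
      also have "(\<Sum>l\<in>(UNIV::'m set). 2 * \<delta> * real J) = (real CARD('m) * real J) * 2 * \<delta>" by simp
      also have "\<dots> \<le> (real CARD('m) * real J) * 2 * (1 / (32 * real CARD('m) * real J))"
        using \<delta> by (intro mult_left_mono) auto
      also have "\<dots> = 1/16" using J by simp
      also have "\<bar>\<Sum>i\<in>UNIV. u $ i * (\<theta> j $ i - of_int (g j i) - real (zz j i) / real M)\<bar>
           \<le> (\<Sum>i\<in>(UNIV::'k set). real N * (1 / (2 * real M)))"
      proof (rule order.trans[OF sum_abs], rule sum_mono)
        fix i show "\<bar>u $ i * (\<theta> j $ i - of_int (g j i) - real (zz j i) / real M)\<bar> \<le> real N * (1 / (2 * real M))"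
          unfolding abs_mult using uN[of i] err[of j i] by (intro mult_mono) auto
      qed
      also have "\<dots> = 1/16" using N by (simp add: M_def field_simps)
      finally have "\<bar>\<alpha> - of_int n\<bar> \<le> 1/8" using n by simp
      from cos_ge_half_near_int[OF this] show ?thesis by (simp add: \<alpha>_def u_def)
    qed
    then have "(\<Sum>v\<in>V. 1/2) \<le> Re (F (zz j))" unfolding F_def Re_sum by (intro sum_mono) auto
    then show ?thesis using complex_Re_le_cmod[of "F (zz j)"] by simp
  qed
  have "real (card ?Jset) * (real (card V) / 2)\<^sup>2 = (\<Sum>j\<in>?Jset. (real (card V) / 2)\<^sup>2)" by simp
  also have "\<dots> \<le> (\<Sum>j\<in>?Jset. (cmod (F (zz j)))\<^sup>2)"
    by (intro sum_mono power_mono large) auto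
  also have "\<dots> = (\<Sum>z\<in>zz ` ?Jset. (cmod (F z))\<^sup>2)" by (simp add: sum.reindex[OF inj])
  also have "\<dots> \<le> (\<Sum>z\<in>?Z. (cmod (F z))\<^sup>2)"
    using zzM by (intro sum_mono2 finite_bounded_funs) auto
  also have "\<dots> = real (card V) * real M ^ CARD('k)"
    unfolding F_def using diam NM by (intro torus_parseval V) (meson le_less_trans of_nat_less_iff)
  finally have "real J ^ CARD('m) * (real (card V))\<^sup>2 \<le> 4 * real M ^ CARD('k) * real (card V)"
    by (simp add: card_bounded_funs power_divide mult_ac)
  then have "real (card V) * (real J ^ CARD('m) * real (card V)) \<le> real (card V) * (4 * real M ^ CARD('k))"
    by (simp add: power2_eq_square mult_ac)
  moreover have "real (card V) > 0" using False V by (simp add: card_gt_0_iff)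
  ultimately have "real J ^ CARD('m) * real (card V) \<le> 4 * real M ^ CARD('k)"
    by (simp only: mult_le_cancel_left_pos)
  then show ?thesis by (simp add: M_def mult_ac)
qed

section \<open>The diophantine exponent\<close>

definition dioph_bound :: "real \<Rightarrow> real \<Rightarrow> real ^ 'm::finite ^ 'r::finite \<Rightarrow> bool" where
  "dioph_bound c w A \<longleftrightarrow> (\<forall>j\<in>int_vectors. j \<noteq> 0 \<longrightarrow>
     (\<forall>p\<in>int_vectors. c * infnorm j powr (- w) \<le> infnorm (A *v j - p)))"

lemma zero_int_vectors [simp]: "0 \<in> int_vectors"
  by (auto simp: int_vectors_def)

lemma int_vectors_nonempty [simp]: "int_vectors \<noteq> {}"
  using zero_int_vectors by blast

lemma scaleR_nat_int_vectors: "q \<in> int_vectors \<Longrightarrow> real k *\<^sub>R q \<in> int_vectors"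
  by (auto simp: int_vectors_def)

lemma infnorm_le_cart: "(\<And>i. \<bar>x $ i\<bar> \<le> b) \<Longrightarrow> infnorm (x :: real ^ 'n::finite) \<le> b"
  unfolding infnorm_cart by (rule cSup_least) auto

lemma infnorm_int_vectors_ge_1:
  assumes "q \<in> int_vectors" "q \<noteq> 0"
  shows "infnorm q \<ge> 1"
proof -
  obtain i where i: "q $ i \<noteq> 0" using assms by (auto simp: vec_eq_iff)
  have "q $ i \<in> \<int>" using assms by (auto simp: int_vectors_def)
  then have "\<bar>q $ i\<bar> \<ge> 1" using i by (rule Ints_nonzero_abs_ge1)
  then show ?thesis using component_le_infnorm_cart[of q i] by simp
qed

lemma nearest_int_dist_less_iff: "nearest_int_dist y < \<delta> \<longleftrightarrow> (\<exists>p\<in>int_vectors. infnorm (y - p) < \<delta>)"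
  unfolding nearest_int_dist_def
  by (subst cINF_less_iff) (auto intro!: bdd_belowI[of _ 0] simp: infnorm_pos_le)

text \<open>Since \<open>w\<close> exceeds the exponent, the bound with constant 1 fails for
  finitely many vectors only, and \<open>c\<close> absorbs these. This requires their distance to
  the integers to be positive: otherwise all multiples of such a vector would have distance 0, and
  the exponent would be infinite.\<close>

lemma dioph_bound_exists:
  fixes A :: "real ^ 'm::finite ^ 'r::finite"
  assumes "diophantine_exponent A = ereal \<omega>" "\<omega> < w"
  obtains c where "c > 0" "dioph_bound c w A"
proof -
  let ?S = "\<lambda>w. {q \<in> int_vectors. q \<noteq> 0 \<and> nearest_int_dist (A *v q) < infnorm q powr (- w)}"
  have upper: "w' \<le> \<omega>" if "infinite (?S w')" for w'
  proof -
    have "ereal w' \<le> diophantine_exponent A"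
      unfolding diophantine_exponent_def using that by (intro SUP_upper) auto
    then show ?thesis using assms by simp
  qed
  have fin: "finite (?S w)" using upper[of w] assms by force
  have pos: "nearest_int_dist (A *v q) > 0" if q: "q \<in> int_vectors" "q \<noteq> 0" for q
  proof (rule ccontr)
    assume np: "\<not> nearest_int_dist (A *v q) > 0"
    have small: "nearest_int_dist (A *v (real k *\<^sub>R q)) < \<epsilon>" if k: "k \<ge> 1" and \<epsilon>: "\<epsilon> > 0" for k :: nat and \<epsilon>
    proof -
      have "nearest_int_dist (A *v q) < \<epsilon> / real k" using np k \<epsilon> by (auto intro: le_less_trans[of _ 0])
      then obtain p where p: "p \<in> int_vectors" "infnorm (A *v q - p) < \<epsilon> / real k"
        unfolding nearest_int_dist_less_iff by auto
      have "A *v (real k *\<^sub>R q) - real k *\<^sub>R p = real k *\<^sub>R (A *v q - p)"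
        by (simp add: matrix_vector_mult_scaleR scaleR_diff_right)
      then have "infnorm (A *v (real k *\<^sub>R q) - real k *\<^sub>R p) = real k * infnorm (A *v q - p)"
        by (simp add: infnorm_mul)
      also have "\<dots> < \<epsilon>" using p k by (simp add: field_simps)
      finally show ?thesis unfolding nearest_int_dist_less_iff
        using scaleR_nat_int_vectors[OF p(1)] by blast
    qed
    have "infinite (?S (\<omega> + 1))"
    proof (rule infinite_super)
      show "(\<lambda>k. real k *\<^sub>R q) ` {1..} \<subseteq> ?S (\<omega> + 1)"
        using q by (auto intro!: scaleR_nat_int_vectors small simp: infnorm_pos_lt powr_gt_zero infnorm_eq_0)
      have "inj_on (\<lambda>k. real k *\<^sub>R q) {1..}" using q by (auto simp: inj_on_def)
      then show "infinite ((\<lambda>k. real k *\<^sub>R q) ` {1..})"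
        using infinite_Ici by (simp add: finite_image_iff)
    qed
    then show False using upper[of "\<omega> + 1"] by simp
  qed
  define c where "c = Min (insert 1 ((\<lambda>q. nearest_int_dist (A *v q) / infnorm q powr (- w)) ` ?S w))"
  have c: "c > 0" "c \<le> 1" "\<And>q. q \<in> ?S w \<Longrightarrow> c \<le> nearest_int_dist (A *v q) / infnorm q powr (- w)"
  proof -
    show "c > 0" unfolding c_def using fin pos
      by (subst Min_gr_iff) (auto intro!: divide_pos_pos simp: infnorm_eq_0 powr_gt_zero)
    show "c \<le> 1" unfolding c_def using fin by (intro Min_le) auto
    show "c \<le> nearest_int_dist (A *v q) / infnorm q powr (- w)" if "q \<in> ?S w" for q
      unfolding c_def using fin that by (intro Min_le) auto
  qed
  have "c * infnorm j powr (- w) \<le> infnorm (A *v j - p)"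
    if j: "j \<in> int_vectors" "j \<noteq> 0" "p \<in> int_vectors" for j p
  proof -
    have "infnorm j > 0" using j by (simp add: infnorm_pos_lt)
    then have jp: "infnorm j powr (- w) > 0" by simp
    have "nearest_int_dist (A *v j) \<le> infnorm (A *v j - p)"
      using nearest_int_dist_less_iff[of "A *v j"] j(3) by (meson less_irrefl not_le)
    moreover have "c * infnorm j powr (- w) \<le> nearest_int_dist (A *v j)"
    proof (cases "j \<in> ?S w")
      case True
      then show ?thesis using c(3)[OF True] jp by (simp add: pos_le_divide_eq)
    next
      case False
      then have "infnorm j powr (- w) \<le> nearest_int_dist (A *v j)" using j by auto
      moreover have "c * infnorm j powr (- w) \<le> 1 * infnorm j powr (- w)"
        using c jp by (intro mult_right_mono) auto
      ultimately show ?thesis by simp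
    qed
    ultimately show ?thesis by simp
  qed
  then show ?thesis using that[of c] c by (auto simp: dioph_bound_def)
qed

section \<open>Counting and finding rational points\<close>

text \<open>For positive \<open>q\<close> this is \<open>q\<close> times \<open>cons_one\<close> of
  a/q. Hence \<open>near_int \<delta> (qvec q a v* A)\<close> says that the point of the subspace
  above a/q becomes integral up to \<delta> after multiplication by \<open>q\<close>.\<close>

definition qvec :: "nat \<Rightarrow> real ^ 'd::finite \<Rightarrow> real ^ 'd option" where
  "qvec q a = (\<chi> k. case k of None \<Rightarrow> real q | Some i \<Rightarrow> a $ i)"

lemma qvec_nth [simp]: "qvec q a $ None = real q" "qvec q a $ Some i = a $ i"
  by (simp_all add: qvec_def)

lemma qvec_int_vectors: "a \<in> int_vectors \<Longrightarrow> qvec q a \<in> int_vectors"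
  by (auto simp: int_vectors_def qvec_def split: option.split)

lemma qvec_eq_iff: "qvec q a = qvec q' a' \<longleftrightarrow> q = q' \<and> a = a'"
proof
  assume eq: "qvec q a = qvec q' a'"
  have "q = q'" using arg_cong[OF eq, of "\<lambda>v. v $ None"] by simp
  moreover have "a $ i = a' $ i" for i using arg_cong[OF eq, of "\<lambda>v. v $ Some i"] by simp
  ultimately show "q = q' \<and> a = a'" by (simp add: vec_eq_iff)
qed simp

lemma near_int_mono: "near_int \<delta> y \<Longrightarrow> \<delta> \<le> \<delta>' \<Longrightarrow> near_int \<delta>' y"
  unfolding near_int_def by (meson order.trans)

lemma finite_int_box: "finite {f :: 'i::finite \<Rightarrow> int. \<forall>i. f i \<in> {lo..hi}}"
  and card_int_box: "card {f :: 'i::finite \<Rightarrow> int. \<forall>i. f i \<in> {lo..hi}} = nat (hi - lo + 1) ^ CARD('i)"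
proof -
  have eq: "{f :: 'i \<Rightarrow> int. \<forall>i. f i \<in> {lo..hi}} = PiE UNIV (\<lambda>_. {lo..hi})"
    by (auto simp: PiE_def Pi_def extensional_def)
  show "finite {f :: 'i \<Rightarrow> int. \<forall>i. f i \<in> {lo..hi}}" unfolding eq by (intro finite_PiE) auto
  show "card {f :: 'i \<Rightarrow> int. \<forall>i. f i \<in> {lo..hi}} = nat (hi - lo + 1) ^ CARD('i)"
    unfolding eq by (subst card_PiE) auto
qed

lemma finite_int_vectors_box: "finite {a \<in> int_vectors. \<forall>i. \<bar>a $ i - y i\<bar> \<le> (L :: real)}"
  (is "finite ?S") for y :: "'d::finite \<Rightarrow> real"
proof -
  define b where "b = L + Max (range (\<lambda>i. \<bar>y i\<bar>))"
  have inj: "inj_on (\<lambda>a i. \<lfloor>a $ i\<rfloor>) ?S"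
  proof (rule inj_onI)
    fix a a' assume a: "a \<in> ?S" "a' \<in> ?S" "(\<lambda>i. \<lfloor>a $ i\<rfloor>) = (\<lambda>i. \<lfloor>a' $ i\<rfloor>)"
    have "a $ i = a' $ i" for i
    proof -
      have "a $ i \<in> \<int>" "a' $ i \<in> \<int>" using a by (auto simp: int_vectors_def)
      moreover have "\<lfloor>a $ i\<rfloor> = \<lfloor>a' $ i\<rfloor>" using fun_cong[OF a(3)] .
      ultimately show ?thesis by (metis of_int_floor)
    qed
    then show "a = a'" by (simp add: vec_eq_iff)
  qed
  have im: "(\<lambda>a i. \<lfloor>a $ i\<rfloor>) ` ?S \<subseteq> {f. \<forall>i. f i \<in> {\<lfloor>- b\<rfloor>..\<lfloor>b\<rfloor>}}"
  proof (intro image_subsetI, clarify)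
    fix a i assume a: "a \<in> int_vectors" "\<forall>i. \<bar>a $ i - y i\<bar> \<le> L"
    have "\<bar>y i\<bar> \<le> Max (range (\<lambda>i. \<bar>y i\<bar>))" by (intro Max_ge) auto
    then have "- b \<le> a $ i" "a $ i \<le> b" using a(2)[rule_format, of i] unfolding b_def by linarith+
    then show "\<lfloor>a $ i\<rfloor> \<in> {\<lfloor>- b\<rfloor>..\<lfloor>b\<rfloor>}" by (auto intro: floor_mono)
  qed
  show ?thesis by (rule inj_on_finite[OF inj im finite_int_box])
qed

text \<open>The first factors come from \<open>card_near_int_le\<close>, the last one from its
  parameter \<open>J\<close> being at least 1/(64 m \<delta>). The arguments only carry the
  dimensions.\<close>

definition cube_const :: "'m itself \<Rightarrow> 'k itself \<Rightarrow> real" where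
  "cube_const _ _ = 4 * (8 * real CARD('k)) ^ CARD('k) * (64 * real CARD('m)) ^ CARD('m)"

text \<open>The Fourier bound is used with \<open>J\<close> of order 1/\<delta>, which is at most
  N^\<tau>. The distance of \<open>A *v j\<close> to the integers is then at least c N^(-w\<tau>),
  and this beats a multiple of 1/N for large \<open>N\<close> because
  \<open>w * \<tau> < 1\<close>.\<close>

lemma card_cube_le:
  fixes A :: "real ^ 'm::finite ^ 'k::finite"
  assumes A: "dioph_bound c w A" "c > 0" "w > 0" and \<tau>: "\<tau> > 0" "w * \<tau> < 1"
  obtains N0 :: nat where "N0 \<ge> 1"
    "\<And>N \<delta> V. N \<ge> N0 \<Longrightarrow> real N powr (- \<tau>) \<le> \<delta> \<Longrightarrow> \<delta> \<le> 1 / (32 * real CARD('m)) \<Longrightarrow>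
       finite V \<Longrightarrow> V \<subseteq> int_vectors \<Longrightarrow> (\<And>v v' i. v \<in> V \<Longrightarrow> v' \<in> V \<Longrightarrow> \<bar>v $ i - v' $ i\<bar> \<le> real N) \<Longrightarrow>
       (\<And>v. v \<in> V \<Longrightarrow> near_int \<delta> (v v* A)) \<Longrightarrow>
       real (card V) \<le> cube_const TYPE('m) TYPE('k) * real N ^ CARD('k) * \<delta> ^ CARD('m)"
proof -
  \<comment> \<open>From here on c N^(1 - w\<tau>) is at least 1.\<close>
  define N0 where "N0 = nat \<lceil>(1/c) powr (1 / (1 - w * \<tau>))\<rceil> + 1"
  show ?thesis
  proof (rule that[of N0])
    show "N0 \<ge> 1" by (simp add: N0_def)
  next
    fix N :: nat and \<delta> :: real and V :: "(real ^ 'k) set"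
    assume N: "N \<ge> N0" and \<delta>: "real N powr (- \<tau>) \<le> \<delta>" "\<delta> \<le> 1 / (32 * real CARD('m))"
      and V: "finite V" "V \<subseteq> int_vectors" "\<And>v v' i. v \<in> V \<Longrightarrow> v' \<in> V \<Longrightarrow> \<bar>v $ i - v' $ i\<bar> \<le> real N"
        "\<And>v. v \<in> V \<Longrightarrow> near_int \<delta> (v v* A)"
    have N1: "N \<ge> 1" using N by (simp add: N0_def)
    have mpos: "real CARD('m) \<ge> 1" and kpos: "real CARD('k) \<ge> 1" by (simp_all add: Suc_leI)
    have \<delta>0: "\<delta> > 0" using \<delta>(1) N1 by (intro less_le_trans[OF _ \<delta>(1)]) auto
    \<comment> \<open>The upper bound on \<delta> makes the rounded number at least 1, so rounding
      down loses at most a factor 2; this is why 64 appears next to 32.\<close>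
    define J where "J = nat \<lfloor>1 / (32 * real CARD('m) * \<delta>)\<rfloor>"
    have X1: "1 / (32 * real CARD('m) * \<delta>) \<ge> 1" using \<delta>(2) \<delta>0 by (simp add: field_simps)
    have J: "J \<ge> 1" "real J \<le> 1 / (32 * real CARD('m) * \<delta>)" "real J \<ge> 1 / (64 * real CARD('m) * \<delta>)"
    proof -
      have *: "real J = of_int \<lfloor>1 / (32 * real CARD('m) * \<delta>)\<rfloor>" unfolding J_def by (rule of_nat_nat) (use X1 in linarith)
      have "real J > 0" unfolding * using X1 by linarith
      then show "J \<ge> 1" by simp
      show "real J \<le> 1 / (32 * real CARD('m) * \<delta>)" unfolding * by (rule of_int_floor_le)
      have "real J > 1 / (32 * real CARD('m) * \<delta>) - 1" unfolding * by linarith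
      moreover have "1 / (32 * real CARD('m) * \<delta>) = 2 * (1 / (64 * real CARD('m) * \<delta>))" by simp
      ultimately show "real J \<ge> 1 / (64 * real CARD('m) * \<delta>)" using \<open>J \<ge> 1\<close> by linarith
    qed
    have key: "c * real J powr (- w) > 1 / (8 * real CARD('k) * real N)"
    proof -
      have "1/c = ((1/c) powr (1 / (1 - w * \<tau>))) powr (1 - w * \<tau>)"
        using A(2) \<tau> by (simp add: powr_powr)
      also have "\<dots> \<le> real N powr (1 - w * \<tau>)"
      proof (rule powr_mono2)
        show "(1/c) powr (1 / (1 - w * \<tau>)) \<le> real N"
          using real_nat_ceiling_ge[of "(1/c) powr (1 / (1 - w * \<tau>))"] N unfolding N0_def by linarith
      qed (use \<tau> in auto)
      finally have 1: "1 \<le> c * real N powr (1 - w * \<tau>)" using A(2) by (simp add: field_simps)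
      have "real J \<le> 1 / (32 * real CARD('m) * \<delta>)" by (rule J)
      also have "\<dots> \<le> 1 / (1 * \<delta>)"
      proof (intro divide_left_mono mult_right_mono)
        show "1 \<le> 32 * real CARD('m)" using mpos by linarith
      qed (use mpos \<delta>0 in auto)
      also have "\<dots> \<le> 1 / real N powr (- \<tau>)" using \<delta> \<delta>0 N1 by (intro divide_left_mono) auto
      also have "\<dots> = real N powr \<tau>" by (simp add: powr_minus_divide)
      finally have "(real N powr \<tau>) powr (- w) \<le> real J powr (- w)"
        using J(1) A(3) by (intro powr_mono2') auto
      then have JN: "real N powr (- (w * \<tau>)) \<le> real J powr (- w)" by (simp add: powr_powr mult.commute)
      have "1 / (8 * real CARD('k) * real N) < 1 / real N"
      proof (intro divide_strict_left_mono)
        have "1 * real N < 8 * real CARD('k) * real N"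
          using kpos N1 by (intro mult_strict_right_mono) linarith+
        then show "real N < 8 * real CARD('k) * real N" by simp
      qed (use N1 in auto)
      also have "\<dots> \<le> c * real N powr (1 - w * \<tau>) / real N"
        using 1 N1 by (intro divide_right_mono) auto
      also have "\<dots> = c * real N powr (- (w * \<tau>))" using N1 by (simp add: powr_diff powr_minus_divide)
      also have "\<dots> \<le> c * real J powr (- w)" using JN A(2) by simp
      finally show ?thesis .
    qed
    have "real (card V) * real J ^ CARD('m) \<le> 4 * (8 * real CARD('k) * real N) ^ CARD('k)"
    proof (rule card_near_int_le[OF V(1,2) N1 J(1) V(3,4)])
      show "\<delta> \<le> 1 / (32 * real CARD('m) * real J)"
        using J(1,2) \<delta>0 by (simp add: field_simps)
      fix j p assume j: "j \<in> (int_vectors :: (real^'m) set)" "j \<noteq> 0" "\<And>l. \<bar>j $ l\<bar> < real J" "p \<in> (int_vectors :: (real^'k) set)"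
      show "\<exists>i. \<bar>(A *v j - p) $ i\<bar> > 1 / (8 * real CARD('k) * real N)"
      proof (rule ccontr)
        assume "\<not> ?thesis"
        then have "infnorm (A *v j - p) \<le> 1 / (8 * real CARD('k) * real N)"
          by (intro infnorm_le_cart) (simp add: not_less)
        moreover have "infnorm j \<le> real J" using j(3) by (intro infnorm_le_cart) (simp add: less_imp_le)
        then have "real J powr (- w) \<le> infnorm j powr (- w)"
          using infnorm_int_vectors_ge_1[OF j(1,2)] A(3) by (intro powr_mono2') auto
        then have "c * real J powr (- w) \<le> c * infnorm j powr (- w)" using A(2) by simp
        moreover have "c * infnorm j powr (- w) \<le> infnorm (A *v j - p)"
          using A(1) j(1,2,4) unfolding dioph_bound_def by blast
        ultimately show False using key by simp
      qed
    qed
    moreover have "real (card V) * (1 / (64 * real CARD('m) * \<delta>)) ^ CARD('m) \<le> real (card V) * real J ^ CARD('m)"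
      using J(3) \<delta>0 by (intro mult_left_mono power_mono) auto
    ultimately have "real (card V) * (1 / (64 * real CARD('m) * \<delta>)) ^ CARD('m) \<le> 4 * (8 * real CARD('k) * real N) ^ CARD('k)"
      by linarith
    then have "real (card V) \<le> 4 * (8 * real CARD('k) * real N) ^ CARD('k) * (64 * real CARD('m) * \<delta>) ^ CARD('m)"
      using \<delta>0 by (simp add: power_divide divide_le_eq)
    then show "real (card V) \<le> cube_const TYPE('m) TYPE('k) * real N ^ CARD('k) * \<delta> ^ CARD('m)"
      by (simp add: cube_const_def power_mult_distrib mult_ac)
  qed
qed

text \<open>Pigeonhole on the fractional parts of q y and of the images of the integer points (q,
  floor(q y)) under \<open>A\<close>. Taking these integer points, rather than q (1, y), keeps the
  error \<kappa> of the first block out of the second one; differences of integer points are again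
  of the form \<open>qvec q a\<close>.\<close>

lemma dirichlet_affine:
  fixes A :: "real ^ 'm::finite ^ ('d::finite) option" and y :: "real ^ 'd"
  assumes \<kappa>: "0 < \<kappa>" "\<kappa> \<le> 1" and \<delta>: "0 < \<delta>" "\<delta> \<le> 1"
    and Q: "(2 / \<kappa>) ^ CARD('d) * (2 / \<delta>) ^ CARD('m) \<le> real Q"
  obtains q a where "1 \<le> q" "q \<le> Q" "a \<in> int_vectors" "\<And>i. \<bar>real q * y $ i - a $ i\<bar> \<le> \<kappa>"
    "near_int \<delta> (qvec q a v* A)"
proof -
  define a :: "nat \<Rightarrow> real ^ 'd" where "a q = (\<chi> i. of_int \<lfloor>real q * y $ i\<rfloor>)" for q
  define \<theta> where "\<theta> q = qvec q (a q) v* A" for q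
  define f where "f q = (\<lambda>i. \<lfloor>frac (real q * y $ i) / \<kappa>\<rfloor>, \<lambda>l. \<lfloor>frac (\<theta> q $ l) / \<delta>\<rfloor>)" for q :: nat
  let ?X = "{g :: 'd \<Rightarrow> int. \<forall>i. g i \<in> {0..\<lfloor>1/\<kappa>\<rfloor>}} \<times> {g :: 'm \<Rightarrow> int. \<forall>i. g i \<in> {0..\<lfloor>1/\<delta>\<rfloor>}}"
  have fl: "\<lfloor>frac t / \<epsilon>\<rfloor> \<in> {0..\<lfloor>1/\<epsilon>\<rfloor>}" if "\<epsilon> > 0" for t \<epsilon> :: real
    using that frac_lt_1[of t] by (auto intro!: floor_mono divide_right_mono simp: less_imp_le)
  have "f ` {0..Q} \<subseteq> ?X" using fl \<kappa> \<delta> by (auto simp: f_def)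
  moreover have fin: "finite ?X" by (intro finite_cartesian_product finite_int_box)
  \<comment> \<open>There are \<open>Q + 1\<close> candidates including 0, so a number of boxes up
    to \<open>Q\<close> still forces a collision. Each side of length \<epsilon> \<le> 1 gives
    floor(1/\<epsilon>) + 1 \<le> 2/\<epsilon> boxes.\<close>
  moreover have "card ?X < card {0..Q}"
  proof -
    have c1: "real (nat (\<lfloor>1/\<epsilon>\<rfloor> - 0 + 1)) \<le> 2 / \<epsilon>" if e: "\<epsilon> > 0" "\<epsilon> \<le> 1" for \<epsilon> :: real
    proof -
      have "1 / \<epsilon> \<ge> 1" using e by simp
      then have "0 \<le> \<lfloor>1/\<epsilon>\<rfloor> - 0 + 1" by linarith
      from of_nat_nat[OF this] have "real (nat (\<lfloor>1/\<epsilon>\<rfloor> - 0 + 1)) = of_int \<lfloor>1/\<epsilon>\<rfloor> + 1" by simp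
      also have "\<dots> \<le> 1 / \<epsilon> + 1 / \<epsilon>" using \<open>1 / \<epsilon> \<ge> 1\<close> by linarith
      finally show ?thesis by simp
    qed
    have "real (card ?X) = real (nat (\<lfloor>1/\<kappa>\<rfloor> - 0 + 1)) ^ CARD('d) * real (nat (\<lfloor>1/\<delta>\<rfloor> - 0 + 1)) ^ CARD('m)"
      by (simp only: card_cartesian_product card_int_box of_nat_mult of_nat_power)
    also have "\<dots> \<le> (2 / \<kappa>) ^ CARD('d) * (2 / \<delta>) ^ CARD('m)"
      using \<kappa> \<delta> c1 by (intro mult_mono power_mono) auto
    also have "\<dots> \<le> real Q" by (rule Q)
    finally show ?thesis by simp
  qed
  ultimately have "\<not> inj_on f {0..Q}" using card_inj_on_le[of f "{0..Q}" ?X] by linarith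
  then obtain x x' where "x \<le> Q" "x' \<le> Q" "f x = f x'" "x \<noteq> x'"
    unfolding inj_on_def by auto
  then have "\<exists>q1 q2. q1 \<le> Q \<and> q2 \<le> Q \<and> q1 < q2 \<and> f q1 = f q2"
    by (metis linorder_neqE_nat)
  then obtain q1 q2 where q: "q1 \<le> Q" "q2 \<le> Q" "q1 < q2" "f q1 = f q2" by blast
  have close: "\<bar>(t2 - t1) - of_int (\<lfloor>t2\<rfloor> - \<lfloor>t1\<rfloor>)\<bar> \<le> \<epsilon>" if "\<lfloor>frac t1 / \<epsilon>\<rfloor> = \<lfloor>frac t2 / \<epsilon>\<rfloor>" "\<epsilon> > 0" for t1 t2 \<epsilon> :: real
  proof -
    have "\<bar>frac t2 / \<epsilon> - frac t1 / \<epsilon>\<bar> < 1" using that(1) by linarith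
    then have "\<bar>frac t2 - frac t1\<bar> / \<epsilon> < 1" using that(2) by (simp flip: diff_divide_distrib)
    then have "\<bar>frac t2 - frac t1\<bar> < \<epsilon>" using that(2) by (simp add: field_simps)
    then show ?thesis by (simp add: frac_def algebra_simps)
  qed
  have f1: "\<lfloor>frac (real q1 * y $ i) / \<kappa>\<rfloor> = \<lfloor>frac (real q2 * y $ i) / \<kappa>\<rfloor>" for i
    using q(4) unfolding f_def by (metis prod.inject)
  have f2: "\<lfloor>frac (\<theta> q1 $ l) / \<delta>\<rfloor> = \<lfloor>frac (\<theta> q2 $ l) / \<delta>\<rfloor>" for l
    using q(4) unfolding f_def by (metis prod.inject)
  have qv: "qvec (q2 - q1) (a q2 - a q1) = qvec q2 (a q2) - qvec q1 (a q1)"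
    using q(3) by (simp add: vec_eq_iff qvec_def of_nat_diff split: option.split)
  show ?thesis
  proof (rule that[of "q2 - q1" "a q2 - a q1"])
    show "1 \<le> q2 - q1" "q2 - q1 \<le> Q" using q by auto
    show "a q2 - a q1 \<in> int_vectors" by (auto simp: int_vectors_def a_def)
    show "\<bar>real (q2 - q1) * y $ i - (a q2 - a q1) $ i\<bar> \<le> \<kappa>" for i
      using close[OF f1 \<kappa>(1), of i] q(3) by (simp add: a_def of_nat_diff algebra_simps)
    show "near_int \<delta> (qvec (q2 - q1) (a q2 - a q1) v* A)"
      unfolding near_int_def
    proof (intro bexI[of _ "\<chi> l. of_int (\<lfloor>\<theta> q2 $ l\<rfloor> - \<lfloor>\<theta> q1 $ l\<rfloor>)"] allI)
      fix l
      have "(qvec (q2 - q1) (a q2 - a q1) v* A) $ l = \<theta> q2 $ l - \<theta> q1 $ l"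
        unfolding qv \<theta>_def by (simp add: vector_matrix_mult_def sum_subtractf left_diff_distrib)
      then show "\<bar>(qvec (q2 - q1) (a q2 - a q1) v* A) $ l - (\<chi> l. of_int (\<lfloor>\<theta> q2 $ l\<rfloor> - \<lfloor>\<theta> q1 $ l\<rfloor>)) $ l\<bar> \<le> \<delta>"
        using close[OF f2 \<delta>(1), of l] by simp
    qed (auto simp: int_vectors_def)
  qed
qed


section \<open>Counting rational points over a ball\<close>

definition approx_pairs :: "real ^ 'm::finite ^ ('d::finite) option \<Rightarrow> real \<Rightarrow> real ^ 'd \<Rightarrow> real \<Rightarrow> real \<Rightarrow> (nat \<times> (real ^ 'd)) set" where
  "approx_pairs A \<delta> x Q L = {(q, a). 1 \<le> q \<and> real q \<le> Q \<and> a \<in> int_vectors \<and>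
     (\<forall>i. \<bar>a $ i - real q * x $ i\<bar> \<le> L) \<and> near_int \<delta> (qvec q a v* A)}"

lemma finite_approx_pairs: "finite (approx_pairs A \<delta> x Q L)"
proof (rule finite_subset)
  show "approx_pairs A \<delta> x Q L \<subseteq> (SIGMA q:{..nat \<lfloor>Q\<rfloor>}. {a \<in> int_vectors. \<forall>i. \<bar>a $ i - real q * x $ i\<bar> \<le> L})"
    by (auto simp: approx_pairs_def le_nat_floor)
  show "finite (SIGMA q:{..nat \<lfloor>Q\<rfloor>}. {a \<in> int_vectors. \<forall>i. \<bar>a $ i - real q * x $ i\<bar> \<le> L})"
    by (intro finite_SigmaI finite_int_vectors_box) auto
qed

text \<open>
  The skewed box of all \<open>(q, a)\<close> with \<open>a/q\<close> near \<open>x\<close> is cut into cubes whose side is smaller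
  than \<open>Q R\<close> by a constant factor depending on \<open>x\<close>; that factor cancels in the total.
\<close>

lemma card_approx_pairs_le_cubes:
  fixes A :: "real ^ 'm::finite ^ ('d::finite) option" and x :: "real ^ 'd" and N :: nat
  assumes R: "R > 0" and K0: "K0 \<ge> 1" "R \<le> K0" "\<And>i. \<bar>x $ i\<bar> \<le> K0"
    and N: "N \<ge> 1" "real N \<le> Q * R / K0" "Q * R / K0 \<le> 2 * real N"
    and cube: "\<And>V. finite V \<Longrightarrow> V \<subseteq> int_vectors \<Longrightarrow> (\<And>v v' i. v \<in> V \<Longrightarrow> v' \<in> V \<Longrightarrow> \<bar>v $ i - v' $ i\<bar> \<le> real N) \<Longrightarrow>
       (\<And>v. v \<in> V \<Longrightarrow> near_int \<delta> (v v* A)) \<Longrightarrow> real (card V) \<le> B * real N ^ (CARD('d) + 1)"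
    and B: "B \<ge> 0"
  shows "real (card (approx_pairs A \<delta> x Q (Q * R))) \<le> 2 * 10 ^ CARD('d) * B * Q ^ (CARD('d) + 1) * R ^ CARD('d)"
proof -
  let ?S = "approx_pairs A \<delta> x Q (Q * R)"
  \<comment> \<open>Within a block of \<open>N\<close> consecutive denominators the centre q x moves
    by at most \<open>N * K0\<close>, which is at most \<open>Q * R\<close>. The cubes may therefore
    be aligned with the centre at the start of the block. The lower end \<open>- M - 1\<close> of
    the range below is needed because negative quotients are rounded down.\<close>
  define g where "g = (\<lambda>(q :: nat, a :: real ^ 'd). (q div N, \<lambda>i. \<lfloor>(a $ i - real (q div N * N) * x $ i) / real N\<rfloor>))"
  define M where "M = \<lfloor>4 * K0\<rfloor>"
  let ?X = "{..nat \<lfloor>Q / real N\<rfloor>} \<times> {f :: 'd \<Rightarrow> int. \<forall>i. f i \<in> {- M - 1..M}}"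
  have N0: "real N > 0" using N by simp
  have NK: "real N * K0 \<le> Q * R" using N K0 by (simp add: field_simps)
  moreover have "real N * K0 > 0" using N0 K0 by simp
  ultimately have Q0: "Q > 0" using R by (metis less_le_trans zero_less_mult_pos2)
  have QRN: "Q * R / real N \<le> 2 * K0" using N K0 N0 by (simp add: field_simps)
  have NQ: "real N \<le> Q"
  proof -
    have "real N * K0 \<le> Q * K0" using NK K0 Q0 mult_left_mono[of R K0 Q] by linarith
    then show ?thesis using K0 by simp
  qed
  have img: "g ` ?S \<subseteq> ?X"
  proof
    fix z assume "z \<in> g ` ?S"
    then obtain q a where qa: "(q, a) \<in> ?S" and z: "z = g (q, a)" by auto
    have q: "real q \<le> Q" "\<And>i. \<bar>a $ i - real q * x $ i\<bar> \<le> Q * R" using qa by (auto simp: approx_pairs_def)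
    have "real (q div N) \<le> real q / real N" by (rule of_nat_div_le_of_nat)
    also have "\<dots> \<le> Q / real N" using q N0 by (intro divide_right_mono) auto
    finally have 1: "q div N \<le> nat \<lfloor>Q / real N\<rfloor>" by (rule le_nat_floor)
    have 2: "\<lfloor>(a $ i - real (q div N * N) * x $ i) / real N\<rfloor> \<in> {- M - 1..M}" for i
    proof -
      have "real q - real (q div N * N) = real (q mod N)"
        by (metis add_diff_cancel_left' div_mult_mod_eq of_nat_add)
      moreover have "real (q mod N) \<le> real N" using N by (simp add: less_imp_le)
      ultimately have "\<bar>(real q - real (q div N * N)) * x $ i\<bar> \<le> real N * K0"
        unfolding abs_mult using K0(3)[of i] by (intro mult_mono) auto
      then have "\<bar>(real q - real (q div N * N)) * x $ i\<bar> \<le> Q * R" using NK by simp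
      then have "\<bar>a $ i - real (q div N * N) * x $ i\<bar> \<le> 2 * (Q * R)"
        using q(2)[of i] by (simp add: algebra_simps)
      then have "\<bar>(a $ i - real (q div N * N) * x $ i) / real N\<bar> \<le> 2 * (Q * R) / real N"
        using N0 by (simp add: abs_divide divide_right_mono)
      also have "\<dots> \<le> 4 * K0" using QRN by simp
      finally have le: "\<bar>(a $ i - real (q div N * N) * x $ i) / real N\<bar> \<le> 4 * K0" .
      show ?thesis unfolding M_def atLeastAtMost_iff by (intro conjI) (use le in linarith)+
    qed
    show "z \<in> ?X" using 1 2 by (simp add: z g_def)
  qed
  have fibre: "real (card {z \<in> ?S. g z = y}) \<le> B * real N ^ (CARD('d) + 1)" for y
  proof -
    let ?F = "{z \<in> ?S. g z = y}"
    let ?V = "(\<lambda>(q, a). qvec q a) ` ?F"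
    have finF: "finite ?F" by (rule finite_subset[OF _ finite_approx_pairs]) blast
    have "inj_on (\<lambda>(q, a). qvec q a) ?F" by (auto simp: inj_on_def qvec_eq_iff)
    then have "card ?F = card ?V" by (simp add: card_image)
    also have "real \<dots> \<le> B * real N ^ (CARD('d) + 1)"
    proof (rule cube)
      show "finite ?V" using finF by simp
      show "?V \<subseteq> int_vectors" by (auto simp: approx_pairs_def intro!: qvec_int_vectors)
      show "near_int \<delta> (v v* A)" if "v \<in> ?V" for v using that by (auto simp: approx_pairs_def)
      fix v v' k assume "v \<in> ?V" "v' \<in> ?V"
      then obtain q a q' a' where v: "v = qvec q a" "v' = qvec q' a'" "g (q, a) = g (q', a')" by auto
      have dq: "q div N = q' div N" using v(3) by (simp add: g_def)
      show "\<bar>v $ k - v' $ k\<bar> \<le> real N"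
      proof (cases k)
        case None
        have "real q = real (q div N * N) + real (q mod N)" "real q' = real (q div N * N) + real (q' mod N)"
          unfolding of_nat_add[symmetric] by (simp, simp add: dq)
        moreover have "real (q mod N) < real N" "real (q' mod N) < real N" using N by auto
        ultimately have "\<bar>real q - real q'\<bar> \<le> real N" by linarith
        then show ?thesis unfolding v None by simp
      next
        case (Some i)
        let ?b = "real (q div N * N) * x $ i"
        have "\<lfloor>(a $ i - ?b) / real N\<rfloor> = \<lfloor>(a' $ i - ?b) / real N\<rfloor>"
          using v(3) dq unfolding g_def by (simp add: fun_eq_iff)
        then have "\<bar>(a $ i - ?b) / real N - (a' $ i - ?b) / real N\<bar> < 1" by linarith
        then have "\<bar>a $ i - a' $ i\<bar> / real N < 1" using N0 by (simp flip: diff_divide_distrib)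
        then have "\<bar>a $ i - a' $ i\<bar> < real N" using N0 by (simp add: field_simps)
        then show ?thesis unfolding v Some by simp
      qed
    qed
    finally show ?thesis .
  qed
  have M0: "M \<ge> 4" using K0 unfolding M_def by linarith
  have finX: "finite ?X" by (intro finite_cartesian_product finite_int_box) simp
  have "?S = (\<Union>y\<in>?X. {z \<in> ?S. g z = y})" using img by blast
  then have "real (card ?S) \<le> (\<Sum>y\<in>?X. real (card {z \<in> ?S. g z = y}))"
    using card_UN_le[OF finX, of "\<lambda>y. {z \<in> ?S. g z = y}"] by (simp flip: of_nat_sum)
  also have "\<dots> \<le> (\<Sum>y\<in>?X. B * real N ^ (CARD('d) + 1))" by (intro sum_mono fibre)
  also have "\<dots> = real (card ?X) * (B * real N ^ (CARD('d) + 1))" by simp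
  also have "real (card ?X) = real (Suc (nat \<lfloor>Q / real N\<rfloor>)) * real (nat (M - (- M - 1) + 1)) ^ CARD('d)"
    by (simp only: card_cartesian_product card_int_box of_nat_mult of_nat_power card_atMost)
  also have "\<dots> \<le> (2 * (Q / real N)) * (10 * K0) ^ CARD('d)"
  proof (intro mult_mono power_mono)
    have "Q / real N \<ge> 1" using NQ N0 by simp
    moreover have "real (nat \<lfloor>Q / real N\<rfloor>) \<le> Q / real N" using Q0 N0 by (intro of_nat_floor) simp
    ultimately show "real (Suc (nat \<lfloor>Q / real N\<rfloor>)) \<le> 2 * (Q / real N)"
      unfolding of_nat_Suc by linarith
    have "0 \<le> M - (- M - 1) + 1" using M0 by simp
    from of_nat_nat[OF this, where ?'a = real] have "real (nat (M - (- M - 1) + 1)) = 2 * of_int M + 2" by simp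
    also have "\<dots> \<le> 10 * K0" using K0 unfolding M_def by linarith
    finally show "real (nat (M - (- M - 1) + 1)) \<le> 10 * K0" .
  qed (use Q0 N0 in auto)
  finally have "real (card ?S) \<le> (2 * (Q / real N)) * (10 * K0) ^ CARD('d) * (B * real N ^ (CARD('d) + 1))"
    using B by (simp add: mult_right_mono)
  \<comment> \<open>The loss \<open>K0\<close> in the number of cubes meets the side
    \<open>N\<close> here, and their product is at most \<open>Q * R\<close>.\<close>
  also have "\<dots> = 2 * 10 ^ CARD('d) * B * Q * (real N * K0) ^ CARD('d)"
    using N0 by (simp add: power_mult_distrib field_simps)
  also have "\<dots> \<le> 2 * 10 ^ CARD('d) * B * Q * (Q * R) ^ CARD('d)"
    using NK K0 B Q0 by (intro mult_left_mono power_mono) auto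
  also have "\<dots> = 2 * 10 ^ CARD('d) * B * Q ^ (CARD('d) + 1) * R ^ CARD('d)"
    by (simp add: power_mult_distrib mult_ac)
  finally show ?thesis .
qed

text \<open>With Q = 2^(i+1), the factor 2 * 10^d of the cube decomposition is multiplied by
  2^(d+1), which makes 4 * 20^d.\<close>

definition local_const :: "'m itself \<Rightarrow> 'd itself \<Rightarrow> real" where
  "local_const _ _ = 4 * 20 ^ CARD('d) * cube_const TYPE('m) TYPE('d option)"

lemma cube_const_nonneg: "cube_const a b \<ge> 0"
  by (simp add: cube_const_def)

lemma inverse_card_le_1: "1 / (32 * real CARD('m::finite)) \<le> 1"
proof -
  have "real CARD('m) \<ge> 1" by (simp add: Suc_leI)
  then have "1 \<le> 32 * real CARD('m)" by linarith
  then show ?thesis by simp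
qed

lemma local_const_nonneg: "local_const a b \<ge> 0"
  by (simp add: local_const_def cube_const_nonneg)

text \<open>The cubes have side about 2^i times a factor \<open>b\<close> that depends on the ball.
  The gap between \<open>\<tau>'\<close> and \<tau> absorbs the power of \<open>b\<close> once
  \<open>i\<close> is large. Only the threshold \<open>i0\<close> depends on \<open>x\<close> and
  \<open>R\<close>; the constant does not, and this uniformity is what richness in every ball rests
  on.\<close>

lemma card_approx_pairs_le:
  fixes A :: "real ^ 'm::finite ^ ('d::finite) option" and x :: "real ^ 'd"
  assumes A: "dioph_bound c w A" "c > 0" "w > 0" and \<tau>: "0 < \<tau>'" "\<tau>' < \<tau>" "w * \<tau> < 1" and R: "R > 0"
  obtains i0 :: nat where "\<And>i \<delta>. i \<ge> i0 \<Longrightarrow> (2 ^ i) powr (- \<tau>') \<le> \<delta> \<Longrightarrow> \<delta> \<le> 1 / (32 * real CARD('m)) \<Longrightarrow>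
      real (card (approx_pairs A \<delta> x (2 ^ (i + 1)) (2 ^ (i + 1) * R)))
        \<le> local_const TYPE('m) TYPE('d) * \<delta> ^ CARD('m) * (2 ^ i) ^ (CARD('d) + 1) * R ^ CARD('d)"
proof -
  have \<tau>0: "\<tau> > 0" using \<tau> by simp
  obtain N0 :: nat where N0: "N0 \<ge> 1"
    "\<And>N \<delta> V. N \<ge> N0 \<Longrightarrow> real N powr (- \<tau>) \<le> \<delta> \<Longrightarrow> \<delta> \<le> 1 / (32 * real CARD('m)) \<Longrightarrow>
       finite V \<Longrightarrow> V \<subseteq> int_vectors \<Longrightarrow> (\<And>v v' i. v \<in> V \<Longrightarrow> v' \<in> V \<Longrightarrow> \<bar>v $ i - v' $ i\<bar> \<le> real N) \<Longrightarrow>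
       (\<And>v. v \<in> V \<Longrightarrow> near_int \<delta> (v v* A)) \<Longrightarrow>
       real (card V) \<le> cube_const TYPE('m) TYPE('d option) * real N ^ CARD('d option) * \<delta> ^ CARD('m)"
    by (rule card_cube_le[OF A \<tau>0 \<tau>(3)]) blast
  define K0 where "K0 = max 1 (max R (infnorm x))"
  have K0: "K0 \<ge> 1" "R \<le> K0" "\<And>i. \<bar>x $ i\<bar> \<le> K0"
    unfolding K0_def by (auto intro: component_le_infnorm_cart max.coboundedI2)
  define b where "b = R / K0"
  have b: "b > 0" using R K0 by (simp add: b_def)
  obtain i0 where i0: "max ((real N0 + 1) / b) (b powr (- \<tau> / (\<tau> - \<tau>'))) < 2 ^ i0"
  proof -
    have "\<exists>i0. max ((real N0 + 1) / b) (b powr (- \<tau> / (\<tau> - \<tau>'))) < 2 ^ i0" by (rule real_arch_pow) simp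
    then show ?thesis using that by blast
  qed
  show ?thesis
  proof (rule that[of i0])
    fix i \<delta> assume i: "i \<ge> i0" and \<delta>: "(2 ^ i) powr (- \<tau>') \<le> \<delta>" "\<delta> \<le> 1 / (32 * real CARD('m))"
    define Q :: real where "Q = 2 ^ (i + 1)"
    have "(2::real) ^ i0 \<le> 2 ^ i" using i by (intro power_increasing) auto
    then have i1: "(real N0 + 1) / b \<le> 2 ^ i" "b powr (- \<tau> / (\<tau> - \<tau>')) \<le> 2 ^ i"
      using i0[unfolded max_less_iff_conj] by linarith+
    define N where "N = nat \<lfloor>Q * R / K0\<rfloor>"
    have Qb: "Q * R / K0 = 2 * (2 ^ i * b)" by (simp add: Q_def b_def)
    have big: "2 ^ i * b \<ge> real N0 + 1" using i1(1) b by (simp add: field_simps)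
    have N: "real N = of_int \<lfloor>Q * R / K0\<rfloor>" unfolding N_def
      by (rule of_nat_nat) (use big Qb in linarith)
    have N1: "real N \<le> Q * R / K0" unfolding N by (rule of_int_floor_le)
    have N2: "Q * R / K0 \<le> real N + 1" unfolding N by linarith
    have N3: "2 ^ i * b \<le> real N" "N0 \<le> N" using N2 Qb big by linarith+
    have N4: "1 \<le> N" using N3 N0 by simp
    have \<delta>0: "\<delta> > 0" by (rule less_le_trans[OF _ \<delta>(1)]) simp
    have "real N powr (- \<tau>) \<le> (2 ^ i * b) powr (- \<tau>)"
      using N3 b \<tau>0 by (intro powr_mono2') auto
    also have "\<dots> = (2 ^ i) powr (- \<tau>) * b powr (- \<tau>)" using b by (simp add: powr_mult)
    also have "b powr (- \<tau>) = (b powr (- \<tau> / (\<tau> - \<tau>'))) powr (\<tau> - \<tau>')"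
      using \<tau> by (simp add: powr_powr)
    also have "\<dots> \<le> (2 ^ i) powr (\<tau> - \<tau>')" using i1(2) \<tau> by (intro powr_mono2) auto
    also have "(2 ^ i) powr (- \<tau>) * (2 ^ i) powr (\<tau> - \<tau>') = (2 ^ i :: real) powr (- \<tau>')"
      by (simp flip: powr_add)
    also have "\<dots> \<le> \<delta>" by (rule \<delta>)
    finally have N5: "real N powr (- \<tau>) \<le> \<delta>" by simp
    have "real (card (approx_pairs A \<delta> x Q (Q * R)))
        \<le> 2 * 10 ^ CARD('d) * (cube_const TYPE('m) TYPE('d option) * \<delta> ^ CARD('m)) * Q ^ (CARD('d) + 1) * R ^ CARD('d)"
    proof (rule card_approx_pairs_le_cubes[OF R K0 N4 N1])
      show "Q * R / K0 \<le> 2 * real N" using N2 N4 by linarith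
      show "cube_const TYPE('m) TYPE('d option) * \<delta> ^ CARD('m) \<ge> 0"
        using \<delta>0 by (simp add: cube_const_nonneg)
      fix V :: "(real ^ 'd option) set"
      assume V: "finite V" "V \<subseteq> int_vectors" "\<And>v v' i. v \<in> V \<Longrightarrow> v' \<in> V \<Longrightarrow> \<bar>v $ i - v' $ i\<bar> \<le> real N"
        "\<And>v. v \<in> V \<Longrightarrow> near_int \<delta> (v v* A)"
      show "real (card V) \<le> cube_const TYPE('m) TYPE('d option) * \<delta> ^ CARD('m) * real N ^ (CARD('d) + 1)"
        using N0(2)[OF N3(2) N5 \<delta>(2) V] by (simp add: mult_ac)
    qed
    also have "\<dots> = local_const TYPE('m) TYPE('d) * \<delta> ^ CARD('m) * (2 ^ i) ^ (CARD('d) + 1) * R ^ CARD('d)"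
    proof -
      have "(20::real) ^ CARD('d) = 10 ^ CARD('d) * 2 ^ CARD('d)" by (simp flip: power_mult_distrib)
      then show ?thesis by (simp add: Q_def local_const_def power_mult_distrib mult_ac)
    qed
    finally show "real (card (approx_pairs A \<delta> x (2 ^ (i + 1)) (2 ^ (i + 1) * R)))
        \<le> local_const TYPE('m) TYPE('d) * \<delta> ^ CARD('m) * (2 ^ i) ^ (CARD('d) + 1) * R ^ CARD('d)"
      by (simp only: Q_def)
  qed
qed

section \<open>Rational points of large and of small denominator\<close>

text \<open>The denominators lie between 2^(k-e) and 2^k; the lower bound is written as a product to
  avoid truncated subtraction.\<close>

definition rat_points :: "real ^ 'm::finite ^ ('d::finite) option \<Rightarrow> real \<Rightarrow> nat \<Rightarrow> nat \<Rightarrow> (real ^ 'd) set" where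
  "rat_points A \<delta> k e = {(1 / real q) *\<^sub>R a | q a. 1 \<le> q \<and> q \<le> 2 ^ k \<and> 2 ^ k \<le> 2 ^ e * q \<and>
     a \<in> int_vectors \<and> near_int \<delta> (qvec q a v* A)}"

text \<open>
  With \<open>\<kappa> = 2\<^sup>k * spacing\<close> the condition of Dirichlet's theorem for denominators up to \<open>2\<^sup>k\<close> holds
  with equality.
\<close>

definition spacing :: "'m itself \<Rightarrow> 'd itself \<Rightarrow> nat \<Rightarrow> real \<Rightarrow> real" where
  "spacing _ _ k \<delta> = 2 * (2 ^ CARD('m) / (2 ^ k * \<delta> ^ CARD('m))) powr (1 / real CARD('d)) / 2 ^ k"

lemma spacing_power:
  fixes \<delta> :: real
  assumes "\<delta> > 0"
  shows "(2 ^ k * spacing TYPE('m::finite) TYPE('d::finite) k \<delta>) ^ CARD('d)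
      = 2 ^ (CARD('d) + CARD('m)) / (2 ^ k * \<delta> ^ CARD('m))"
proof -
  have "((2 ^ CARD('m) / (2 ^ k * \<delta> ^ CARD('m))) powr (1 / real CARD('d))) ^ CARD('d)
      = 2 ^ CARD('m) / (2 ^ k * \<delta> ^ CARD('m))"
    using assms by (simp add: powr_power)
  then show ?thesis by (simp add: spacing_def power_mult_distrib power_add)
qed

lemma spacing_pos: "\<delta> > 0 \<Longrightarrow> spacing TYPE('m::finite) TYPE('d::finite) k \<delta> > 0"
  by (simp add: spacing_def)

lemma norm_le_card_mult: "(\<And>i. \<bar>v $ i\<bar> \<le> b) \<Longrightarrow> norm (v :: real ^ 'n::finite) \<le> real CARD('n) * b"
  using norm_le_l1_cart[of v] sum_bounded_above[of UNIV "\<lambda>i. \<bar>v $ i\<bar>" b] by simp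

text \<open>All pairs with \<open>q < 2 ^ n\<close> that Dirichlet's theorem may return for a point
  y of \<open>cball x R\<close>: q y is within q R of q x, and \<open>a\<close> is within \<kappa>
  of q y.\<close>

definition small_denom :: "real ^ 'm::finite ^ ('d::finite) option \<Rightarrow> real \<Rightarrow> real \<Rightarrow> real ^ 'd \<Rightarrow> real \<Rightarrow> nat \<Rightarrow> (nat \<times> (real ^ 'd)) set" where
  "small_denom A \<delta> \<kappa> x R n = {(q, a). 1 \<le> q \<and> q < 2 ^ n \<and> a \<in> int_vectors \<and>
     (\<forall>i. \<bar>a $ i - real q * x $ i\<bar> \<le> real q * R + \<kappa>) \<and> near_int \<delta> (qvec q a v* A)}"

text \<open>
  The contribution of the balls around the rational points of denominator less than
  \<open>2\<^sup>k\<^sup>-\<^sup>e\<close> supplied by Dirichlet's theorem.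
\<close>

lemma small_denom_sum_le:
  fixes A :: "real ^ 'm::finite ^ ('d::finite) option" and x :: "real ^ 'd"
  assumes A: "dioph_bound c w A" "c > 0" "w > 0"
    and \<tau>: "0 < \<tau>2" "\<tau>2 < \<tau>" "w * \<tau> < 1" "real CARD('m) * \<tau>2 < 1" and R: "R > 0"
  obtains M0 :: real where "M0 \<ge> 0"
    "\<And>k \<delta> \<kappa> F. 0 < \<delta> \<Longrightarrow> \<delta> \<le> 1 / (32 * real CARD('m)) \<Longrightarrow> 0 < \<kappa> \<Longrightarrow> \<kappa> \<le> 1 \<Longrightarrow> e \<le> k \<Longrightarrow>
       F = small_denom A \<delta> \<kappa> x R (k - e) \<Longrightarrow>
       finite F \<and> (\<Sum>(q, a)\<in>F. (real CARD('d) * \<kappa> / real q) ^ CARD('d)) \<le>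
         (real CARD('d) * \<kappa>) ^ CARD('d) * (M0 + local_const TYPE('m) TYPE('d) * (2 * R) ^ CARD('d) *
            (2 ^ k / 2 ^ e * \<delta> ^ CARD('m) + real k * (2 ^ k) powr (1 - real CARD('m) * \<tau>2)))"
proof -
  let ?d = "CARD('d)" and ?m = "CARD('m)"
  let ?L = "local_const TYPE('m) TYPE('d)"
  have R2: "2 * R > 0" using R by simp
  have L0: "?L \<ge> 0" by (rule local_const_nonneg)
  obtain i1 :: nat where i1: "\<And>i \<delta>. i \<ge> i1 \<Longrightarrow> (2 ^ i) powr (- \<tau>2) \<le> \<delta> \<Longrightarrow> \<delta> \<le> 1 / (32 * real CARD('m)) \<Longrightarrow>
      real (card (approx_pairs A \<delta> x (2 ^ (i + 1)) (2 ^ (i + 1) * (2 * R))))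
        \<le> ?L * \<delta> ^ CARD('m) * (2 ^ i) ^ (CARD('d) + 1) * (2 * R) ^ CARD('d)"
    by (rule card_approx_pairs_le[OF A \<tau>(1-3) R2, where x = x]) blast
  \<comment> \<open>From this level on, \<kappa> \<le> 1 is absorbed by replacing \<open>R\<close>
    with \<open>2 * R\<close>, and the enlarged thickness used below stays in the range of the
    counting lemma.\<close>
  obtain i2 where i2: "max (1 / R) ((32 * real ?m) powr (1 / \<tau>2)) < 2 ^ i2"
  proof -
    have "\<exists>i2. max (1 / R) ((32 * real ?m) powr (1 / \<tau>2)) < 2 ^ i2" by (rule real_arch_pow) simp
    then show ?thesis using that by blast
  qed
  define i0 where "i0 = max i1 i2"
  \<comment> \<open>The finitely many levels below \<open>i0\<close> are bounded crudely. Thickness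
    1 makes \<open>S\<close>, and hence \<open>M0\<close>, independent of \<open>k\<close>, \<delta>
    and \<kappa>.\<close>
  define S where "S = approx_pairs A 1 x (2 ^ i0) (2 ^ i0 * R + 1)"
  define M0 where "M0 = real i0 * real (card S)"
  show ?thesis
  proof (rule that[of M0])
    show "M0 \<ge> 0" by (simp add: M0_def)
    fix k and \<delta> \<kappa> :: real and F
    assume \<delta>: "0 < \<delta>" "\<delta> \<le> 1 / (32 * real CARD('m))" and \<kappa>: "0 < \<kappa>" "\<kappa> \<le> 1" and e: "e \<le> k"
      and F: "F = small_denom A \<delta> \<kappa> x R (k - e)"
    have FD: "1 \<le> q" "q < 2 ^ (k - e)" "a \<in> int_vectors" "\<And>i. \<bar>a $ i - real q * x $ i\<bar> \<le> real q * R + \<kappa>"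
      "near_int \<delta> (qvec q a v* A)" if "(q, a) \<in> F" for q a
      using that by (auto simp: F small_denom_def)
    have \<delta>1: "\<delta> \<le> 1" using \<delta>(2) inverse_card_le_1[where 'm = 'm] by (rule order.trans)
    have in_pairs: "z \<in> approx_pairs A \<delta>' x (2 ^ n) L"
      if z: "z \<in> F" "fst z < 2 ^ n" "2 ^ n * R + 1 \<le> L" "\<delta> \<le> \<delta>'" for z n L \<delta>'
    proof -
      obtain q a where zz: "z = (q, a)" by (cases z)
      have qa: "(q, a) \<in> F" using z(1) zz by simp
      have "real q \<le> real (2 ^ n)" using z(2) zz by (intro of_nat_mono) simp
      then have ql: "real q \<le> 2 ^ n" by simp
      then have "real q * R \<le> 2 ^ n * R" using R by (intro mult_right_mono) auto
      then have "\<bar>a $ i - real q * x $ i\<bar> \<le> L" for i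
        using FD(4)[OF qa, of i] \<kappa> z(3) by linarith
      moreover have "near_int \<delta>' (qvec q a v* A)" using FD(5)[OF qa] z(4) by (rule near_int_mono)
      ultimately show ?thesis using FD(1,3)[OF qa] ql by (simp add: approx_pairs_def zz)
    qed
    have fin: "finite F"
    proof (rule finite_subset[OF subsetI finite_approx_pairs])
      fix z assume z: "z \<in> F"
      then have "fst z < 2 ^ (k - e)" using FD(2)[of "fst z" "snd z"] by simp
      then show "z \<in> approx_pairs A \<delta> x (2 ^ (k - e)) (2 ^ (k - e) * R + 1)" using z by (intro in_pairs) auto
    qed
    define E where "E i = {z :: nat \<times> (real ^ 'd). 2 ^ i \<le> fst z \<and> fst z < 2 ^ (i + 1)}" for i :: nat
    define f where "f z = (real ?d * \<kappa> / real (fst z)) ^ ?d" for z :: "nat \<times> (real ^ 'd)"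
    have f0: "f z \<ge> 0" for z using \<kappa> by (simp add: f_def)
    have cover: "F \<subseteq> (\<Union>i\<in>{..<k - e}. E i)"
    proof
      fix z assume z: "z \<in> F"
      then have zq: "1 \<le> fst z" "fst z < 2 ^ (k - e)" using FD(1,2)[of "fst z" "snd z"] by auto
      obtain i where i: "2 ^ i \<le> fst z" "fst z < 2 ^ (i + 1)" using ex_power_ivl1[of 2 "fst z"] zq by auto
      have "(2::nat) ^ i < 2 ^ (k - e)" using i zq by linarith
      then have "i < k - e" by simp
      then show "z \<in> (\<Union>i\<in>{..<k - e}. E i)" using i by (auto simp: E_def)
    qed
    have small: "sum f (F \<inter> E i) \<le> real (card S) * (real ?d * \<kappa>) ^ ?d" if i: "i < i0" for i
    proof -
      have sub: "F \<inter> E i \<subseteq> S"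
        unfolding S_def
      proof
        fix z assume z: "z \<in> F \<inter> E i"
        then have "fst z < 2 ^ (i + 1)" by (simp add: E_def)
        also have "(2::nat) ^ (i + 1) \<le> 2 ^ i0" using i by (intro power_increasing) auto
        finally show "z \<in> approx_pairs A 1 x (2 ^ i0) (2 ^ i0 * R + 1)"
          using z \<delta>1 by (intro in_pairs) auto
      qed
      have "f z \<le> (real ?d * \<kappa>) ^ ?d" if "z \<in> F \<inter> E i" for z
      proof -
        have "1 \<le> fst z" using that FD(1)[of "fst z" "snd z"] by simp
        then have "real ?d * \<kappa> / real (fst z) \<le> real ?d * \<kappa> / 1"
          using \<kappa> by (intro divide_left_mono) auto
        then show ?thesis unfolding f_def using \<kappa> by (intro power_mono) auto
      qed
      then have "sum f (F \<inter> E i) \<le> of_nat (card (F \<inter> E i)) * (real ?d * \<kappa>) ^ ?d"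
        by (intro sum_bounded_above) auto
      also have "\<dots> \<le> real (card S) * (real ?d * \<kappa>) ^ ?d"
        using card_mono[OF finite_approx_pairs sub[unfolded S_def]] \<kappa> by (intro mult_right_mono) (auto simp: S_def)
      finally show ?thesis .
    qed
    let ?T = "\<lambda>i. (2 ^ i * \<delta> ^ ?m + (2 ^ i) powr (1 - real ?m * \<tau>2)) :: real"
    have large: "sum f (F \<inter> E i) \<le> (real ?d * \<kappa>) ^ ?d * (?L * (2 * R) ^ ?d * ?T i)" if i: "i \<ge> i0" for i
    proof -
      \<comment> \<open>For small denominators \<delta> may be thinner than the counting lemma
        permits. The thickness is then enlarged to the threshold, at the price of the second summand
        of \<open>?T\<close>.\<close>
      define \<delta>' where "\<delta>' = max \<delta> ((2 ^ i) powr (- \<tau>2))"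
      have "(2::real) ^ i2 \<le> 2 ^ i" using i by (intro power_increasing) (auto simp: i0_def)
      then have two: "1 / R \<le> 2 ^ i" "(32 * real ?m) powr (1 / \<tau>2) \<le> 2 ^ i"
        using i2[unfolded max_less_iff_conj] by linarith+
      have "(2 ^ i) powr (- \<tau>2) \<le> ((32 * real ?m) powr (1 / \<tau>2)) powr (- \<tau>2)"
        using two(2) \<tau> by (intro powr_mono2') auto
      also have "\<dots> = (32 * real ?m) powr (- 1)" using \<tau> by (simp add: powr_powr)
      also have "\<dots> = 1 / (32 * real ?m)" by (simp add: powr_minus_divide)
      finally have \<delta>': "\<delta>' \<le> 1 / (32 * real ?m)" using \<delta>(2) by (simp add: \<delta>'_def)
      let ?P = "approx_pairs A \<delta>' x (2 ^ (i + 1)) (2 ^ (i + 1) * (2 * R))"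
      have sub: "F \<inter> E i \<subseteq> ?P"
      proof
        fix z assume z: "z \<in> F \<inter> E i"
        have "1 \<le> 2 ^ (i + 1) * R" using two(1) R by (simp add: field_simps)
        then show "z \<in> ?P" using z by (intro in_pairs) (auto simp: E_def \<delta>'_def mult_ac)
      qed
      have "f z \<le> (real ?d * \<kappa>) ^ ?d / (2 ^ i) ^ ?d" if "z \<in> F \<inter> E i" for z
      proof -
        have "2 ^ i \<le> fst z" using that by (simp add: E_def)
        then have "real (2 ^ i) \<le> real (fst z)" by (rule of_nat_mono)
        moreover from this have "real (fst z) > 0" by (rule less_le_trans[rotated]) simp
        ultimately have "real ?d * \<kappa> / real (fst z) \<le> real ?d * \<kappa> / 2 ^ i"
          using \<kappa> by (intro divide_left_mono) auto
        then show ?thesis unfolding f_def power_divide[symmetric] using \<kappa> by (intro power_mono) auto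
      qed
      then have "sum f (F \<inter> E i) \<le> of_nat (card (F \<inter> E i)) * ((real ?d * \<kappa>) ^ ?d / (2 ^ i) ^ ?d)"
        by (intro sum_bounded_above) auto
      also have "\<dots> \<le> real (card ?P) * ((real ?d * \<kappa>) ^ ?d / (2 ^ i) ^ ?d)"
        using card_mono[OF finite_approx_pairs sub] \<kappa> by (intro mult_right_mono) auto
      also have "\<dots> \<le> ?L * \<delta>' ^ ?m * (2 ^ i) ^ (?d + 1) * (2 * R) ^ ?d * ((real ?d * \<kappa>) ^ ?d / (2 ^ i) ^ ?d)"
      proof (intro mult_right_mono i1 \<delta>')
        show "i1 \<le> i" using i by (simp add: i0_def)
        show "(2 ^ i) powr (- \<tau>2) \<le> \<delta>'" by (simp add: \<delta>'_def)
      qed (use \<kappa> in auto)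
      also have "\<dots> = (real ?d * \<kappa>) ^ ?d * (?L * (2 * R) ^ ?d * (2 ^ i * \<delta>' ^ ?m))"
        by simp
      also have "\<dots> \<le> (real ?d * \<kappa>) ^ ?d * (?L * (2 * R) ^ ?d * ?T i)"
      proof (intro mult_left_mono)
        have "\<delta>' ^ ?m \<le> \<delta> ^ ?m + ((2 ^ i) powr (- \<tau>2)) ^ ?m"
          using \<delta> by (auto simp: \<delta>'_def max_def)
        also have "((2 ^ i) powr (- \<tau>2)) ^ ?m = (2 ^ i :: real) powr (- (real ?m * \<tau>2))"
          by (simp add: powr_power mult.commute)
        finally have "2 ^ i * \<delta>' ^ ?m \<le> 2 ^ i * (\<delta> ^ ?m + (2 ^ i) powr (- (real ?m * \<tau>2)))"
          by (intro mult_left_mono) auto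
        also have "\<dots> = ?T i" by (simp add: distrib_left powr_diff powr_minus_divide)
        finally show "2 ^ i * \<delta>' ^ ?m \<le> ?T i" .
      qed (use R \<kappa> L0 in auto)
      finally show ?thesis .
    qed
    have T0: "?T i \<ge> 0" for i using \<delta> by simp
    have "sum f F \<le> (\<Sum>i<k - e. sum f (F \<inter> E i))"
      using fin cover f0 by (intro sum_le_sum_cover) auto
    also have "\<dots> \<le> (\<Sum>i<k - e. (if i < i0 then real (card S) * (real ?d * \<kappa>) ^ ?d else 0)
         + (real ?d * \<kappa>) ^ ?d * (?L * (2 * R) ^ ?d * ?T i))"
    proof (rule sum_mono)
      fix i
      have nn: "(real ?d * \<kappa>) ^ ?d * (?L * (2 * R) ^ ?d * ?T i) \<ge> 0"
        using \<kappa> R T0[of i] L0 by (intro mult_nonneg_nonneg zero_le_power) auto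
      show "sum f (F \<inter> E i) \<le> (if i < i0 then real (card S) * (real ?d * \<kappa>) ^ ?d else 0)
         + (real ?d * \<kappa>) ^ ?d * (?L * (2 * R) ^ ?d * ?T i)"
        using small[of i] large[of i] nn by (cases "i < i0") auto
    qed
    also have "\<dots> = (\<Sum>i<k - e. if i < i0 then real (card S) * (real ?d * \<kappa>) ^ ?d else 0)
         + (real ?d * \<kappa>) ^ ?d * (?L * (2 * R) ^ ?d * (\<Sum>i<k - e. ?T i))"
      unfolding sum_distrib_left by (rule sum.distrib)
    also have "(\<Sum>i<k - e. if i < i0 then real (card S) * (real ?d * \<kappa>) ^ ?d else 0) \<le> M0 * (real ?d * \<kappa>) ^ ?d"
    proof -
      have "(\<Sum>i<k - e. if i < i0 then real (card S) * (real ?d * \<kappa>) ^ ?d else 0)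
          = (\<Sum>i\<in>{..<k - e} \<inter> {..<i0}. real (card S) * (real ?d * \<kappa>) ^ ?d)"
        by (intro sum.mono_neutral_cong_right) auto
      also have "\<dots> = real (card ({..<k - e} \<inter> {..<i0})) * (real (card S) * (real ?d * \<kappa>) ^ ?d)" by simp
      also have "\<dots> \<le> real i0 * (real (card S) * (real ?d * \<kappa>) ^ ?d)"
        using \<kappa> card_mono[of "{..<i0}" "{..<k - e} \<inter> {..<i0}"] by (intro mult_right_mono) auto
      finally show ?thesis by (simp add: M0_def)
    qed
    \<comment> \<open>The first sum is geometric and dominated by its last block, whence the gain
      \<open>2 ^ e\<close> that the choice of \<open>e\<close> exploits. The second is at most
      \<open>k\<close> times its largest possible term.\<close>
    also have "(\<Sum>i<k - e. ?T i) \<le> 2 ^ k / 2 ^ e * \<delta> ^ ?m + real k * (2 ^ k) powr (1 - real ?m * \<tau>2)"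
    proof -
      have "(\<Sum>i<k - e. (2::real) ^ i) = 2 ^ (k - e) - 1" by (simp add: geometric_sum)
      also have "\<dots> \<le> 2 ^ k / 2 ^ e" using e by (simp add: power_diff)
      finally have "(\<Sum>i<k - e. 2 ^ i * \<delta> ^ ?m) \<le> 2 ^ k / 2 ^ e * \<delta> ^ ?m"
        unfolding sum_distrib_right[symmetric] using \<delta> by (intro mult_right_mono) auto
      moreover have "(\<Sum>i<k - e. (2 ^ i) powr (1 - real ?m * \<tau>2)) \<le> real k * (2 ^ k :: real) powr (1 - real ?m * \<tau>2)"
      proof -
        have "(\<Sum>i<k - e. (2 ^ i) powr (1 - real ?m * \<tau>2)) \<le> of_nat (card {..<k - e}) * (2 ^ k :: real) powr (1 - real ?m * \<tau>2)"
          using \<tau> by (intro sum_bounded_above powr_mono2 power_increasing) auto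
        also have "\<dots> \<le> real k * (2 ^ k :: real) powr (1 - real ?m * \<tau>2)"
          by (intro mult_right_mono) auto
        finally show ?thesis .
      qed
      ultimately show ?thesis by (simp add: sum.distrib)
    qed
    finally have "sum f F \<le> M0 * (real ?d * \<kappa>) ^ ?d + (real ?d * \<kappa>) ^ ?d * (?L * (2 * R) ^ ?d *
        (2 ^ k / 2 ^ e * \<delta> ^ ?m + real k * (2 ^ k) powr (1 - real ?m * \<tau>2)))"
      using \<kappa> R L0 by (simp add: mult_left_mono)
    also have "\<dots> = (real CARD('d) * \<kappa>) ^ CARD('d) * (M0 + ?L * (2 * R) ^ CARD('d) *
            (2 ^ k / 2 ^ e * \<delta> ^ CARD('m) + real k * (2 ^ k) powr (1 - real CARD('m) * \<tau>2)))"
      by (simp add: algebra_simps)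
    finally show "finite F \<and> (\<Sum>(q, a)\<in>F. (real CARD('d) * \<kappa> / real q) ^ CARD('d)) \<le>
         (real CARD('d) * \<kappa>) ^ CARD('d) * (M0 + ?L * (2 * R) ^ CARD('d) *
            (2 ^ k / 2 ^ e * \<delta> ^ CARD('m) + real k * (2 ^ k) powr (1 - real CARD('m) * \<tau>2)))"
      using fin by (simp add: f_def case_prod_beta)
  qed
qed

section \<open>Well-spread rational points near the subspace\<close>

lemma two_power_powr: "((2::real) ^ k) powr a = (2 powr a) ^ k"
  by (simp add: powr_power powr_powr mult.commute flip: powr_realpow)

lemma dist_scaled_le:
  fixes y a :: "real ^ 'd::finite"
  assumes "q \<ge> 1" "\<And>i. \<bar>real q * y $ i - a $ i\<bar> \<le> \<kappa>"
  shows "dist ((1 / real q) *\<^sub>R a) y \<le> real CARD('d) * \<kappa> / real q"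
proof -
  have "\<bar>(y - (1 / real q) *\<^sub>R a) $ i\<bar> \<le> \<kappa> / real q" for i
  proof -
    have "(y - (1 / real q) *\<^sub>R a) $ i = (real q * y $ i - a $ i) / real q"
      using assms(1) by (simp add: field_simps)
    then show ?thesis using assms by (simp add: abs_divide divide_right_mono)
  qed
  then have "norm (y - (1 / real q) *\<^sub>R a) \<le> real CARD('d) * (\<kappa> / real q)" by (rule norm_le_card_mult)
  then show ?thesis by (simp add: dist_norm norm_minus_commute)
qed

lemma finite_rat_points: "finite (rat_points A \<delta> k e \<inter> cball x R)"
  for A :: "real ^ 'm::finite ^ ('d::finite) option"
proof (rule finite_subset)
  show "rat_points A \<delta> k e \<inter> cball x R \<subseteq> (\<lambda>(q, a). (1 / real q) *\<^sub>R a) ` approx_pairs A \<delta> x (2 ^ k) (2 ^ k * R)"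
  proof
    fix p assume p: "p \<in> rat_points A \<delta> k e \<inter> cball x R"
    then obtain q a where qa: "p = (1 / real q) *\<^sub>R a" "1 \<le> q" "q \<le> 2 ^ k" "a \<in> int_vectors"
      "near_int \<delta> (qvec q a v* A)" unfolding rat_points_def by blast
    have "real q \<le> real (2 ^ k)" using qa(3) by (rule of_nat_mono)
    then have ql: "real q \<le> 2 ^ k" by simp
    have "\<bar>a $ i - real q * x $ i\<bar> \<le> 2 ^ k * R" for i
    proof -
      have "norm (p - x) \<le> R" using p by (simp add: dist_norm norm_minus_commute)
      then have "\<bar>(p - x) $ i\<bar> \<le> R" using component_le_norm_cart[of "p - x" i] by linarith
      then have "real q * \<bar>(p - x) $ i\<bar> \<le> 2 ^ k * R"
        using ql by (intro mult_mono) auto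
      moreover have "real q * \<bar>(p - x) $ i\<bar> = \<bar>real q * ((p - x) $ i)\<bar>" by (simp add: abs_mult)
      moreover have "real q * ((p - x) $ i) = a $ i - real q * x $ i"
        using qa(2) by (simp add: qa(1) field_simps)
      ultimately show ?thesis by simp
    qed
    then have "(q, a) \<in> approx_pairs A \<delta> x (2 ^ k) (2 ^ k * R)"
      using qa ql by (simp add: approx_pairs_def)
    then show "p \<in> (\<lambda>(q, a). (1 / real q) *\<^sub>R a) ` approx_pairs A \<delta> x (2 ^ k) (2 ^ k * R)"
      using qa(1) by (intro image_eqI[of _ _ "(q, a)"]) auto
  qed
qed (intro finite_imageI finite_approx_pairs)

text \<open>A volume comparison: the balls from Dirichlet's theorem cover
  \<open>cball x (R/2)\<close>, but those of small denominator account for at most half of its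
  volume. The remaining balls have radius of order \<open>spacing\<close>, so many separated centres
  are needed. The order of choices matters: \<open>e\<close> and \<open>c0\<close> depend on the
  dimensions only, \<open>K\<close> on the ball.\<close>

lemma rich_rational_points:
  fixes A :: "real ^ 'm::finite ^ ('d::finite) option"
  assumes A: "dioph_bound c w A" "c > 0" "w > 0"
    and \<tau>: "0 < \<tau>1" "\<tau>1 < \<tau>2" "\<tau>2 < \<tau>" "w * \<tau> < 1" "real CARD('m) * \<tau>2 < 1"
  obtains e c0 where "c0 > 0"
    "\<And>x R. 0 < R \<Longrightarrow> \<exists>K. \<forall>k\<ge>K. \<forall>\<delta>. (2 ^ k) powr (- \<tau>1) \<le> \<delta> \<longrightarrow> \<delta> \<le> 1 / (32 * real CARD('m)) \<longrightarrow>
       rich_in (rat_points A \<delta> k e) (spacing TYPE('m) TYPE('d) k \<delta>) c0 x R"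
proof -
  let ?d = "CARD('d)" and ?m = "CARD('m)"
  let ?L = "local_const TYPE('m) TYPE('d)"
  have L0: "?L \<ge> 0" by (rule local_const_nonneg)
  define D0 :: real where "D0 = 2 ^ (?d + ?m)"
  define D1 where "D1 = real ?d ^ ?d * D0"
  have D: "D0 > 0" "D1 > 0" by (simp_all add: D0_def D1_def)
  \<comment> \<open>Makes the main term for small denominators at most a quarter of
    \<open>(R/2) ^ ?d\<close>. The two lower order terms get an eighth each, which is
    \<open>V\<close> below; together this is half the volume.\<close>
  obtain e where e: "4 * 2 ^ ?d * D1 * ?L < 2 ^ e"
  proof -
    have "\<exists>e. 4 * 2 ^ ?d * D1 * ?L < 2 ^ e" by (rule real_arch_pow) simp
    then show ?thesis using that by blast
  qed
  \<comment> \<open>A Dirichlet ball with q \<ge> 2^(k-e) has radius at most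
    \<open>?d * 2 ^ e\<close> times the spacing, and its centre is within one spacing of a maximal
    separated set.\<close>
  define G where "G = real ?d * 2 ^ e + 1"
  have G: "G > 0" by (simp add: G_def add_nonneg_pos)
  define c0 where "c0 = 1 / (2 * (2 * G) ^ ?d)"
  have c0: "c0 > 0" using G by (simp add: c0_def)
  show ?thesis
  proof (rule that[OF c0])
    fix x :: "real ^ 'd" and R :: real assume R: "0 < R"
    have R2: "R / 2 > 0" and \<tau>20: "\<tau>2 > 0" using R \<tau> by simp_all
    obtain M0 :: real where M0: "M0 \<ge> 0"
      "\<And>k \<delta> \<kappa> F. 0 < \<delta> \<Longrightarrow> \<delta> \<le> 1 / (32 * real CARD('m)) \<Longrightarrow> 0 < \<kappa> \<Longrightarrow> \<kappa> \<le> 1 \<Longrightarrow> e \<le> k \<Longrightarrow>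
       F = small_denom A \<delta> \<kappa> x (R/2) (k - e) \<Longrightarrow>
       finite F \<and> (\<Sum>(q, a)\<in>F. (real CARD('d) * \<kappa> / real q) ^ CARD('d)) \<le>
         (real CARD('d) * \<kappa>) ^ CARD('d) * (M0 + ?L * (2 * (R/2)) ^ CARD('d) *
            (2 ^ k / 2 ^ e * \<delta> ^ CARD('m) + real k * (2 ^ k) powr (1 - real CARD('m) * \<tau>2)))"
      by (rule small_denom_sum_le[OF A \<tau>20 \<tau>(3,4,5) R2, where x = x and e = e]) blast
    \<comment> \<open>The expected count 2^k \<delta>^m is at least \<open>g ^ k\<close>, and
      \<open>g > 1\<close> because m \<open>\<tau>1\<close> < 1; hence \<kappa> tends to 0. The cost
      of enlarging the thickness, relative to this count, is at most \<open>k * h ^ k\<close> up to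
      a constant, and \<open>h < 1\<close> because \<open>\<tau>1 < \<tau>2\<close>.\<close>
    define g where "g = (2::real) powr (1 - real ?m * \<tau>1)"
    define h where "h = (2::real) powr (- (real ?m * (\<tau>2 - \<tau>1)))"
    have "real ?m * \<tau>1 < real ?m * \<tau>2" using \<tau> by simp
    then have g: "g > 1" using \<tau>(5) unfolding g_def by (intro gr_one_powr) linarith+
    have h: "0 < h" "h < 1" using \<tau> unfolding h_def by (auto simp: powr_less_one)
    define V where "V = (R / 2) ^ ?d / 8"
    have V: "V > 0" using R by (simp add: V_def)
    have lim0: "(\<lambda>k. C * (1 / g) ^ k) \<longlonglongrightarrow> 0" for C
      using tendsto_mult_left[OF LIMSEQ_power_zero[of "1/g"], of C] g by simp
    have "eventually (\<lambda>k. D0 * (1 / g) ^ k < 1) sequentially"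
      using lim0 by (rule order_tendstoD(2)) simp
    moreover have "eventually (\<lambda>k. D1 * M0 * (1 / g) ^ k < V) sequentially"
      using lim0 V by (rule order_tendstoD(2))
    moreover have "(\<lambda>k. D1 * (?L * R ^ ?d) * (real k * h ^ k)) \<longlonglongrightarrow> D1 * (?L * R ^ ?d) * 0"
      using powser_times_n_limit_0[of h] h by (intro tendsto_mult_left) simp
    then have "eventually (\<lambda>k. D1 * (?L * R ^ ?d) * (real k * h ^ k) < V) sequentially"
      by (rule order_tendstoD(2)) (use V in simp)
    moreover have "(\<lambda>k. real ?d * 2 ^ e * (1/2) ^ k) \<longlonglongrightarrow> real ?d * 2 ^ e * 0"
      by (intro tendsto_mult_left LIMSEQ_power_zero) simp
    then have "eventually (\<lambda>k. real ?d * 2 ^ e * (1/2) ^ k < R / 2) sequentially"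
      by (rule order_tendstoD(2)) (use R in simp)
    moreover have "eventually (\<lambda>k. e \<le> k) sequentially" by (rule eventually_ge_at_top)
    ultimately have "eventually (\<lambda>k. D0 * (1 / g) ^ k < 1 \<and> D1 * M0 * (1 / g) ^ k < V \<and>
        D1 * (?L * R ^ ?d) * (real k * h ^ k) < V \<and> real ?d * 2 ^ e * (1/2) ^ k < R / 2 \<and> e \<le> k) sequentially"
      by eventually_elim simp
    then obtain K where K: "\<And>k. k \<ge> K \<Longrightarrow> D0 * (1 / g) ^ k < 1" "\<And>k. k \<ge> K \<Longrightarrow> D1 * M0 * (1 / g) ^ k < V"
      "\<And>k. k \<ge> K \<Longrightarrow> D1 * (?L * R ^ ?d) * (real k * h ^ k) < V"
      "\<And>k. k \<ge> K \<Longrightarrow> real ?d * 2 ^ e * (1/2) ^ k < R / 2" "\<And>k. k \<ge> K \<Longrightarrow> e \<le> k"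
      unfolding eventually_sequentially by blast
    show "\<exists>K. \<forall>k\<ge>K. \<forall>\<delta>. (2 ^ k) powr (- \<tau>1) \<le> \<delta> \<longrightarrow> \<delta> \<le> 1 / (32 * real CARD('m)) \<longrightarrow>
       rich_in (rat_points A \<delta> k e) (spacing TYPE('m) TYPE('d) k \<delta>) c0 x R"
    proof (intro exI[of _ K] allI impI)
      fix k \<delta> assume k: "K \<le> k" and \<delta>: "(2 ^ k) powr (- \<tau>1) \<le> \<delta>" "\<delta> \<le> 1 / (32 * real CARD('m))"
      have \<delta>0: "\<delta> > 0" by (rule less_le_trans[OF _ \<delta>(1)]) simp
      have \<delta>1: "\<delta> \<le> 1" using \<delta>(2) inverse_card_le_1[where 'm = 'm] by (rule order.trans)
      define \<rho> where "\<rho> = spacing TYPE('m) TYPE('d) k \<delta>"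
      have \<rho>: "\<rho> > 0" unfolding \<rho>_def using \<delta>0 by (rule spacing_pos)
      define \<kappa> where "\<kappa> = 2 ^ k * \<rho>"
      have \<kappa>0: "\<kappa> > 0" using \<rho> by (simp add: \<kappa>_def)
      define Y where "Y = 2 ^ k * \<delta> ^ ?m"
      have Y0: "Y > 0" using \<delta>0 by (simp add: Y_def)
      have \<kappa>d: "\<kappa> ^ ?d = D0 / Y" unfolding \<kappa>_def \<rho>_def spacing_power[OF \<delta>0] D0_def Y_def ..
      have Yg: "g ^ k \<le> Y"
      proof -
        have pw: "((2 ^ k) powr (- \<tau>1)) ^ ?m = (2 ^ k :: real) powr (- (real ?m * \<tau>1))"
          by (simp add: powr_power mult.commute)
        have "g ^ k = (2 ^ k) powr (1 - real ?m * \<tau>1)" by (simp add: g_def two_power_powr)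
        also have "\<dots> = 2 ^ k * ((2 ^ k) powr (- \<tau>1)) ^ ?m"
          unfolding pw by (simp add: powr_diff powr_minus_divide)
        also have "\<dots> \<le> Y" unfolding Y_def using \<delta> by (intro mult_left_mono power_mono) auto
        finally show ?thesis .
      qed
      have gk: "g ^ k > 0" using g by simp
      have invY: "C / Y \<le> C * (1 / g) ^ k" if "C \<ge> 0" for C
      proof -
        have "C / Y \<le> C / g ^ k" using Yg gk that by (intro divide_left_mono) auto
        then show ?thesis by (simp add: power_one_over)
      qed
      have "\<kappa> ^ ?d < 1" using invY[of D0] K(1)[OF k] D by (simp add: \<kappa>d)
      then have \<kappa>1: "\<kappa> \<le> 1" using one_le_power[of \<kappa> ?d] by linarith
      define F where "F = small_denom A \<delta> \<kappa> x (R/2) (k - e)"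
      define B where "B = (\<Sum>(q, a)\<in>F. (real ?d * \<kappa> / real q) ^ ?d)"
      have F: "finite F" "B \<le> (real ?d * \<kappa>) ^ ?d * (M0 + ?L * (2 * (R/2)) ^ ?d *
            (2 ^ k / 2 ^ e * \<delta> ^ ?m + real k * (2 ^ k) powr (1 - real ?m * \<tau>2)))"
        using M0(2)[OF \<delta>0 \<delta>(2) \<kappa>0 \<kappa>1 K(5)[OF k] F_def] unfolding B_def by auto
      have Bhalf: "B \<le> (R / 2) ^ ?d / 2"
      proof -
        have 1: "(real ?d * \<kappa>) ^ ?d = D1 / Y" by (simp add: power_mult_distrib \<kappa>d D1_def)
        have 2: "D1 / Y * (?L * R ^ ?d * (2 ^ k / 2 ^ e * \<delta> ^ ?m)) = D1 * ?L * R ^ ?d / 2 ^ e"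
          using \<delta>0 by (simp add: Y_def)
        have 3: "(2 ^ k) powr (1 - real ?m * \<tau>2) / Y \<le> h ^ k"
        proof -
          have "(2 ^ k) powr (1 - real ?m * \<tau>2) / Y \<le> (2 ^ k) powr (1 - real ?m * \<tau>2) / g ^ k"
            using Yg gk by (intro divide_left_mono) auto
          also have "\<dots> = (2 ^ k) powr ((1 - real ?m * \<tau>2) - (1 - real ?m * \<tau>1))"
            unfolding g_def two_power_powr[symmetric] by (rule powr_diff[symmetric])
          also have "\<dots> = h ^ k" by (simp add: h_def two_power_powr algebra_simps)
          finally show ?thesis .
        qed
        have "B \<le> D1 / Y * M0 + D1 / Y * (?L * R ^ ?d * (2 ^ k / 2 ^ e * \<delta> ^ ?m))
            + D1 / Y * (?L * R ^ ?d * (real k * (2 ^ k) powr (1 - real ?m * \<tau>2)))"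
          using F(2) unfolding 1 by (simp add: distrib_left)
        also have "\<dots> = D1 * M0 / Y + D1 * ?L * R ^ ?d / 2 ^ e
            + D1 * (?L * R ^ ?d) * (real k * ((2 ^ k) powr (1 - real ?m * \<tau>2) / Y))"
          unfolding 2 by simp
        also have "\<dots> \<le> V + 2 * V + V"
        proof (intro add_mono)
          show "D1 * M0 / Y \<le> V" using invY[of "D1 * M0"] K(2)[OF k] D M0(1) by simp
          have "D1 * ?L / 2 ^ e \<le> 1 / (4 * 2 ^ ?d)"
            using e by (simp add: field_simps)
          then have "R ^ ?d * (D1 * ?L / 2 ^ e) \<le> R ^ ?d * (1 / (4 * 2 ^ ?d))"
            using R by (intro mult_left_mono) auto
          then show "D1 * ?L * R ^ ?d / 2 ^ e \<le> 2 * V" by (simp add: V_def power_divide mult_ac)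
          have "D1 * (?L * R ^ ?d) * (real k * ((2 ^ k) powr (1 - real ?m * \<tau>2) / Y))
              \<le> D1 * (?L * R ^ ?d) * (real k * h ^ k)"
            using 3 D L0 R by (intro mult_left_mono) auto
          then show "D1 * (?L * R ^ ?d) * (real k * ((2 ^ k) powr (1 - real ?m * \<tau>2) / Y)) \<le> V"
            using K(3)[OF k] by linarith
        qed
        also have "\<dots> = (R / 2) ^ ?d / 2" by (simp add: V_def)
        finally show ?thesis .
      qed
      let ?RP = "rat_points A \<delta> k e \<inter> cball x R"
      have finRP: "finite ?RP" by (rule finite_rat_points)
      obtain P where P: "P \<subseteq> ?RP" "pairwise (\<lambda>x y. disjnt (cball x (\<rho>/2)) (cball y (\<rho>/2))) P"
        "\<And>z. z \<in> ?RP \<Longrightarrow> \<exists>y\<in>P. \<not> disjnt (cball z (\<rho>/2)) (cball y (\<rho>/2))"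
        using greedy_disjoint_cballs[OF finRP, where c = "\<lambda>x. x" and t = "\<lambda>_. \<rho>/2"] \<rho> by auto
      have finP: "finite P" using P(1) finRP by (rule finite_subset)
      have sepP: "separated \<rho> P" using P(2) by (simp add: separated_def)
      define ctr where "ctr = case_sum (\<lambda>(q, a). (1 / real q) *\<^sub>R a) (\<lambda>p :: real ^ 'd. p)"
      define rad where "rad = case_sum (\<lambda>(q :: nat, a :: real ^ 'd). real ?d * \<kappa> / real q) (\<lambda>p :: real ^ 'd. G * \<rho>)"
      have "cball x (R/2) \<subseteq> (\<Union>i\<in>F <+> P. cball (ctr i) (rad i))"
      proof
        fix y assume y: "y \<in> cball x (R/2)"
        have Dir: "(2 / \<kappa>) ^ ?d * (2 / \<delta>) ^ ?m \<le> real (2 ^ k)"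
          using \<delta>0 D by (simp add: power_divide \<kappa>d Y_def D0_def power_add)
        obtain q a where qa: "1 \<le> q" "q \<le> 2 ^ k" "a \<in> int_vectors" "\<And>i. \<bar>real q * y $ i - a $ i\<bar> \<le> \<kappa>"
          "near_int \<delta> (qvec q a v* A)"
          using dirichlet_affine[OF \<kappa>0 \<kappa>1 \<delta>0 \<delta>1 Dir] by blast
        have da: "dist ((1 / real q) *\<^sub>R a) y \<le> real ?d * \<kappa> / real q" by (rule dist_scaled_le[OF qa(1,4)])
        show "y \<in> (\<Union>i\<in>F <+> P. cball (ctr i) (rad i))"
        proof (cases "q < 2 ^ (k - e)")
          case True
          have "\<bar>a $ i - real q * x $ i\<bar> \<le> real q * (R/2) + \<kappa>" for i
          proof -
            have "norm (y - x) \<le> R/2" using y by (simp add: dist_norm norm_minus_commute)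
            then have "\<bar>(y - x) $ i\<bar> \<le> R/2" using component_le_norm_cart[of "y - x" i] by linarith
            then have "real q * \<bar>(y - x) $ i\<bar> \<le> real q * (R/2)" by (rule mult_left_mono) simp
            moreover have "real q * \<bar>(y - x) $ i\<bar> = \<bar>real q * y $ i - real q * x $ i\<bar>"
              by (metis abs_mult abs_of_nat right_diff_distrib vector_minus_component)
            ultimately show ?thesis using qa(4)[of i] by linarith
          qed
          then have "(q, a) \<in> F" using qa True by (simp add: F_def small_denom_def)
          then have "Inl (q, a) \<in> F <+> P" by (rule InlI)
          moreover have "y \<in> cball (ctr (Inl (q, a))) (rad (Inl (q, a)))" using da by (simp add: ctr_def rad_def)
          ultimately show ?thesis by blast
        next
          case False
          let ?p = "(1 / real q) *\<^sub>R a"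
          have "2 ^ (k - e) \<le> q" using False by simp
          then have "2 ^ e * 2 ^ (k - e) \<le> 2 ^ e * q" by simp
          then have qe: "2 ^ k \<le> 2 ^ e * q" using K(5)[OF k] by (simp flip: power_add)
          then have "real (2 ^ k) \<le> real (2 ^ e * q)" by (rule of_nat_mono)
          then have qe': "2 ^ k \<le> 2 ^ e * real q" by simp
          have "real ?d * \<kappa> / real q = real ?d * 2 ^ k / real q * \<rho>" by (simp add: \<kappa>_def)
          also have "\<dots> \<le> real ?d * 2 ^ e * \<rho>"
            using qe' qa(1) \<rho> by (intro mult_right_mono) (auto simp: divide_le_eq mult_ac)
          finally have dd: "real ?d * \<kappa> / real q \<le> real ?d * 2 ^ e * \<rho>" .
          have "real ?d * 2 ^ e * \<rho> = real ?d * 2 ^ e * (1/2) ^ k * \<kappa>" by (simp add: \<kappa>_def power_one_over)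
          also have "\<dots> \<le> real ?d * 2 ^ e * (1/2) ^ k * 1" using \<kappa>1 by (intro mult_left_mono) auto
          also have "\<dots> \<le> R / 2" using K(4)[OF k] by simp
          finally have "dist ?p y \<le> R / 2" using da dd by linarith
          then have "dist x ?p \<le> R" using dist_triangle[of x ?p y] y by (simp add: dist_commute)
          moreover have "?p \<in> rat_points A \<delta> k e" unfolding rat_points_def using qa qe by blast
          ultimately have "?p \<in> ?RP" by simp
          then obtain p where p: "p \<in> P" "\<not> disjnt (cball ?p (\<rho>/2)) (cball p (\<rho>/2))" using P(3) by blast
          then obtain z where "dist ?p z \<le> \<rho>/2" "dist p z \<le> \<rho>/2" by (auto simp: disjnt_iff)
          then have "dist p ?p \<le> \<rho>" using dist_triangle[of p ?p z] by (simp add: dist_commute)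
          then have "dist p y \<le> \<rho> + real ?d * 2 ^ e * \<rho>" using dist_triangle[of p y ?p] da dd by linarith
          also have "\<dots> = G * \<rho>" by (simp add: G_def algebra_simps)
          finally have "y \<in> cball (ctr (Inr p)) (rad (Inr p))" by (simp add: ctr_def rad_def)
          moreover have "Inr p \<in> F <+> P" using p(1) by (rule InrI)
          ultimately show ?thesis by blast
        qed
      qed
      then have "(R/2) ^ DIM(real ^ 'd) \<le> (\<Sum>i\<in>F <+> P. rad i ^ DIM(real ^ 'd))"
        using R F(1) finP \<kappa>0 G \<rho> by (intro cball_cover_power_le) (auto simp: rad_def)
      then have "(R/2) ^ ?d \<le> (\<Sum>i\<in>F <+> P. rad i ^ ?d)" by simp
      also have "\<dots> = (\<Sum>z\<in>F. rad (Inl z) ^ ?d) + (\<Sum>p\<in>P. rad (Inr p) ^ ?d)"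
        using F(1) finP by (simp add: sum.Plus)
      also have "(\<Sum>z\<in>F. rad (Inl z) ^ ?d) = B"
        unfolding B_def rad_def by (intro sum.cong) (auto simp: case_prod_beta)
      also have "(\<Sum>p\<in>P. rad (Inr p) ^ ?d) = real (card P) * (G * \<rho>) ^ ?d" by (simp add: rad_def)
      finally have "(R/2) ^ ?d / 2 \<le> real (card P) * (G * \<rho>) ^ ?d" using Bhalf by linarith
      then have "(R/2) ^ ?d / 2 / (G * \<rho>) ^ ?d \<le> real (card P)"
        using G \<rho> by (simp add: pos_divide_le_eq)
      moreover have "(R/2) ^ ?d / 2 / (G * \<rho>) ^ ?d = c0 * R ^ ?d / \<rho> ^ ?d"
        by (simp add: c0_def power_mult_distrib power_divide)
      ultimately have "c0 * R ^ ?d / \<rho> ^ ?d \<le> real (card P)" by simp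
      then show "rich_in (rat_points A \<delta> k e) (spacing TYPE('m) TYPE('d) k \<delta>) c0 x R"
        using P(1) finP sepP unfolding rich_in_def \<rho>_def by (intro exI[of _ P]) simp
    qed
  qed
qed

section \<open>Dyadic sums and Hausdorff null sets\<close>

lemma sum_dyadic_blocks:
  fixes f :: "nat \<Rightarrow> real"
  shows "sum f {1..<2 ^ n} = (\<Sum>k<n. sum f {2 ^ k..<2 ^ (k + 1)})"
proof (induction n)
  case (Suc n)
  have "sum f {1..<2 ^ Suc n} = sum f {1..<2 ^ n} + sum f {2 ^ n..<2 ^ Suc n}"
    by (rule sum.atLeastLessThan_concat[symmetric]) auto
  then show ?case using Suc by simp
qed simp

text \<open>Cauchy condensation. The two factors vary in opposite directions, so in each dyadic
  block \<psi> and the power of \<open>q\<close> are bounded at different ends; the lower bound for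
  a block therefore involves \<psi> at the start of the next one.\<close>

lemma summable_on_dyadic_iff:
  fixes \<psi> :: "nat \<Rightarrow> real"
  assumes pos: "\<And>q. q \<ge> 1 \<Longrightarrow> \<psi> q > 0" and anti: "antimono_on {1..} \<psi>"
    and \<alpha>: "\<alpha> \<ge> 0" and \<beta>: "\<beta> \<ge> 0"
  shows "(\<lambda>q. \<psi> q powr \<alpha> * real q powr \<beta>) summable_on {1..} \<longleftrightarrow>
    summable (\<lambda>k. \<psi> (2 ^ k) powr \<alpha> * (2 ^ k) powr (\<beta> + 1))"
proof -
  define f where "f q = \<psi> q powr \<alpha> * real q powr \<beta>" for q
  define D where "D k = \<psi> (2 ^ k) powr \<alpha> * (2 ^ k) powr (\<beta> + 1)" for k :: nat
  have f0: "f q \<ge> 0" for q by (simp add: f_def)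
  have D0: "D k \<ge> 0" for k by (simp add: D_def)
  have anti': "\<psi> q' \<le> \<psi> q" if "1 \<le> q" "q \<le> q'" for q q'
    using anti that by (auto simp: monotone_on_def)
  have upper: "sum f {2 ^ k..<2 ^ (k + 1)} \<le> 2 powr \<beta> * D k" for k
  proof -
    have "f q \<le> \<psi> (2 ^ k) powr \<alpha> * (2 * 2 ^ k) powr \<beta>" if "q \<in> {2 ^ k..<2 ^ (k + 1)}" for q
    proof -
      have "real q \<le> real (2 ^ (k + 1))" using that by (intro of_nat_mono) auto
      then have "real q \<le> 2 * 2 ^ k" by simp
      moreover have "1 \<le> q" using that by (auto intro: order.trans[of 1 "2 ^ k"])
      ultimately show ?thesis unfolding f_def using that pos[of q] anti'[of "2 ^ k" q] \<alpha> \<beta>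
        by (intro mult_mono powr_mono2) auto
    qed
    then have "sum f {2 ^ k..<2 ^ (k + 1)} \<le> of_nat (card {2 ^ k..<2 ^ (k + 1) :: nat}) * (\<psi> (2 ^ k) powr \<alpha> * (2 * 2 ^ k) powr \<beta>)"
      by (rule sum_bounded_above)
    also have "\<dots> = 2 powr \<beta> * D k" by (simp add: D_def powr_mult powr_add)
    finally show ?thesis .
  qed
  have lower: "D (Suc k) \<le> 2 powr (\<beta> + 1) * sum f {2 ^ k..<2 ^ (k + 1)}" for k
  proof -
    have "\<psi> (2 ^ Suc k) powr \<alpha> * (2 ^ k) powr \<beta> \<le> f q" if "q \<in> {2 ^ k..<2 ^ (k + 1)}" for q
    proof -
      have "real (2 ^ k) \<le> real q" using that by (intro of_nat_mono) auto
      then have "2 ^ k \<le> real q" by simp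
      moreover have "1 \<le> q" using that by (auto intro: order.trans[of 1 "2 ^ k"])
      ultimately show ?thesis unfolding f_def using that pos[of "2 ^ Suc k"] anti'[of q "2 ^ Suc k"] \<alpha> \<beta>
        by (intro mult_mono powr_mono2) auto
    qed
    then have "of_nat (card {2 ^ k..<2 ^ (k + 1) :: nat}) * (\<psi> (2 ^ Suc k) powr \<alpha> * (2 ^ k) powr \<beta>) \<le> sum f {2 ^ k..<2 ^ (k + 1)}"
      by (rule sum_bounded_below)
    then have "2 powr (\<beta> + 1) * (2 ^ k * (\<psi> (2 ^ Suc k) powr \<alpha> * (2 ^ k) powr \<beta>)) \<le> 2 powr (\<beta> + 1) * sum f {2 ^ k..<2 ^ (k + 1)}"
      by (intro mult_left_mono) auto
    moreover have "D (Suc k) = 2 powr (\<beta> + 1) * (2 ^ k * (\<psi> (2 ^ Suc k) powr \<alpha> * (2 ^ k) powr \<beta>))"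
      by (simp add: D_def powr_mult powr_add mult_ac)
    ultimately show ?thesis by simp
  qed
  have "f summable_on {1..} \<longleftrightarrow> summable D"
  proof
    assume f: "f summable_on {1..}"
    have "summable (\<lambda>k. D (Suc k))"
    proof (rule summableI_nonneg_bounded)
      fix n
      have "(\<Sum>k<n. D (Suc k)) \<le> (\<Sum>k<n. 2 powr (\<beta> + 1) * sum f {2 ^ k..<2 ^ (k + 1)})"
        by (intro sum_mono lower)
      also have "\<dots> = 2 powr (\<beta> + 1) * sum f {1..<2 ^ n}"
        unfolding sum_dyadic_blocks by (simp add: sum_distrib_left)
      also have "\<dots> \<le> 2 powr (\<beta> + 1) * infsum f {1..}"
        using f f0 by (intro mult_left_mono finite_sum_le_infsum) auto
      finally show "(\<Sum>k<n. D (Suc k)) \<le> 2 powr (\<beta> + 1) * infsum f {1..}" .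
    qed (rule D0)
    then show "summable D" by (simp only: summable_Suc_iff)
  next
    assume D: "summable D"
    show "f summable_on {1..}"
    proof (rule nonneg_bdd_above_summable_on)
      show "bdd_above (sum f ` {F. F \<subseteq> {1..} \<and> finite F})"
      proof (rule bdd_aboveI2)
        fix F :: "nat set" assume "F \<in> {F. F \<subseteq> {1..} \<and> finite F}"
        then have F: "F \<subseteq> {1..}" "finite F" by auto
        define n where "n = Suc (Max (insert 0 F))"
        have "F \<subseteq> {1..<2 ^ n}"
        proof
          fix q assume q: "q \<in> F"
          have "q \<le> Max (insert 0 F)" using F q by (intro Max_ge) auto
          then have "q < n" by (simp add: n_def)
          also have "n < 2 ^ n" by (rule less_exp)
          finally show "q \<in> {1..<2 ^ n}" using q F by auto
        qed
        then have "sum f F \<le> sum f {1..<2 ^ n}" using f0 by (intro sum_mono2) auto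
        also have "\<dots> \<le> (\<Sum>k<n. 2 powr \<beta> * D k)"
          unfolding sum_dyadic_blocks by (intro sum_mono upper)
        also have "\<dots> = 2 powr \<beta> * (\<Sum>k<n. D k)" by (simp add: sum_distrib_left)
        also have "\<dots> \<le> 2 powr \<beta> * suminf D"
          using D D0 by (intro mult_left_mono sum_le_suminf) auto
        finally show "sum f F \<le> 2 powr \<beta> * suminf D" .
      qed
    qed (rule f0)
  qed
  then show ?thesis unfolding f_def[abs_def] D_def[abs_def] .
qed

section \<open>Covers and Hausdorff measure zero or infinity\<close>

lemma suminf_ennreal_le:
  fixes b :: "nat \<Rightarrow> real"
  assumes "summable b" "\<And>k. b k \<ge> 0" "suminf b \<le> \<epsilon>" "\<And>k. g k \<le> ennreal (b k)"
  shows "suminf g \<le> ennreal \<epsilon>"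
proof -
  have "suminf g \<le> (\<Sum>k. ennreal (b k))" using assms(4) by (intro suminf_le) auto
  also have "\<dots> = ennreal (suminf b)" using assms by (intro suminf_ennreal2) auto
  also have "\<dots> \<le> ennreal \<epsilon>" using assms(3) by (intro ennreal_leI)
  finally show ?thesis .
qed

lemma diam_power_le:
  assumes "s > 0" "diameter U \<le> t" "bounded U"
  shows "diam_power s U \<le> ennreal (t powr s)"
  using assms diameter_ge_0[of U] by (auto simp: diam_power_def intro!: ennreal_leI powr_mono2)

definition fine_cover :: "real \<Rightarrow> real \<Rightarrow> real \<Rightarrow> 'a::metric_space set \<Rightarrow> (nat \<Rightarrow> 'a set) \<Rightarrow> bool" where
  "fine_cover s \<delta> \<epsilon> E U \<longleftrightarrow> E \<subseteq> (\<Union>i. U i) \<and> (\<forall>i. bounded (U i) \<and> diameter (U i) \<le> \<delta>) \<and>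
     (\<Sum>i. diam_power s (U i)) \<le> ennreal \<epsilon>"

text \<open>The Hausdorff version of the Borel-Cantelli lemma: every point lies in sets of
  arbitrarily high level, so each tail of the families is a cover, and the tails of the cost series
  become arbitrarily small.\<close>

lemma fine_cover_limsup:
  fixes C :: "nat \<Rightarrow> 'a::metric_space set set"
  assumes s: "s > 0" and fin: "\<And>k. finite (C k)"
    and C: "\<And>k U. U \<in> C k \<Longrightarrow> bounded U" "\<And>k U. U \<in> C k \<Longrightarrow> diameter U \<le> t k"
    and t: "t \<longlonglongrightarrow> 0" and sm: "summable (\<lambda>k. real (card (C k)) * t k powr s)"
    and E: "\<And>x K. x \<in> E \<Longrightarrow> \<exists>k\<ge>K. x \<in> \<Union> (C k)"
    and \<delta>: "\<delta> > 0" "\<epsilon> > 0"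
  obtains U where "fine_cover s \<delta> \<epsilon> E U"
proof -
  define b where "b k = real (card (C k)) * t k powr s" for k
  have b0: "b k \<ge> 0" for k by (simp add: b_def)
  obtain K1 where K1: "\<And>n. n \<ge> K1 \<Longrightarrow> norm (\<Sum>i. b (i + n)) < \<epsilon>"
    using suminf_exist_split[OF \<delta>(2)] sm unfolding b_def by blast
  have "eventually (\<lambda>k. t k < \<delta>) sequentially" using t \<delta>(1) by (rule order_tendstoD)
  then obtain K2 where K2: "\<And>k. k \<ge> K2 \<Longrightarrow> t k < \<delta>" unfolding eventually_sequentially by blast
  define K where "K = max K1 K2"
  have "\<forall>k. \<exists>e. bij_betw e {..<card (C k)} (C k)"
    using fin by (metis bij_betw_from_nat_into_finite)
  then obtain e where e: "\<And>k. bij_betw (e k) {..<card (C k)} (C k)" by metis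
  \<comment> \<open>Padding with the empty set, which \<open>diam_power\<close> charges 0, turns the
    finite families into sequences that can be merged into one by pairing.\<close>
  define V where "V k i = (if i < card (C k) then e k i else {})" for k i
  have Vin: "V k i \<in> C k \<or> V k i = {}" for k i
    using e[of k] by (auto simp: V_def bij_betw_def)
  define U where "U n = (case prod_decode n of (k, i) \<Rightarrow> V (K + k) i)" for n
  have "fine_cover s \<delta> \<epsilon> E U"
    unfolding fine_cover_def
  proof (intro conjI allI subsetI)
    fix x assume "x \<in> E"
    from E[OF this, of K] obtain k W where k: "k \<ge> K" "W \<in> C k" "x \<in> W" by blast
    have "W \<in> e k ` {..<card (C k)}" using k(2) bij_betw_imp_surj_on[OF e[of k]] by simp
    then obtain i where "W = e k i" "i \<in> {..<card (C k)}" by (rule imageE)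
    then have i: "i < card (C k)" "e k i = W" by auto
    have "U (prod_encode (k - K, i)) = W" using k i by (simp add: U_def V_def)
    then show "x \<in> (\<Union>i. U i)" using k by blast
  next
    fix n
    obtain k i where ki: "prod_decode n = (k, i)" by fastforce
    show "bounded (U n)" using Vin[of "K + k" i] C(1) by (auto simp: U_def ki)
    have "t (K + k) < \<delta>" by (rule K2) (simp add: K_def)
    then show "diameter (U n) \<le> \<delta>"
      using Vin[of "K + k" i] C(2)[of "V (K + k) i" "K + k"] \<delta>(1)
      by (auto simp: U_def ki diameter_empty)
  next
    let ?f = "\<lambda>(k, i). diam_power s (V (K + k) i)"
    have "(\<Sum>n. diam_power s (U n)) = (\<Sum>n. ?f (prod_decode n))"
      by (intro arg_cong[of _ _ suminf] ext) (simp add: U_def split: prod.split)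
    also have "\<dots> = (\<Sum>k. \<Sum>i. ?f (k, i))" by (rule suminf_ennreal_2dimen) simp
    also have "\<dots> \<le> ennreal \<epsilon>"
    proof (rule suminf_ennreal_le)
      show "summable (\<lambda>k. b (k + K))" using sm unfolding b_def by (rule summable_ignore_initial_segment)
      show "(\<Sum>k. b (k + K)) \<le> \<epsilon>" using K1[of K] by (auto simp: K_def abs_less_iff)
      fix k
      show "b (k + K) \<ge> 0" by (rule b0)
      have "(\<Sum>i. ?f (k, i)) = (\<Sum>i<card (C (K + k)). ?f (k, i))"
        by (rule suminf_finite) (auto simp: V_def diam_power_def)
      also have "\<dots> \<le> (\<Sum>i<card (C (K + k)). ennreal (t (K + k) powr s))"
      proof (rule sum_mono)
        fix i assume "i \<in> {..<card (C (K + k))}"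
        then have "V (K + k) i \<in> C (K + k)" using e[of "K + k"] by (auto simp: V_def bij_betw_def)
        then show "?f (k, i) \<le> ennreal (t (K + k) powr s)" using s C by (auto intro!: diam_power_le)
      qed
      also have "\<dots> = ennreal (b (k + K))"
        by (simp add: b_def ennreal_mult' ennreal_of_nat_eq_real_of_nat add.commute)
      finally show "(\<Sum>i. ?f (k, i)) \<le> ennreal (b (k + K))" .
    qed
    finally show "(\<Sum>n. diam_power s (U n)) \<le> ennreal \<epsilon>" .
  qed
  then show ?thesis by (rule that)
qed

text \<open>Countable subadditivity for null sets: the cover of the M-th set receives a geometric
  share of the total cost \<epsilon>.\<close>

lemma hausdorff_measure_zero:
  fixes E :: "nat \<Rightarrow> 'a::metric_space set"
  assumes cov: "\<And>M \<delta> \<epsilon>. \<delta> > 0 \<Longrightarrow> \<epsilon> > 0 \<Longrightarrow> \<exists>U. fine_cover s \<delta> \<epsilon> (E M) U"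
  shows "hausdorff_measure s (\<Union>M. E M) = 0"
proof -
  have "hausdorff_content s \<delta> (\<Union>M. E M) = 0" if \<delta>: "\<delta> > 0" for \<delta>
  proof -
    have "hausdorff_content s \<delta> (\<Union>M. E M) \<le> 0 + ennreal \<epsilon>" if \<epsilon>: "\<epsilon> > 0" for \<epsilon>
    proof -
      have "\<forall>M. \<exists>U. fine_cover s \<delta> (\<epsilon> / 2 * (1/2) ^ M) (E M) U" using cov \<delta> \<epsilon> by simp
      then obtain V where V: "\<And>M. fine_cover s \<delta> (\<epsilon> / 2 * (1/2) ^ M) (E M) (V M)" by metis
      define U where "U n = (case prod_decode n of (M, i) \<Rightarrow> V M i)" for n
      have "hausdorff_content s \<delta> (\<Union>M. E M) \<le> (\<Sum>n. diam_power s (U n))"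
        unfolding hausdorff_content_def
      proof (rule INF_lower, safe)
        fix x M assume "x \<in> E M"
        then obtain i where "x \<in> V M i" using V[of M] by (auto simp: fine_cover_def)
        then have "x \<in> U (prod_encode (M, i))" by (simp add: U_def)
        then show "x \<in> (\<Union>i. U i)" by blast
      next
        fix n
        show "bounded (U n)" "diameter (U n) \<le> \<delta>"
          using V by (auto simp: U_def fine_cover_def split: prod.split)
      qed
      also have "\<dots> = (\<Sum>n. (\<lambda>(M, i). diam_power s (V M i)) (prod_decode n))"
        by (intro arg_cong[of _ _ suminf] ext) (simp add: U_def split: prod.split)
      also have "\<dots> = (\<Sum>M. \<Sum>i. diam_power s (V M i))" by (rule suminf_ennreal_2dimen) simp
      also have "\<dots> \<le> ennreal \<epsilon>"
      proof (rule suminf_ennreal_le)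
        show "summable (\<lambda>M. \<epsilon> / 2 * (1/2) ^ M)" by (intro summable_mult summable_geometric) simp
        have "(\<Sum>M. \<epsilon> / 2 * (1/2) ^ M) = \<epsilon> / 2 * (\<Sum>M. (1/2) ^ M)"
          by (intro suminf_mult summable_geometric) simp
        then show "(\<Sum>M. \<epsilon> / 2 * (1/2) ^ M) \<le> \<epsilon>" by (simp add: suminf_geometric)
      qed (use V \<epsilon> in \<open>auto simp: fine_cover_def\<close>)
      finally show ?thesis by simp
    qed
    then have "hausdorff_content s \<delta> (\<Union>M. E M) \<le> 0"
      by (rule ennreal_le_epsilon)
    then show ?thesis by simp
  qed
  then have "hausdorff_measure s (\<Union>M. E M) \<le> 0"
    unfolding hausdorff_measure_def by (intro SUP_least) simp
  then show ?thesis by simp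
qed

text \<open>A single scale \<delta> suffices, the measure being a supremum over scales. For positive
  \<open>s\<close>, \<open>diam_power\<close> is the plain power of the diameter, also for the empty
  set.\<close>

lemma hausdorff_measure_infinite:
  assumes s: "s > 0" and \<delta>: "\<delta> > 0"
    and "\<And>U. E \<subseteq> (\<Union>i. U i) \<Longrightarrow> (\<And>i. bounded (U i)) \<Longrightarrow> (\<And>i. diameter (U i) \<le> \<delta>) \<Longrightarrow>
           \<not> summable (\<lambda>i. diameter (U i :: 'a::metric_space set) powr s)"
  shows "hausdorff_measure s E = \<infinity>"
proof -
  have "(\<Sum>i. diam_power s (U i)) = \<infinity>"
    if U: "E \<subseteq> (\<Union>i. U i)" "\<forall>i. bounded (U i) \<and> diameter (U i) \<le> \<delta>" for U :: "nat \<Rightarrow> 'a set"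
  proof (rule ccontr)
    assume fin: "(\<Sum>i. diam_power s (U i)) \<noteq> \<infinity>"
    have "diam_power s (U i) = ennreal (diameter (U i) powr s)" for i
      using s by (auto simp: diam_power_def diameter_empty)
    then have "summable (\<lambda>i. diameter (U i) powr s)"
      using fin by (intro summable_suminf_not_top) auto
    then show False using assms(3)[of U] U by auto
  qed
  then have "hausdorff_content s \<delta> E = \<infinity>"
    unfolding hausdorff_content_def by (intro antisym INF_greatest) auto
  moreover have "hausdorff_content s \<delta> E \<le> hausdorff_measure s E"
    unfolding hausdorff_measure_def using \<delta> by (intro SUP_upper) auto
  ultimately show ?thesis by (simp add: top.extremum_unique)
qed

section \<open>Convergence\<close>

definition graph_map :: "real ^ 'm::finite ^ ('d::finite) option \<Rightarrow> real ^ 'd \<Rightarrow> real ^ ('d + 'm)" where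
  "graph_map A x = vec_append x (cons_one x v* A)"

lemma graph_map_nth [simp]:
  "graph_map A x $ Inl i = x $ i" "graph_map A x $ Inr l = (cons_one x v* A) $ l"
  by (simp_all add: graph_map_def vec_append_def)

lemma affine_graph_eq: "affine_graph A = range (graph_map A)"
  by (auto simp: affine_graph_def graph_map_def)

text \<open>A crude bound for the norm of the linear map given by \<open>A\<close> between
  sup-normed spaces.\<close>

definition coeff_sum :: "real ^ 'm::finite ^ 'k::finite \<Rightarrow> real" where
  "coeff_sum A = (\<Sum>k\<in>UNIV. \<Sum>l\<in>UNIV. \<bar>A $ k $ l\<bar>)"

lemma coeff_sum_nonneg: "coeff_sum A \<ge> 0"
  by (simp add: coeff_sum_def sum_nonneg)

lemma vector_matrix_component_le:
  assumes "\<And>k. \<bar>v $ k\<bar> \<le> b" "b \<ge> 0"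
  shows "\<bar>(v v* A) $ l\<bar> \<le> coeff_sum A * b"
proof -
  have "\<bar>(v v* A) $ l\<bar> = \<bar>\<Sum>k\<in>UNIV. v $ k * A $ k $ l\<bar>"
    by (simp add: vector_matrix_mult_def mult.commute)
  also have "\<dots> \<le> (\<Sum>k\<in>UNIV. b * (\<Sum>l\<in>UNIV. \<bar>A $ k $ l\<bar>))"
  proof (rule order.trans[OF sum_abs], rule sum_mono)
    fix k
    have "\<bar>A $ k $ l\<bar> \<le> (\<Sum>l\<in>UNIV. \<bar>A $ k $ l\<bar>)"
      by (rule member_le_sum) auto
    then show "\<bar>v $ k * A $ k $ l\<bar> \<le> b * (\<Sum>l\<in>UNIV. \<bar>A $ k $ l\<bar>)"
      unfolding abs_mult using assms by (intro mult_mono) auto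
  qed
  also have "\<dots> = coeff_sum A * b" by (simp add: coeff_sum_def sum_distrib_left mult.commute)
  finally show ?thesis .
qed

lemma qvec_matrix_close:
  assumes "\<And>i. \<bar>real q * x $ i - a $ i\<bar> \<le> b" "b \<ge> 0"
  shows "\<bar>(qvec q a v* A) $ l - real q * (cons_one x v* A) $ l\<bar> \<le> coeff_sum A * b"
proof -
  have "(qvec q a v* A) $ l - real q * (cons_one x v* A) $ l = ((qvec q a - real q *\<^sub>R cons_one x) v* A) $ l"
    by (simp add: vector_matrix_mult_def sum_subtractf sum_distrib_left algebra_simps)
  moreover have "\<bar>(qvec q a - real q *\<^sub>R cons_one x) $ k\<bar> \<le> b" for k
    using assms by (cases k) (auto simp: cons_one_def abs_minus_commute)
  ultimately show ?thesis using vector_matrix_component_le[of _ b A l] assms(2) by metis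
qed

text \<open>The first d coordinates of the nearby integer vector give \<open>a\<close>. Replacing q
  x by \<open>a\<close> before applying \<open>A\<close> costs another
  \<open>coeff_sum A * \<eta>\<close> in the remaining coordinates; the converse below pays in the
  same way.\<close>

lemma approximable_imp_pair:
  fixes A :: "real ^ 'm::finite ^ ('d::finite) option"
  assumes "nearest_int_dist (real q *\<^sub>R graph_map A x) < \<eta>"
  obtains a where "a \<in> int_vectors" "\<And>i. \<bar>real q * x $ i - a $ i\<bar> \<le> \<eta>"
    "near_int ((1 + coeff_sum A) * \<eta>) (qvec q a v* A)"
proof -
  obtain p where p: "p \<in> int_vectors" "infnorm (real q *\<^sub>R graph_map A x - p) < \<eta>"
    using assms unfolding nearest_int_dist_less_iff by blast
  have comp: "\<bar>(real q *\<^sub>R graph_map A x - p) $ k\<bar> \<le> \<eta>" for k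
    using component_le_infnorm_cart[of "real q *\<^sub>R graph_map A x - p" k] p(2) by linarith
  define a :: "real ^ 'd" where "a = (\<chi> i. p $ Inl i)"
  have a: "\<bar>real q * x $ i - a $ i\<bar> \<le> \<eta>" for i using comp[of "Inl i"] by (simp add: a_def)
  have \<eta>: "\<eta> \<ge> 0" using p(2) infnorm_pos_le[of "real q *\<^sub>R graph_map A x - p"] by linarith
  show ?thesis
  proof (rule that)
    show "a \<in> int_vectors" using p(1) by (auto simp: int_vectors_def a_def)
    show "\<bar>real q * x $ i - a $ i\<bar> \<le> \<eta>" for i by (rule a)
    show "near_int ((1 + coeff_sum A) * \<eta>) (qvec q a v* A)"
      unfolding near_int_def
    proof (intro bexI[of _ "\<chi> l. p $ Inr l"] allI)
      fix l
      have "\<bar>real q * (cons_one x v* A) $ l - p $ Inr l\<bar> \<le> \<eta>" using comp[of "Inr l"] by simp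
      then show "\<bar>(qvec q a v* A) $ l - (\<chi> l. p $ Inr l) $ l\<bar> \<le> (1 + coeff_sum A) * \<eta>"
        using qvec_matrix_close[OF a \<eta>, of A l] by (simp add: distrib_right)
    qed (use p(1) in \<open>auto simp: int_vectors_def\<close>)
  qed
qed

lemma pair_imp_approximable:
  fixes A :: "real ^ 'm::finite ^ ('d::finite) option"
  assumes a: "a \<in> int_vectors" "\<And>i. \<bar>real q * x $ i - a $ i\<bar> \<le> b" "b \<ge> 0" and near: "near_int \<delta> (qvec q a v* A)"
    and small: "b < \<eta>" "\<delta> + coeff_sum A * b < \<eta>"
  shows "nearest_int_dist (real q *\<^sub>R graph_map A x) < \<eta>"
proof -
  obtain p where p: "p \<in> int_vectors" "\<And>l. \<bar>(qvec q a v* A) $ l - p $ l\<bar> \<le> \<delta>"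
    using near unfolding near_int_def by blast
  let ?z = "vec_append a p"
  have "infnorm (real q *\<^sub>R graph_map A x - ?z) \<le> max b (\<delta> + coeff_sum A * b)"
  proof (rule infnorm_le_cart)
    fix k
    show "\<bar>(real q *\<^sub>R graph_map A x - ?z) $ k\<bar> \<le> max b (\<delta> + coeff_sum A * b)"
    proof (cases k)
      case (Inl i)
      then show ?thesis using a(2)[of i] by (simp add: vec_append_def)
    next
      case (Inr l)
      have "\<bar>real q * (cons_one x v* A) $ l - p $ l\<bar> \<le> \<delta> + coeff_sum A * b"
        using qvec_matrix_close[OF a(2,3), of A l] p(2)[of l] by linarith
      then show ?thesis by (simp add: Inr vec_append_def)
    qed
  qed
  also have "\<dots> < \<eta>" using small by simp
  finally have "infnorm (real q *\<^sub>R graph_map A x - ?z) < \<eta>" .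
  moreover have "?z \<in> int_vectors"
    using a(1) p(1) by (auto simp: int_vectors_def vec_append_def split: sum.split)
  ultimately show ?thesis unfolding nearest_int_dist_less_iff by blast
qed

definition graph_lip :: "real ^ 'm::finite ^ ('d::finite) option \<Rightarrow> real" where
  "graph_lip A = real CARD('d + 'm) * (1 + coeff_sum A)"

lemma graph_map_lipschitz: "dist (graph_map A x) (graph_map A y) \<le> graph_lip A * dist x y"
  for A :: "real ^ 'm::finite ^ ('d::finite) option"
proof -
  have comp: "\<bar>x $ i - y $ i\<bar> \<le> dist x y" for i
    using component_le_norm_cart[of "x - y" i] by (simp add: dist_norm)
  have "\<bar>(graph_map A x - graph_map A y) $ k\<bar> \<le> (1 + coeff_sum A) * dist x y" for k
  proof (cases k)
    case (Inl i)
    have "0 \<le> coeff_sum A * dist x y" using coeff_sum_nonneg[of A] by simp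
    then show ?thesis using comp[of i] by (simp add: Inl distrib_right)
  next
    case (Inr l)
    have "(graph_map A x - graph_map A y) $ k = ((cons_one x - cons_one y) v* A) $ l"
      by (simp add: Inr vector_matrix_mult_def sum_subtractf left_diff_distrib)
    moreover have "\<bar>(cons_one x - cons_one y) $ k\<bar> \<le> dist x y" for k
      using comp by (cases k) (auto simp: cons_one_def)
    ultimately have "\<bar>(graph_map A x - graph_map A y) $ k\<bar> \<le> coeff_sum A * dist x y"
      using vector_matrix_component_le[of _ "dist x y" A l] by (metis zero_le_dist)
    moreover have "(1 + coeff_sum A) * dist x y = dist x y + coeff_sum A * dist x y" by (simp add: distrib_right)
    ultimately show ?thesis using zero_le_dist[of x y] by linarith
  qed
  then have "norm (graph_map A x - graph_map A y) \<le> real CARD('d + 'm) * ((1 + coeff_sum A) * dist x y)"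
    by (rule norm_le_card_mult)
  then show ?thesis by (simp add: dist_norm graph_lip_def mult.assoc)
qed

lemma graph_lip_nonneg: "graph_lip A \<ge> 0"
  using coeff_sum_nonneg[of A] by (simp add: graph_lip_def)

lemma graph_image_cball:
  assumes "t \<ge> 0"
  shows "bounded (graph_map A ` cball p t)" "diameter (graph_map A ` cball p t) \<le> graph_lip A * (2 * t)"
proof -
  have le: "dist (graph_map A x) (graph_map A y) \<le> graph_lip A * (2 * t)" if "x \<in> cball p t" "y \<in> cball p t" for x y
  proof -
    have "dist x y \<le> 2 * t" using that dist_triangle2[of x y p] by (simp add: dist_commute)
    then have "graph_lip A * dist x y \<le> graph_lip A * (2 * t)" using graph_lip_nonneg[of A] by (intro mult_left_mono)
    then show ?thesis using graph_map_lipschitz[of A x y] by simp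
  qed
  have "p \<in> cball p t" using assms by simp
  then show "bounded (graph_map A ` cball p t)"
    unfolding bounded_def using le by (intro exI[of _ "graph_map A p"] exI[of _ "graph_lip A * (2 * t)"]) blast
  show "diameter (graph_map A ` cball p t) \<le> graph_lip A * (2 * t)"
    using le assms graph_lip_nonneg[of A] by (intro diameter_le) (auto simp: dist_norm)
qed

lemma summable_two_power_powr: "a < 0 \<Longrightarrow> summable (\<lambda>k. ((2::real) ^ k) powr a)"
  unfolding two_power_powr by (rule summable_geometric) (simp add: powr_less_one)

text \<open>At dyadic denominators \<psi> is raised to \<Psi>, which only enlarges the set. The
  bound on \<open>s\<close> keeps the series convergent, and \<Psi> is thick enough for the counting
  lemma. Level \<open>k\<close> then needs about \<Psi>^m 2^(k(d+1)) balls of radius about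
  \<Psi>/2^k, and their cost is a multiple of \<open>T k\<close>.\<close>

lemma hausdorff_measure_convergence:
  fixes A :: "real ^ 'm::finite ^ ('d::finite) option" and \<psi> :: "nat \<Rightarrow> real"
  assumes A: "dioph_bound c w A" "c > 0" "w > 0" and \<tau>: "0 < \<tau>1" "\<tau>1 < \<tau>" "w * \<tau> < 1"
    and s: "s > 0" "s \<le> real CARD('d)" "real CARD('d) + 1 - s < (real CARD('m) + s) * \<tau>1"
    and pos: "\<And>q. q \<ge> 1 \<Longrightarrow> \<psi> q > 0" and anti: "antimono_on {1..} \<psi>"
    and conv: "summable (\<lambda>k. \<psi> (2 ^ k) powr (real CARD('m) + s) * (2 ^ k) powr (real CARD('d) - s + 1))"
  shows "hausdorff_measure s (approximable \<psi> \<inter> affine_graph A) = 0"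
proof -
  let ?d = "CARD('d)" and ?m = "CARD('m)"
  let ?L = "local_const TYPE('m) TYPE('d)"
  have L0: "?L \<ge> 0" by (rule local_const_nonneg)
  define \<alpha> where "\<alpha> = real ?m + s"
  define \<gamma> where "\<gamma> = real ?d - s + 1"
  have \<alpha>: "\<alpha> > 0" and \<gamma>: "\<gamma> > 0" using s by (auto simp: \<alpha>_def \<gamma>_def add_nonneg_pos)
  define CA where "CA = 1 + coeff_sum A"
  have CA: "CA \<ge> 1" using coeff_sum_nonneg[of A] by (simp add: CA_def)
  define \<Psi> where "\<Psi> k = max (\<psi> (2 ^ k)) ((2 ^ k) powr (- \<tau>1))" for k
  have \<Psi>0: "\<Psi> k > 0" for k by (simp add: \<Psi>_def less_max_iff_disj)
  define T where "T k = \<Psi> k powr \<alpha> * (2 ^ k) powr \<gamma>" for k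
  have T: "summable T"
  proof (rule summable_comparison_test')
    show "summable (\<lambda>k. \<psi> (2 ^ k) powr \<alpha> * (2 ^ k) powr \<gamma> + (2 ^ k) powr (\<gamma> - \<alpha> * \<tau>1))"
      using conv s(3) unfolding \<alpha>_def \<gamma>_def by (intro summable_add summable_two_power_powr) auto
    fix k :: nat
    have e1: "((2 ^ k) powr (- \<tau>1)) powr \<alpha> * (2 ^ k) powr \<gamma> = (2 ^ k :: real) powr (\<gamma> - \<alpha> * \<tau>1)"
      by (simp add: powr_powr powr_add[symmetric] algebra_simps)
    have "\<Psi> k powr \<alpha> \<le> \<psi> (2 ^ k) powr \<alpha> + ((2 ^ k) powr (- \<tau>1)) powr \<alpha>"
      by (simp add: \<Psi>_def max_def)
    then have "T k \<le> (\<psi> (2 ^ k) powr \<alpha> + ((2 ^ k) powr (- \<tau>1)) powr \<alpha>) * (2 ^ k) powr \<gamma>"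
      unfolding T_def by (intro mult_right_mono) auto
    also have "\<dots> = \<psi> (2 ^ k) powr \<alpha> * (2 ^ k) powr \<gamma> + (2 ^ k) powr (\<gamma> - \<alpha> * \<tau>1)"
      by (simp only: distrib_right e1)
    finally show "norm (T k) \<le> \<psi> (2 ^ k) powr \<alpha> * (2 ^ k) powr \<gamma> + (2 ^ k) powr (\<gamma> - \<alpha> * \<tau>1)"
      by (simp add: T_def)
  qed
  have \<Psi>lim: "\<Psi> \<longlonglongrightarrow> 0"
  proof (rule LIMSEQ_I)
    fix e :: real assume e: "e > 0"
    have "eventually (\<lambda>k. T k < e powr \<alpha>) sequentially"
      using summable_LIMSEQ_zero[OF T] e by (intro order_tendstoD(2)) auto
    then obtain K where K: "\<And>k. k \<ge> K \<Longrightarrow> T k < e powr \<alpha>" unfolding eventually_sequentially by blast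
    have "norm (\<Psi> k - 0) < e" if "k \<ge> K" for k
    proof -
      have "\<Psi> k powr \<alpha> * 1 \<le> T k"
        unfolding T_def using \<gamma> by (intro mult_left_mono ge_one_powr_ge_zero) auto
      then have "\<Psi> k powr \<alpha> < e powr \<alpha>" using K[OF that] by simp
      then have "\<Psi> k < e" using \<alpha> \<Psi>0[of k] e powr_mono2[of \<alpha> e "\<Psi> k"] by (meson less_imp_le not_le)
      then show ?thesis using \<Psi>0[of k] by simp
    qed
    then show "\<exists>no. \<forall>n\<ge>no. norm (\<Psi> n - 0) < e" by blast
  qed
  \<comment> \<open>Bounded pieces, because rational points are counted over a ball, here around the
    origin.\<close>
  define E where "E M = {graph_map A x | x. \<forall>i. \<bar>x $ i\<bar> \<le> real M} \<inter> approximable \<psi>" for M :: nat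
  have "\<exists>U. fine_cover s \<delta>' \<epsilon> (E M) U" if de: "\<delta>' > 0" "\<epsilon> > 0" for M \<delta>' \<epsilon>
  proof -
    \<comment> \<open>The additional 1 absorbs the distance between \<open>a\<close> and q x, which
      is at most \<Psi> < 1.\<close>
    define R where "R = real M + 1"
    have R: "R > 0" by (simp add: R_def)
    obtain i0 :: nat where i0: "\<And>i \<delta>. i \<ge> i0 \<Longrightarrow> (2 ^ i) powr (- \<tau>1) \<le> \<delta> \<Longrightarrow> \<delta> \<le> 1 / (32 * real CARD('m)) \<Longrightarrow>
      real (card (approx_pairs A \<delta> 0 (2 ^ (i + 1)) (2 ^ (i + 1) * R)))
        \<le> ?L * \<delta> ^ CARD('m) * (2 ^ i) ^ (CARD('d) + 1) * R ^ CARD('d)"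
      by (rule card_approx_pairs_le[OF A \<tau> R, where x = 0]) blast
    have "eventually (\<lambda>k. \<Psi> k < 1) sequentially" using \<Psi>lim by (rule order_tendstoD(2)) simp
    moreover have "eventually (\<lambda>k. \<Psi> k < 1 / (32 * real ?m) / CA) sequentially"
      using \<Psi>lim by (rule order_tendstoD(2)) (use CA in simp)
    ultimately have "eventually (\<lambda>k. \<Psi> k < 1 \<and> \<Psi> k < 1 / (32 * real ?m) / CA \<and> i0 \<le> k) sequentially"
      using eventually_ge_at_top[of i0] by eventually_elim simp
    then obtain K0 where K0: "\<And>k. k \<ge> K0 \<Longrightarrow> \<Psi> k < 1" "\<And>k. k \<ge> K0 \<Longrightarrow> \<Psi> k < 1 / (32 * real ?m) / CA"
      "\<And>k. k \<ge> K0 \<Longrightarrow> i0 \<le> k" unfolding eventually_sequentially by blast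
    define X where "X k = approx_pairs A (CA * \<Psi> k) 0 (2 ^ (k + 1)) (2 ^ (k + 1) * R)" for k :: nat
    define rad where "rad k = real ?d * \<Psi> k / 2 ^ k" for k
    have rad0: "rad k \<ge> 0" for k using \<Psi>0[of k] by (simp add: rad_def)
    \<comment> \<open>Below \<open>K0\<close> the counting bound need not apply. Empty families do
      no harm there, as a limsup set only requires high levels.\<close>
    define C where "C k = (if k < K0 then {} else (\<lambda>(q, a). graph_map A ` cball ((1 / real q) *\<^sub>R a) (rad k)) ` X k)" for k
    define t where "t k = graph_lip A * (2 * rad k)" for k
    have finX: "finite (X k)" for k unfolding X_def by (rule finite_approx_pairs)
    have t0: "t k \<ge> 0" for k unfolding t_def using graph_lip_nonneg[of A] rad0[of k] by simp
    show ?thesis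
    proof (rule fine_cover_limsup[OF s(1) _ _ _ _ _ _ de, of C t "E M"])
      show "finite (C k)" for k using finX by (simp add: C_def)
      show "bounded U" "diameter U \<le> t k" if "U \<in> C k" for U k
        using that graph_image_cball[OF rad0, of A _ k] by (auto simp: C_def t_def split: if_splits)
      have "(\<lambda>k. (2 * graph_lip A * real ?d) * (\<Psi> k * (1/2) ^ k)) \<longlonglongrightarrow> (2 * graph_lip A * real ?d) * (0 * 0)"
        by (intro tendsto_mult_left tendsto_mult \<Psi>lim LIMSEQ_power_zero) simp
      then show "t \<longlonglongrightarrow> 0" by (simp add: t_def[abs_def] rad_def power_one_over mult_ac)
      show "summable (\<lambda>k. real (card (C k)) * t k powr s)"
      proof (rule summable_comparison_test'[of _ K0])
        define cst where "cst = ?L * CA ^ ?m * R ^ ?d * (2 * graph_lip A * real ?d) powr s"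
        show "summable (\<lambda>k. cst * T k)" using T by (rule summable_mult)
        fix k assume k: "k \<ge> K0"
        have "card (C k) \<le> card (X k)" using k finX by (auto simp: C_def intro!: card_image_le)
        then have "real (card (C k)) \<le> real (card (X k))" by simp
        also have "\<dots> \<le> ?L * (CA * \<Psi> k) ^ ?m * (2 ^ k) ^ (?d + 1) * R ^ ?d"
          unfolding X_def
        proof (rule i0)
          show "i0 \<le> k" by (rule K0(3)[OF k])
          have "(2 ^ k) powr (- \<tau>1) \<le> 1 * \<Psi> k" by (simp add: \<Psi>_def)
          also have "\<dots> \<le> CA * \<Psi> k" using CA \<Psi>0[of k] by (intro mult_right_mono) auto
          finally show "(2 ^ k) powr (- \<tau>1) \<le> CA * \<Psi> k" .
          have "CA > 0" using CA by simp
          then have "\<Psi> k * CA < 1 / (32 * real ?m)" using K0(2)[OF k] by (simp only: pos_less_divide_eq)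
          then show "CA * \<Psi> k \<le> 1 / (32 * real ?m)" by (simp add: mult.commute)
        qed
        finally have "real (card (C k)) * t k powr s \<le> ?L * (CA * \<Psi> k) ^ ?m * (2 ^ k) ^ (?d + 1) * R ^ ?d * t k powr s"
          by (rule mult_right_mono) simp
        also have "\<dots> = cst * (\<Psi> k ^ ?m * (2 ^ k) ^ (?d + 1) * (\<Psi> k / 2 ^ k) powr s)"
        proof -
          have "t k = (2 * graph_lip A * real ?d) * (\<Psi> k / 2 ^ k)" by (simp add: t_def rad_def)
          then have "t k powr s = (2 * graph_lip A * real ?d) powr s * (\<Psi> k / 2 ^ k) powr s"
            using graph_lip_nonneg[of A] \<Psi>0[of k] by (simp only:) (intro powr_mult; simp)
          then show ?thesis by (simp add: cst_def power_mult_distrib mult_ac)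
        qed
        also have "\<Psi> k ^ ?m * (2 ^ k) ^ (?d + 1) * (\<Psi> k / 2 ^ k) powr s = T k"
        proof -
          have "\<Psi> k ^ ?m = \<Psi> k powr real ?m" using \<Psi>0[of k] by (simp add: powr_realpow)
          moreover have "((2::real) ^ k) ^ (?d + 1) = (2 ^ k) powr (real ?d + 1)"
            by (subst powr_realpow[symmetric]) (auto simp: add.commute)
          moreover have "(\<Psi> k / 2 ^ k) powr s = \<Psi> k powr s / (2 ^ k) powr s"
            by (rule powr_divide)
          moreover have "\<gamma> = real ?d + 1 - s" by (simp add: \<gamma>_def)
          ultimately show ?thesis by (simp add: T_def \<alpha>_def powr_add powr_diff)
        qed
        finally show "norm (real (card (C k)) * t k powr s) \<le> cst * T k" by simp
      qed
      show "\<exists>k\<ge>K. y \<in> \<Union> (C k)" if y: "y \<in> E M" for y K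
      proof -
        obtain x where x: "y = graph_map A x" "\<And>i. \<bar>x $ i\<bar> \<le> real M" "y \<in> approximable \<psi>"
          using y by (auto simp: E_def)
        have inf: "infinite {q::nat. q \<ge> 1 \<and> nearest_int_dist (real q *\<^sub>R y) < \<psi> q}"
          using x(3) by (simp add: approximable_def)
        obtain q where q: "q \<ge> 2 ^ max K K0" "q \<ge> 1" "nearest_int_dist (real q *\<^sub>R y) < \<psi> q"
          using inf unfolding infinite_nat_iff_unbounded_le by blast
        obtain k where k: "2 ^ k \<le> q" "q < 2 ^ (k + 1)" using ex_power_ivl1[of 2 q] q(2) by auto
        have "(2::nat) ^ max K K0 < 2 ^ (k + 1)" using q k by linarith
        then have "max K K0 < k + 1" by (rule power_less_imp_less_exp[rotated]) simp
        then have kK: "K \<le> k" "K0 \<le> k" by simp_all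
        have "\<psi> q \<le> \<psi> (2 ^ k)" using anti k(1) q(2) by (auto simp: monotone_on_def)
        also have "\<dots> \<le> \<Psi> k" by (simp add: \<Psi>_def)
        finally have "nearest_int_dist (real q *\<^sub>R graph_map A x) < \<Psi> k" using q(3) x(1) by simp
        then obtain a where a: "a \<in> int_vectors" "\<And>i. \<bar>real q * x $ i - a $ i\<bar> \<le> \<Psi> k"
          "near_int (CA * \<Psi> k) (qvec q a v* A)"
          unfolding CA_def by (rule approximable_imp_pair) blast
        have "real (2 ^ k) \<le> real q" "real q \<le> real (2 ^ (k + 1))"
          using k by (auto intro!: of_nat_mono simp del: of_nat_power of_nat_add power_add)
        then have qr: "2 ^ k \<le> real q" "real q \<le> 2 ^ (k + 1)" by simp_all
        have "\<bar>a $ i - real q * 0 $ i\<bar> \<le> 2 ^ (k + 1) * R" for i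
        proof -
          have "\<bar>real q * x $ i\<bar> \<le> 2 ^ (k + 1) * real M"
            unfolding abs_mult using qr x(2)[of i] by (intro mult_mono) auto
          then have "\<bar>a $ i\<bar> \<le> 2 ^ (k + 1) * real M + 1" using a(2)[of i] K0(1)[OF kK(2)] by linarith
          also have "\<dots> \<le> 2 ^ (k + 1) * real M + 2 ^ (k + 1)" by (intro add_left_mono one_le_power) simp
          also have "\<dots> = 2 ^ (k + 1) * R" by (simp add: R_def algebra_simps)
          finally show ?thesis by simp
        qed
        then have qX: "(q, a) \<in> X k" using a q qr by (simp add: X_def approx_pairs_def)
        have "dist ((1 / real q) *\<^sub>R a) x \<le> real ?d * \<Psi> k / real q" by (rule dist_scaled_le[OF q(2) a(2)])
        also have "\<dots> \<le> rad k" unfolding rad_def using qr \<Psi>0[of k] q(2) by (intro divide_left_mono) auto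
        finally have "y \<in> graph_map A ` cball ((1 / real q) *\<^sub>R a) (rad k)" unfolding x(1) by simp
        then have "y \<in> \<Union> (C k)" using qX kK(2) unfolding C_def by force
        then show ?thesis using kK by blast
      qed
    qed blast
  qed
  then have "hausdorff_measure s (\<Union>M. E M) = 0" by (rule hausdorff_measure_zero)
  moreover have "approximable \<psi> \<inter> affine_graph A = (\<Union>M. E M)"
  proof -
    have "\<exists>M::nat. \<forall>i. \<bar>x $ i\<bar> \<le> real M" for x :: "real ^ 'd"
    proof -
      obtain M :: nat where "infnorm x \<le> real M" using real_arch_simple by blast
      then show ?thesis using component_le_infnorm_cart[of x] by (meson order.trans)
    qed
    then show ?thesis unfolding affine_graph_eq E_def by blast
  qed
  ultimately show ?thesis by simp
qed

section \<open>Divergence\<close>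

text \<open>Unit balls with centres 4 apart along an axis: a set of diameter at most 1 meets no more
  than one of them. The first \<open>J\<close> sets therefore spoil finitely many balls, and any
  other ball meets only sets of the tail, whose s-cost is at most \<epsilon>.\<close>

lemma exists_light_ball:
  fixes U :: "nat \<Rightarrow> 'a::euclidean_space set"
  assumes s: "0 < s" "s \<le> real DIM('a)"
    and u: "\<And>j. 0 < u j" "\<And>j. u j \<le> 1" "summable (\<lambda>j. u j powr s)"
    and diam: "\<And>j a b. a \<in> U j \<Longrightarrow> b \<in> U j \<Longrightarrow> dist a b \<le> u j"
    and \<epsilon>: "\<epsilon> > 0"
  obtains x where "light U u \<epsilon> x 1"
proof -
  obtain b :: 'a where b: "b \<in> Basis" using nonempty_Basis by blast
  define x where "x N = (4 * real N) *\<^sub>R b" for N :: nat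
  have far: "dist (x N) (x N') \<ge> 4" if "N \<noteq> N'" for N N'
  proof -
    have "x N - x N' = (4 * (real N - real N')) *\<^sub>R b" by (simp add: x_def algebra_simps)
    then have "dist (x N) (x N') = \<bar>4 * (real N - real N')\<bar>"
      by (simp only: dist_norm norm_scaleR norm_Basis[OF b] mult_1_right)
    then have "dist (x N) (x N') = 4 * \<bar>real N - real N'\<bar>" by (simp only: abs_mult abs_numeral)
    moreover have "\<bar>real N - real N'\<bar> \<ge> 1" using that by linarith
    ultimately show ?thesis by simp
  qed
  obtain J where J: "\<And>F. finite F \<Longrightarrow> (\<And>j. j \<in> F \<Longrightarrow> j \<ge> J) \<Longrightarrow> (\<Sum>j\<in>F. u j powr s) \<le> \<epsilon>"
    using summable_tail_finite_sums[OF u(3) _ \<epsilon>] by auto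
  define meets where "meets N j \<longleftrightarrow> U j \<inter> cball (x N) 1 \<noteq> {}" for N j
  have unique: "N = N'" if mt: "meets N j" "meets N' j" for N N' j
  proof (rule ccontr)
    assume "N \<noteq> N'"
    obtain a a' where a: "a \<in> U j" "dist (x N) a \<le> 1" and a': "a' \<in> U j" "dist (x N') a' \<le> 1"
      using mt unfolding meets_def by auto
    have "dist (x N) (x N') \<le> dist (x N) a + (dist a a' + dist a' (x N'))"
      using dist_triangle[of "x N" "x N'" a] dist_triangle[of a "x N'" a'] by linarith
    also have "\<dots> \<le> 3" using a a' diam[OF a(1) a'(1)] u(2)[of j] by (simp add: dist_commute)
    finally show False using far[OF \<open>N \<noteq> N'\<close>] by simp
  qed
  have "finite {N. \<exists>j<J. meets N j}"
  proof -
    have "{N. meets N j} \<subseteq> {THE N. meets N j}" for j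
    proof
      fix N assume "N \<in> {N. meets N j}"
      then have "meets N j" by simp
      then have "(THE N. meets N j) = N" using unique by (intro the_equality) auto
      then show "N \<in> {THE N. meets N j}" by simp
    qed
    then have "finite {N. meets N j}" for j by (rule finite_subset) simp
    moreover have "{N. \<exists>j<J. meets N j} = (\<Union>j\<in>{..<J}. {N. meets N j})" by blast
    ultimately show ?thesis by simp
  qed
  then obtain N where N: "N \<notin> {N. \<exists>j<J. meets N j}" using ex_new_if_finite infinite_UNIV_nat by blast
  have "light U u \<epsilon> (x N) 1"
    unfolding light_def
  proof (intro allI impI)
    fix F assume F: "finite F" "\<forall>j\<in>F. U j \<inter> cball (x N) 1 \<noteq> {}"
    have "(\<Sum>j\<in>F. u j ^ DIM('a)) \<le> (\<Sum>j\<in>F. u j powr s)"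
    proof (rule sum_mono)
      fix j
      have "u j ^ DIM('a) = u j powr real DIM('a)" using u(1)[of j] by (simp add: powr_realpow)
      also have "\<dots> \<le> u j powr s" using u(1)[of j] u(2)[of j] s by (intro powr_mono') auto
      finally show "u j ^ DIM('a) \<le> u j powr s" .
    qed
    also have "\<dots> \<le> \<epsilon>"
    proof (rule J[OF F(1)])
      fix j assume "j \<in> F"
      then have "meets N j" using F(2) by (simp add: meets_def)
      then show "J \<le> j" using N by (cases "j < J") auto
    qed
    finally show "(\<Sum>j\<in>F. u j ^ DIM('a)) \<le> \<epsilon> * 1 ^ DIM('a)" by simp
  qed
  then show ?thesis by (rule that)
qed

lemma not_summable_window:
  fixes f :: "nat \<Rightarrow> real"
  assumes "\<not> summable f" "\<And>k. f k \<ge> 0"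
  shows "\<exists>N. 1 \<le> sum f {K..<N}"
proof (rule ccontr)
  assume "\<nexists>N. 1 \<le> sum f {K..<N}"
  then have lt: "sum f {K..<N} < 1" for N by (simp add: not_le)
  have "summable (\<lambda>k. f (k + K))"
  proof (rule summableI_nonneg_bounded)
    fix n
    have "(\<Sum>k<n. f (k + K)) = sum f {K..<n + K}"
      by (simp add: sum.shift_bounds_nat_ivl[of f 0 K n, simplified] lessThan_atLeast0)
    then show "(\<Sum>k<n. f (k + K)) \<le> 1" using lt[of "n + K"] by simp
  qed (rule assms)
  then show False using assms(1) by (simp only: summable_iff_shift)
qed

text \<open>Projection to the first d coordinates does not increase distances, so a cover of finite
  cost in the ambient space projects to one in the parameter space. A parameter left uncovered there
  lifts to an approximable point outside the cover.\<close>

lemma hausdorff_measure_divergence: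
  fixes A :: "real ^ 'm::finite ^ ('d::finite) option" and \<psi> :: "nat \<Rightarrow> real"
  assumes A: "dioph_bound c w A" "c > 0" "w > 0"
    and \<tau>: "0 < \<tau>1" "\<tau>1 < \<tau>2" "\<tau>2 < \<tau>" "w * \<tau> < 1" "real CARD('m) * \<tau>2 < 1"
    and s: "s > 0" "s \<le> real CARD('d)" "real CARD('d) + 1 - s < (real CARD('m) + s) * \<tau>1"
    and pos: "\<And>q. q \<ge> 1 \<Longrightarrow> \<psi> q > 0" and anti: "antimono_on {1..} \<psi>"
    and div: "\<not> summable (\<lambda>k. \<psi> (2 ^ k) powr (real CARD('m) + s) * (2 ^ k) powr (real CARD('d) - s + 1))"
  shows "hausdorff_measure s (approximable \<psi> \<inter> affine_graph A) = \<infinity>"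
proof -
  let ?d = "CARD('d)" and ?m = "CARD('m)"
  define \<alpha> where "\<alpha> = real ?m + s"
  define \<gamma> where "\<gamma> = real ?d - s + 1"
  have \<alpha>: "\<alpha> > 0" and \<gamma>: "\<gamma> > 0" using s by (auto simp: \<alpha>_def \<gamma>_def add_nonneg_pos)
  \<comment> \<open>Truncating \<psi> at q^(-\<nu>) forces \<delta> to 0, as the counting lemma
    requires. Divergence survives because \<alpha> \<nu> \<le> 1 \<le> \<gamma>: wherever the
    truncation is active, \<open>T k\<close> is bounded away from 0.\<close>
  define \<nu> where "\<nu> = 1 / (real ?d + real ?m)"
  have \<nu>: "\<nu> > 0" by (simp add: \<nu>_def add_pos_pos)
  have \<alpha>\<nu>: "\<alpha> * \<nu> \<le> \<gamma>"
  proof -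
    have "\<alpha> * \<nu> \<le> (real ?d + real ?m) * \<nu>" using s \<nu> by (intro mult_right_mono) (auto simp: \<alpha>_def)
    also have "\<dots> = 1" by (simp add: \<nu>_def add_pos_pos less_imp_neq[symmetric])
    also have "\<dots> \<le> \<gamma>" using s by (simp add: \<gamma>_def)
    finally show ?thesis .
  qed
  \<comment> \<open>The factor 1/4 leaves room for thickness \<delta> plus a propagated error of at
    most \<delta>, with a strict inequality at the end.\<close>
  define \<delta> where "\<delta> k = min (\<psi> (2 ^ k)) ((2 ^ k) powr (- \<nu>)) / 4" for k
  have \<psi>0: "\<psi> (2 ^ k) > 0" for k by (rule pos) simp
  have \<delta>0: "\<delta> k > 0" for k using \<psi>0[of k] by (simp add: \<delta>_def)
  have \<delta>1: "\<delta> k \<le> 1" for k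
  proof -
    have "(2 ^ k) powr (- \<nu>) \<le> (1::real)" using \<nu> by (simp add: powr_minus_divide ge_one_powr_ge_zero)
    then show ?thesis unfolding \<delta>_def by linarith
  qed
  have \<delta>anti: "\<delta> k' \<le> \<delta> k" if "k \<le> k'" for k k'
  proof -
    have "(2::nat) ^ k \<le> 2 ^ k'" using that by (intro power_increasing) auto
    then have "\<psi> (2 ^ k') \<le> \<psi> (2 ^ k)" using anti by (auto simp: monotone_on_def)
    moreover have "(2 ^ k') powr (- \<nu>) \<le> (2 ^ k :: real) powr (- \<nu>)"
      using that \<nu> by (intro powr_mono2' power_increasing) auto
    ultimately show ?thesis unfolding \<delta>_def by linarith
  qed
  define CA where "CA = 1 + coeff_sum A"
  have CA: "CA \<ge> 1" using coeff_sum_nonneg[of A] by (simp add: CA_def)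
  \<comment> \<open>A parameter within \<open>r k\<close> of a/q with q \<le> 2^k satisfies |q y -
    a| \<le> \<delta>/\<open>CA\<close>, and the division by \<open>CA\<close> keeps the error
    propagated through \<open>A\<close> below \<delta>.\<close>
  define r where "r k = \<delta> k / CA / 2 ^ k" for k
  define T where "T k = \<delta> k powr \<alpha> * (2 ^ k) powr \<gamma>" for k
  have T0: "T k \<ge> 0" for k by (simp add: T_def)
  have notT: "\<not> summable T"
  proof
    assume T: "summable T"
    have "eventually (\<lambda>k. T k < (1/4) powr \<alpha>) sequentially"
      using summable_LIMSEQ_zero[OF T] by (rule order_tendstoD(2)) simp
    then have "eventually (\<lambda>k. \<psi> (2 ^ k) powr \<alpha> * (2 ^ k) powr \<gamma> = 4 powr \<alpha> * T k) sequentially"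
    proof eventually_elim
      case (elim k)
      have "\<psi> (2 ^ k) < (2 ^ k) powr (- \<nu>)"
      proof (rule ccontr)
        assume "\<not> \<psi> (2 ^ k) < (2 ^ k) powr (- \<nu>)"
        then have "\<delta> k = (2 ^ k) powr (- \<nu>) * (1/4)" by (simp add: \<delta>_def)
        then have "\<delta> k powr \<alpha> = (2 ^ k) powr (- (\<alpha> * \<nu>)) * (1/4) powr \<alpha>"
          by (simp only: powr_mult powr_powr) (simp add: mult.commute)
        then have "T k = (1/4) powr \<alpha> * (2 ^ k) powr (\<gamma> - \<alpha> * \<nu>)"
          by (simp add: T_def powr_diff powr_minus_divide)
        moreover have "(1/4) powr \<alpha> * 1 \<le> (1/4) powr \<alpha> * (2 ^ k) powr (\<gamma> - \<alpha> * \<nu>)"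
          using \<alpha>\<nu> by (intro mult_left_mono ge_one_powr_ge_zero) auto
        ultimately show False using elim by simp
      qed
      then have "\<psi> (2 ^ k) = 4 * \<delta> k" by (simp add: \<delta>_def)
      then show ?case by (simp add: T_def powr_mult)
    qed
    moreover have "summable (\<lambda>k. 4 powr \<alpha> * T k)" using T by (rule summable_mult)
    ultimately have "summable (\<lambda>k. \<psi> (2 ^ k) powr \<alpha> * (2 ^ k) powr \<gamma>)"
      by (simp only: summable_cong)
    then show False using div by (simp add: \<alpha>_def \<gamma>_def)
  qed
  obtain k1 where k1: "\<And>k. k \<ge> k1 \<Longrightarrow> \<delta> k \<le> 1 / (32 * real ?m)"
  proof -
    have "2 powr (- \<nu>) < (1::real)" using \<nu> by (simp add: powr_less_one)
    then have "(\<lambda>k. (2 powr (- \<nu>)) ^ k) \<longlonglongrightarrow> 0" by (intro LIMSEQ_power_zero) simp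
    then have "eventually (\<lambda>k. (2 powr (- \<nu>)) ^ k < 1 / (32 * real ?m)) sequentially"
      by (rule order_tendstoD(2)) simp
    then obtain k1 where k1: "\<And>k. k \<ge> k1 \<Longrightarrow> (2 powr (- \<nu>)) ^ k < 1 / (32 * real ?m)"
      unfolding eventually_sequentially by blast
    show ?thesis
    proof (rule that[of k1])
      fix k assume "k \<ge> k1"
      have "\<delta> k \<le> (2 powr (- \<nu>)) ^ k" using \<psi>0[of k] by (auto simp: \<delta>_def two_power_powr min_def)
      then show "\<delta> k \<le> 1 / (32 * real ?m)" using k1[OF \<open>k \<ge> k1\<close>] by linarith
    qed
  qed
  \<comment> \<open>Levels at which rich sets of rational points are available. Among the other
    levels, all but finitely many have \<delta> below 2^(-k\<open>\<tau>1\<close>), and their terms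
    form a convergent series by the bound on \<open>s\<close>.\<close>
  define I where "I = {k. k1 \<le> k \<and> (2 ^ k) powr (- \<tau>1) \<le> \<delta> k}"
  have notTI: "\<not> summable (\<lambda>k. if k \<in> I then T k else 0)"
  proof
    assume S: "summable (\<lambda>k. if k \<in> I then T k else 0)"
    have "summable T"
    proof (rule summable_comparison_test'[of _ k1])
      show "summable (\<lambda>k. (if k \<in> I then T k else 0) + (2 ^ k) powr (\<gamma> - \<alpha> * \<tau>1))"
        using s(3) by (intro summable_add S summable_two_power_powr) (simp add: \<alpha>_def \<gamma>_def)
      fix k assume k: "k \<ge> k1"
      show "norm (T k) \<le> (if k \<in> I then T k else 0) + (2 ^ k) powr (\<gamma> - \<alpha> * \<tau>1)"
      proof (cases "k \<in> I")
        case True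
        then show ?thesis using T0[of k] by simp
      next
        case False
        then have "\<delta> k \<le> (2 ^ k) powr (- \<tau>1)" using k by (simp add: I_def)
        then have "\<delta> k powr \<alpha> \<le> ((2 ^ k) powr (- \<tau>1)) powr \<alpha>"
          using \<alpha> \<delta>0[of k] by (intro powr_mono2) auto
        then have "T k \<le> ((2 ^ k) powr (- \<tau>1)) powr \<alpha> * (2 ^ k) powr \<gamma>"
          unfolding T_def by (intro mult_right_mono) auto
        also have "\<dots> = (2 ^ k) powr (\<gamma> - \<alpha> * \<tau>1)"
          by (simp add: powr_powr powr_add[symmetric] algebra_simps)
        finally show ?thesis using False T0[of k] by simp
      qed
    qed
    then show False using notT by simp
  qed
  obtain e c0 where c0: "c0 > 0" and rich:
    "\<And>x R. 0 < R \<Longrightarrow> \<exists>K. \<forall>k\<ge>K. \<forall>\<delta>. (2 ^ k) powr (- \<tau>1) \<le> \<delta> \<longrightarrow> \<delta> \<le> 1 / (32 * real CARD('m)) \<longrightarrow>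
       rich_in (rat_points A \<delta> k e) (spacing TYPE('m) TYPE('d) k \<delta>) c0 x R"
    by (rule rich_rational_points[OF A \<tau>]) blast
  define \<rho> where "\<rho> k = spacing TYPE('m) TYPE('d) k (\<delta> k)" for k
  define P where "P k = rat_points A (\<delta> k) k e" for k
  have \<rho>0: "\<rho> k > 0" for k unfolding \<rho>_def using \<delta>0 by (rule spacing_pos)
  have r0: "r k > 0" for k using \<delta>0[of k] CA by (simp add: r_def)
  define cst where "cst = 1 / (CA powr s * 2 ^ (?d + ?m))"
  have cst: "cst > 0" using CA by (simp add: cst_def)
  \<comment> \<open>The spacing was chosen so that \<open>\<rho> k ^ ?d\<close> is a constant times
    the ball volume per expected rational point, 1/(2^(k(d+1)) \<delta>^m). The divergence required
    of the levels is thus that of the given series.\<close>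
  have rT: "r k powr s / \<rho> k ^ ?d = cst * T k" for k
  proof -
    have 1: "(2 ^ k) ^ ?d * \<rho> k ^ ?d = 2 ^ (?d + ?m) / (2 ^ k * \<delta> k ^ ?m)"
      using spacing_power[OF \<delta>0, of k, where 'm = 'm and 'd = 'd] by (simp add: \<rho>_def power_mult_distrib)
    then have 2: "1 / \<rho> k ^ ?d = (2 ^ k) ^ ?d * (2 ^ k * \<delta> k ^ ?m) / 2 ^ (?d + ?m)"
      using \<rho>0[of k] \<delta>0[of k] by (simp add: field_simps)
    have 3: "r k powr s = \<delta> k powr s / (CA powr s * (2 ^ k) powr s)"
      using CA by (simp add: r_def powr_divide powr_mult)
    have 4: "T k = \<delta> k powr s * \<delta> k ^ ?m * ((2 ^ k) ^ ?d * 2 ^ k / (2 ^ k) powr s)"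
    proof -
      have "\<delta> k ^ ?m = \<delta> k powr real ?m" using \<delta>0[of k] by (simp add: powr_realpow)
      moreover have "((2::real) ^ k) ^ ?d = (2 ^ k) powr real ?d" by (simp add: powr_realpow)
      ultimately show ?thesis by (simp add: T_def \<alpha>_def \<gamma>_def powr_add powr_diff)
    qed
    have "r k powr s / \<rho> k ^ ?d = r k powr s * (1 / \<rho> k ^ ?d)" by simp
    also have "\<dots> = cst * T k" unfolding 2 3 4 cst_def by (simp add: mult_ac)
    finally show ?thesis .
  qed
  show ?thesis
  proof (rule hausdorff_measure_infinite[OF s(1), of 1])
    fix U :: "nat \<Rightarrow> (real ^ ('d + 'm)) set"
    assume U: "approximable \<psi> \<inter> affine_graph A \<subseteq> (\<Union>i. U i)" "\<And>i. bounded (U i)" "\<And>i. diameter (U i) \<le> 1"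
    show "\<not> summable (\<lambda>i. diameter (U i) powr s)"
    proof
      assume sm: "summable (\<lambda>i. diameter (U i) powr s)"
      define proj where "proj y = (\<chi> i. y $ Inl i)" for y :: "real ^ ('d + 'm)"
      define U' where "U' j = proj ` U j" for j
      \<comment> \<open>Singletons and empty sets receive a positive weight whose s-th power is
        2^(-j), so the total cost stays finite.\<close>
      define u where "u j = max (diameter (U j)) (2 powr (- real j / s))" for j
      have u0: "u j > 0" for j by (simp add: u_def less_max_iff_disj)
      have u1: "u j \<le> 1" for j 
      proof -
        have "(2::real) powr (- real j / s) \<le> 2 powr 0" using s(1) by (intro powr_mono) auto
        then show ?thesis using U(3)[of j] by (simp add: u_def)
      qed
      have us: "summable (\<lambda>j. u j powr s)"
      proof (rule summable_comparison_test')
        show "summable (\<lambda>j. diameter (U j) powr s + (1/2) ^ j)" by (intro summable_add sm summable_geometric) simp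
        fix j
        have "(2 powr (- real j / s)) powr s = (1/2::real) ^ j"
        proof -
          have "(2 powr (- real j / s)) powr s = 2 powr (- real j)" using s(1) by (simp only: powr_powr) simp
          then show ?thesis by (simp add: powr_minus_divide powr_realpow power_one_over)
        qed
        then have "u j powr s \<le> diameter (U j) powr s + (1/2) ^ j"
          by (auto simp: u_def max_def)
        then show "norm (u j powr s) \<le> diameter (U j) powr s + (1/2) ^ j" by simp
      qed
      have udiam: "dist a b \<le> u j" if ab: "a \<in> U' j" "b \<in> U' j" for a b j
      proof -
        obtain y z where yz: "y \<in> U j" "z \<in> U j" "a = proj y" "b = proj z" using ab by (auto simp: U'_def)
        have "dist a b \<le> dist y z"
        proof -
          have "norm (proj y - proj z) = L2_set (\<lambda>i. (y - z) $ Inl i) UNIV"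
            by (simp add: norm_vec_def proj_def L2_set_def)
          also have "\<dots> = L2_set (\<lambda>k. (y - z) $ k) (range Inl)"
            by (simp add: L2_set_def sum.reindex)
          also have "\<dots> \<le> L2_set (\<lambda>k. (y - z) $ k) UNIV" 
            unfolding L2_set_def by (intro real_sqrt_le_mono sum_mono2) auto
          also have "\<dots> = norm (y - z)" by (simp add: norm_vec_def L2_set_def)
          finally show ?thesis by (simp add: dist_norm yz)
        qed
        also have "\<dots> \<le> diameter (U j)" using U(2) yz by (intro diameter_bounded_bound) auto
        finally show ?thesis by (simp add: u_def)
      qed
      have sD: "s \<le> real DIM(real ^ 'd)" using s by simp
      have "c0 / (4 * 18 ^ DIM(real ^ 'd)) > 0" using c0 by simp
      then obtain x0 where light: "light U' u (c0 / (4 * 18 ^ DIM(real ^ 'd))) x0 1"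
        using exists_light_ball[OF s(1) sD u0 u1 us udiam] by blast
      have "\<exists>y. y \<notin> (\<Union>j. U' j) \<and> (\<forall>K. \<exists>k\<ge>K. \<exists>p\<in>P k. dist p y \<le> r k)"
      proof (rule limsup_balls_not_covered[OF s(1) sD u0 u1 us udiam _ _ _ _ _ c0 _ light, of I r \<rho> P])
        show "0 < r k" for k by (rule r0)
        show "0 < \<rho> k" for k by (rule \<rho>0)
        have \<delta>CA: "\<delta> k / CA \<le> 1" for k using \<delta>1[of k] CA by (simp add: divide_le_eq)
        show "r k \<le> 1 / 2 ^ k" for k unfolding r_def using \<delta>CA by (intro divide_right_mono) auto
        show "r k' \<le> r k / 2 ^ (k' - k)" if "k \<le> k'" for k k'
        proof -
          have "r k' = \<delta> k' / CA / 2 ^ k / 2 ^ (k' - k)" using that by (simp add: r_def flip: power_add)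
          also have "\<dots> \<le> \<delta> k / CA / 2 ^ k / 2 ^ (k' - k)"
            using \<delta>anti[OF that] CA by (intro divide_right_mono) auto
          finally show ?thesis by (simp add: r_def)
        qed
        show "\<exists>W\<subseteq>I. finite W \<and> (\<forall>k\<in>W. K \<le> k) \<and> 1 \<le> (\<Sum>k\<in>W. r k powr s / \<rho> k ^ DIM(real ^ 'd))" for K
        proof -
          have "\<not> summable (\<lambda>k. cst * (if k \<in> I then T k else 0))"
            using notTI cst by (simp add: summable_cmult_iff)
          then obtain N where N: "1 \<le> (\<Sum>k\<in>{K..<N}. cst * (if k \<in> I then T k else 0))"
            using not_summable_window[of "\<lambda>k. cst * (if k \<in> I then T k else 0)" K] cst T0 by auto
          also have "\<dots> = (\<Sum>k\<in>{K..<N} \<inter> I. cst * T k)"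
            by (intro sum.mono_neutral_cong_right) auto
          finally show ?thesis
            by (intro exI[of _ "{K..<N} \<inter> I"]) (simp add: rT)
        qed
        show "\<exists>K. \<forall>k\<in>I. k \<ge> K \<longrightarrow> rich_in (P k) (\<rho> k) c0 x R" if R: "0 < R" for x R
        proof -
          obtain K where K: "\<forall>k\<ge>K. \<forall>\<delta>. (2 ^ k) powr (- \<tau>1) \<le> \<delta> \<longrightarrow> \<delta> \<le> 1 / (32 * real CARD('m)) \<longrightarrow>
              rich_in (rat_points A \<delta> k e) (spacing TYPE('m) TYPE('d) k \<delta>) c0 x R"
            using rich[OF R] by blast
          show ?thesis unfolding P_def \<rho>_def using K k1 by (intro exI[of _ K]) (auto simp: I_def)
        qed
      qed
      then obtain y where y: "y \<notin> (\<Union>j. U' j)" "\<And>K. \<exists>k\<ge>K. \<exists>p\<in>P k. dist p y \<le> r k" by blast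
      have "graph_map A y \<in> approximable \<psi>"
        unfolding approximable_def mem_Collect_eq infinite_nat_iff_unbounded_le
      proof
        fix M :: nat
        \<comment> \<open>Denominators of level \<open>k\<close> are at least 2^(k-e), hence at
          least 2^M; this yields infinitely many \<open>q\<close> although their exact size is
          unknown.\<close>
        obtain k p where k: "k \<ge> M + e" "p \<in> P k" "dist p y \<le> r k" using y(2) by blast
        obtain q a where qa: "p = (1 / real q) *\<^sub>R a" "1 \<le> q" "q \<le> 2 ^ k" "2 ^ k \<le> 2 ^ e * q" "a \<in> int_vectors"
          "near_int (\<delta> k) (qvec q a v* A)" using k(2) unfolding P_def rat_points_def by blast
        have "(2::nat) ^ (M + e) \<le> 2 ^ k" using k(1) by (intro power_increasing) auto
        also note qa(4)
        finally have "2 ^ e * 2 ^ M \<le> 2 ^ e * q" by (simp only: power_add mult.commute)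
        then have "2 ^ M \<le> q" by simp
        then have Mq: "M \<le> q" using less_exp[of M] by linarith
        have b0: "\<delta> k / CA \<ge> 0" using \<delta>0[of k] CA by simp
        have close: "\<bar>real q * y $ i - a $ i\<bar> \<le> \<delta> k / CA" for i
        proof -
          have "\<bar>(p - y) $ i\<bar> \<le> r k" using component_le_norm_cart[of "p - y" i] k(3) by (simp add: dist_norm)
          moreover have "real q \<le> real (2 ^ k)" using qa(3) by (rule of_nat_mono)
          ultimately have "real q * \<bar>(p - y) $ i\<bar> \<le> 2 ^ k * r k" by (intro mult_mono) auto
          moreover have "real q * \<bar>(p - y) $ i\<bar> = \<bar>real q * ((p - y) $ i)\<bar>" by (simp add: abs_mult)
          moreover have "real q * ((p - y) $ i) = a $ i - real q * y $ i" using qa(2) by (simp add: qa(1) field_simps)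
          moreover have "2 ^ k * r k = \<delta> k / CA" by (simp add: r_def)
          ultimately show ?thesis by (simp add: abs_minus_commute)
        qed
        have "4 * \<delta> k \<le> \<psi> (2 ^ k)" by (simp add: \<delta>_def)
        also have "\<psi> (2 ^ k) \<le> \<psi> q" using anti qa(2,3) by (auto simp: monotone_on_def)
        finally have \<psi>q: "4 * \<delta> k \<le> \<psi> q" .
        have CAle: "\<delta> k / CA \<le> \<delta> k" using CA \<delta>0[of k] by (simp add: divide_le_eq)
        have "coeff_sum A * (\<delta> k / CA) \<le> CA * (\<delta> k / CA)" using b0 by (intro mult_right_mono) (auto simp: CA_def)
        also have "\<dots> = \<delta> k" using CA by simp
        finally have CAle2: "coeff_sum A * (\<delta> k / CA) \<le> \<delta> k" .
        have "nearest_int_dist (real q *\<^sub>R graph_map A y) < \<psi> q"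
          by (rule pair_imp_approximable[OF qa(5) close b0 qa(6)]) (use \<psi>q CAle CAle2 \<delta>0[of k] in linarith)+
        then show "\<exists>n\<ge>M. 1 \<le> n \<and> nearest_int_dist (real n *\<^sub>R graph_map A y) < \<psi> n"
          using Mq qa(2) by blast
      qed
      then obtain j where "graph_map A y \<in> U j" using U(1) unfolding affine_graph_eq by blast
      then have "proj (graph_map A y) \<in> U' j" by (simp add: U'_def)
      moreover have "proj (graph_map A y) = y" by (simp add: proj_def vec_eq_iff)
      ultimately show False using y(1) by auto
    qed
  qed simp
qed

theorem corollary2p7:
  fixes A :: "real ^ 'm::finite ^ ('d::finite) option"
    and \<omega> \<tau>\<^sub>0 s :: real
    and \<psi> :: "nat \<Rightarrow> real"
  assumes "diophantine_exponent A = ereal \<omega>"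
    and "\<omega> < real (CARD('d) + CARD('m))"
    and "\<tau>\<^sub>0 = 1 / max (real CARD('m)) \<omega>"
    and "(real CARD('d) + 1 - real CARD('m) * \<tau>\<^sub>0) / (\<tau>\<^sub>0 + 1) < s"
    and "s \<le> real CARD('d)"
    and "\<And>q. q \<ge> 1 \<Longrightarrow> \<psi> q > 0"
    and "antimono_on {1..} \<psi>"
  shows "hausdorff_measure s (approximable \<psi> \<inter> affine_graph A) =
     (if (\<lambda>q. \<psi> q powr (real CARD('m) + s) * real q powr (real CARD('d) - s)) summable_on {1..}
      then 0 else \<infinity>)"
proof -
  let ?d = "real CARD('d)" and ?m = "real CARD('m)"
  have m: "?m \<ge> 1" and d: "?d \<ge> 1" by (simp_all add: Suc_leI)
  define v where "v = max ?m \<omega>"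
  have "?m \<le> v" "\<omega> \<le> v" by (simp_all add: v_def)
  then have v: "v > 0" "?m \<le> v" "\<omega> \<le> v" using m by linarith+
  have \<tau>0: "\<tau>\<^sub>0 = 1 / v" using assms(3) by (simp add: v_def)
  have \<tau>0pos: "\<tau>\<^sub>0 > 0" using v by (simp add: \<tau>0)
  have m\<tau>0: "?m * \<tau>\<^sub>0 \<le> 1" using v by (simp add: \<tau>0)
  \<comment> \<open>As m \<open>\<tau>\<^sub>0\<close> \<le> 1, the lower bound imposed on
    \<open>s\<close> is nonnegative.\<close>
  have s: "s > 0"
  proof -
    have "0 \<le> (?d + 1 - ?m * \<tau>\<^sub>0) / (\<tau>\<^sub>0 + 1)"
      using m\<tau>0 d \<tau>0pos by (intro divide_nonneg_nonneg) linarith+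
    then show ?thesis using assms(4) by linarith
  qed
  have ms: "?m + s > 0" using m s by linarith
  \<comment> \<open>The critical exponent: the series belonging to q^(-t) converges exactly for t >
    \<theta>. Solved for \<open>\<tau>\<^sub>0\<close>, the hypothesis on \<open>s\<close> reads
    \<open>\<theta> < \<tau>\<^sub>0\<close>.\<close>
  define \<theta> where "\<theta> = (?d + 1 - s) / (?m + s)"
  have \<theta>: "0 < \<theta>" using assms(5) ms unfolding \<theta>_def by (intro divide_pos_pos) linarith+
  have \<theta>0: "\<theta> < \<tau>\<^sub>0"
  proof -
    have "?d + 1 - ?m * \<tau>\<^sub>0 < s * (\<tau>\<^sub>0 + 1)"
      using assms(4) \<tau>0pos by (simp add: pos_divide_less_eq)
    then have "?d + 1 - s < \<tau>\<^sub>0 * (?m + s)" by (simp add: algebra_simps)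
    then show ?thesis unfolding \<theta>_def using ms by (simp add: pos_divide_less_eq)
  qed
  \<comment> \<open>Every gap in the chain \<theta> < \<open>\<tau>1\<close> <
    \<open>\<tau>2\<close> < \<tau> < \<open>\<tau>\<^sub>0\<close> is spent: the first on
    convergence of the comparison series, the second on making the enlarged thickness negligible,
    the third on ball-dependent constants in the counting bound, the last on an exponent
    \<open>w > \<omega>\<close> with \<open>w * \<tau> < 1\<close>.\<close>
  obtain \<tau>1 where \<tau>1: "\<theta> < \<tau>1" "\<tau>1 < \<tau>\<^sub>0" using dense[OF \<theta>0] by blast
  obtain \<tau>2 where \<tau>2: "\<tau>1 < \<tau>2" "\<tau>2 < \<tau>\<^sub>0" using dense[OF \<tau>1(2)] by blast
  obtain \<tau> where \<tau>: "\<tau>2 < \<tau>" "\<tau> < \<tau>\<^sub>0" using dense[OF \<tau>2(2)] by blast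
  have \<tau>pos: "0 < \<tau>1" "0 < \<tau>" using \<theta> \<tau>1 \<tau>2 \<tau> by linarith+
  have "v < 1 / \<tau>" using \<tau>(2) \<tau>pos v by (simp add: \<tau>0 field_simps)
  then obtain w where w: "v < w" "w < 1 / \<tau>" using dense by blast
  have w\<tau>: "w * \<tau> < 1" using w(2) \<tau>pos by (simp add: field_simps)
  have w0: "w > 0" using w v by linarith
  have m\<tau>2: "?m * \<tau>2 < 1"
  proof -
    have "?m * \<tau>2 < ?m * \<tau>\<^sub>0" using \<tau>2 m by simp
    then show ?thesis using m\<tau>0 by linarith
  qed
  have key: "?d + 1 - s < (?m + s) * \<tau>1"
  proof -
    have "\<theta> * (?m + s) < \<tau>1 * (?m + s)" using \<tau>1(1) ms by (rule mult_strict_right_mono)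
    moreover have "\<theta> * (?m + s) = ?d + 1 - s" using ms by (simp add: \<theta>_def)
    ultimately show ?thesis by (simp add: mult.commute)
  qed
  have "\<omega> < w" using w v by linarith
  then obtain c where c: "c > 0" "dioph_bound c w A"
    using dioph_bound_exists[OF assms(1)] by blast
  let ?D = "\<lambda>k::nat. \<psi> (2 ^ k) powr (?m + s) * (2 ^ k) powr (?d - s + 1)"
  have iff: "(\<lambda>q. \<psi> q powr (?m + s) * real q powr (?d - s)) summable_on {1..} \<longleftrightarrow> summable ?D"
    using assms(5) ms by (intro summable_on_dyadic_iff assms(6,7)) auto
  show ?thesis
  proof (cases "summable ?D")
    case True
    have "hausdorff_measure s (approximable \<psi> \<inter> affine_graph A) = 0"
      using \<tau>1 \<tau>2 \<tau> by (intro hausdorff_measure_convergence[OF c(2,1) w0 \<tau>pos(1) _ w\<tau> s assms(5) key assms(6,7) True]) auto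
    then show ?thesis using iff True by simp
  next
    case False
    have "hausdorff_measure s (approximable \<psi> \<inter> affine_graph A) = \<infinity>"
      by (rule hausdorff_measure_divergence[OF c(2,1) w0 \<tau>pos(1) \<tau>2(1) \<tau>(1) w\<tau> m\<tau>2 s assms(5) key assms(6,7) False])
    then show ?thesis using iff False by simp
  qed
qed

end
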